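(* Let $(R,\mathfrak m)$ be a Noetherian Cohen--Macaulay local ring of dimension $d$ and let $\Omega$ be an $\mathfrak m$-torsion $R$-module (not necessarily finitely generated). Then $\Omega=0$ if and only if $\beta_d(\Omega)=0$.
   Context: $\beta_i(M)=\dim_k\operatorname{Tor}_i^R(k,M)$ with $k=R/\mathfrak m$. An $R$-module $M$ is $\mathfrak m$-torsion if for each $m\in M$ there is $n>0$ with $\mathfrak m^n m=0$. *)

theory Defs
  imports
    "HOL-Library.Extended_Nat"
    "HOL-Algebra.Ring_Divisibility"
    "HOL-Algebra.QuotRing"
    "HOL-Algebra.Ideal_Product"
    "Jordan_Normal_Form.Missing_VectorSpace"
begin

section \<open>Cohen--Macaulay local rings\<close>

definition local_ring :: "('a, 'r) ring_scheme \<Rightarrow> 'a set \<Rightarrow> bool"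
  where "local_ring R \<mm> \<longleftrightarrow> cring R \<and> {I. maximalideal I R} = {\<mm>}"

definition krull_dim :: "('a, 'r) ring_scheme \<Rightarrow> enat"
  where "krull_dim R =
    Sup {enat n | n. \<exists>P :: nat \<Rightarrow> 'a set.
      (\<forall>i\<le>n. primeideal (P i) R) \<and> (\<forall>i<n. P i \<subset> P (Suc i))}"

definition nonzerodivisor :: "('a, 'r) ring_scheme \<Rightarrow> 'a \<Rightarrow> bool"
  where "nonzerodivisor R x \<longleftrightarrow>
    x \<in> carrier R \<and> (\<forall>y\<in>carrier R. x \<otimes>\<^bsub>R\<^esub> y = \<zero>\<^bsub>R\<^esub> \<longrightarrow> y = \<zero>\<^bsub>R\<^esub>)"

definition regular_sequence :: "('a, 'r) ring_scheme \<Rightarrow> 'a list \<Rightarrow> bool"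
  where "regular_sequence R xs \<longleftrightarrow>
    set xs \<subseteq> carrier R \<and>
    (\<forall>i<length xs.
      let I = genideal R (set (take i xs))
      in nonzerodivisor (R Quot I) (I +>\<^bsub>R\<^esub> xs ! i)) \<and>
    genideal R (set xs) \<noteq> carrier R"

definition depth :: "('a, 'r) ring_scheme \<Rightarrow> 'a set \<Rightarrow> enat"
  where "depth R \<mm> = Sup {enat (length xs) | xs. set xs \<subseteq> \<mm> \<and> regular_sequence R xs}"

text \<open>For a Noetherian local ring \<open>(R, \<mm>)\<close>.\<close>

definition cohen_macaulay :: "('a, 'r) ring_scheme \<Rightarrow> 'a set \<Rightarrow> bool"
  where "cohen_macaulay R \<mm> \<longleftrightarrow> depth R \<mm> = krull_dim R"

text \<open>The power \<open>I [^] n\<close> below is taken in the library's semiring of ideals, i.e. it is the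
  \<open>n\<close>-fold ideal product.\<close>

definition torsion_module ::
    "('a, 'r) ring_scheme \<Rightarrow> 'a set \<Rightarrow> ('a, 'b, 'm) module_scheme \<Rightarrow> bool"
  where "torsion_module R I M \<longleftrightarrow>
    (\<forall>x\<in>carrier M. \<exists>n::nat. n > 0 \<and>
      (\<forall>a \<in> I [^]\<^bsub>ideals_set R\<^esub> n. a \<odot>\<^bsub>M\<^esub> x = \<zero>\<^bsub>M\<^esub>))"


section \<open>Quotients, free modules, tensor products\<close>

text \<open>In all module records built here the ring-multiplication fields \<open>mult\<close> and \<open>one\<close>, which
  modules do not use, are left unspecified.\<close>

definition quot_module :: "('a, 'b, 'm) module_scheme \<Rightarrow> 'b set \<Rightarrow> ('a, 'b set) module"
  where "quot_module M N =
    \<lparr>carrier = a_rcosets\<^bsub>M\<^esub> N, mult = undefined, one = undefined,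
     zero = N, add = set_add M, smult = (\<lambda>a X. \<Union>x\<in>X. N +>\<^bsub>M\<^esub> (a \<odot>\<^bsub>M\<^esub> x))\<rparr>"

text \<open>The quotient ring \<open>R Quot I\<close> as an \<open>R\<close>-module.\<close>

definition quot_ring_module :: "('a, 'r) ring_scheme \<Rightarrow> 'a set \<Rightarrow> ('a, 'a set) module"
  where "quot_ring_module R I =
    \<lparr>carrier = carrier (R Quot I), mult = undefined, one = undefined,
     zero = \<zero>\<^bsub>R Quot I\<^esub>, add = add (R Quot I),
     smult = (\<lambda>a X. (I +>\<^bsub>R\<^esub> a) \<otimes>\<^bsub>R Quot I\<^esub> X)\<rparr>"

definition free_module :: "('a, 'r) ring_scheme \<Rightarrow> 'b set \<Rightarrow> ('a, 'b \<Rightarrow> 'a) module"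
  where "free_module R B =
    \<lparr>carrier = {f. range f \<subseteq> carrier R \<and> finite {b. f b \<noteq> \<zero>\<^bsub>R\<^esub>} \<and> {b. f b \<noteq> \<zero>\<^bsub>R\<^esub>} \<subseteq> B},
     mult = undefined, one = undefined,
     zero = (\<lambda>b. \<zero>\<^bsub>R\<^esub>), add = (\<lambda>f g b. f b \<oplus>\<^bsub>R\<^esub> g b), smult = (\<lambda>a f b. a \<otimes>\<^bsub>R\<^esub> f b)\<rparr>"

definition free_gen :: "('a, 'r) ring_scheme \<Rightarrow> 'b \<Rightarrow> 'b \<Rightarrow> 'a"
  where "free_gen R b = (\<lambda>c. if c = b then \<one>\<^bsub>R\<^esub> else \<zero>\<^bsub>R\<^esub>)"

text \<open>The linear map from a free module to \<open>M\<close> with prescribed values \<open>\<phi>\<close> on the basis.\<close>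

definition lin_ext ::
    "('a, 'r) ring_scheme \<Rightarrow> ('a, 'c, 'm) module_scheme \<Rightarrow> ('b \<Rightarrow> 'c) \<Rightarrow> ('b \<Rightarrow> 'a) \<Rightarrow> 'c"
  where "lin_ext R M \<phi> f = (\<Oplus>\<^bsub>M\<^esub>b \<in> {b. f b \<noteq> \<zero>\<^bsub>R\<^esub>}. f b \<odot>\<^bsub>M\<^esub> \<phi> b)"

definition tensor_relations ::
    "('a, 'r) ring_scheme \<Rightarrow> ('a, 'b, 'm) module_scheme \<Rightarrow> ('a, 'c, 'n) module_scheme \<Rightarrow>
     ('b \<times> 'c \<Rightarrow> 'a) set"
  where "tensor_relations R M N =
    (let F = free_module R (carrier M \<times> carrier N) in
      {free_gen R (x \<oplus>\<^bsub>M\<^esub> x', y) \<ominus>\<^bsub>F\<^esub> (free_gen R (x, y) \<oplus>\<^bsub>F\<^esub> free_gen R (x', y)) | x x' y.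
         x \<in> carrier M \<and> x' \<in> carrier M \<and> y \<in> carrier N} \<union>
      {free_gen R (x, y \<oplus>\<^bsub>N\<^esub> y') \<ominus>\<^bsub>F\<^esub> (free_gen R (x, y) \<oplus>\<^bsub>F\<^esub> free_gen R (x, y')) | x y y'.
         x \<in> carrier M \<and> y \<in> carrier N \<and> y' \<in> carrier N} \<union>
      {free_gen R (a \<odot>\<^bsub>M\<^esub> x, y) \<ominus>\<^bsub>F\<^esub> (a \<odot>\<^bsub>F\<^esub> free_gen R (x, y)) | a x y.
         a \<in> carrier R \<and> x \<in> carrier M \<and> y \<in> carrier N} \<union>
      {free_gen R (x, a \<odot>\<^bsub>N\<^esub> y) \<ominus>\<^bsub>F\<^esub> (a \<odot>\<^bsub>F\<^esub> free_gen R (x, y)) | a x y.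
         a \<in> carrier R \<and> x \<in> carrier M \<and> y \<in> carrier N})"

definition tensor ::
    "('a, 'r) ring_scheme \<Rightarrow> ('a, 'b, 'm) module_scheme \<Rightarrow> ('a, 'c, 'n) module_scheme \<Rightarrow>
     ('a, ('b \<times> 'c \<Rightarrow> 'a) set) module"
  where "tensor R M N =
    (let F = free_module R (carrier M \<times> carrier N)
     in quot_module F (module.span R F (tensor_relations R M N)))"

definition tensor_elem ::
    "('a, 'r) ring_scheme \<Rightarrow> ('a, 'b, 'm) module_scheme \<Rightarrow> ('a, 'c, 'n) module_scheme \<Rightarrow>
     'b \<Rightarrow> 'c \<Rightarrow> ('b \<times> 'c \<Rightarrow> 'a) set"
  where "tensor_elem R M N x y =
    (let F = free_module R (carrier M \<times> carrier N)
     in module.span R F (tensor_relations R M N) +>\<^bsub>F\<^esub> free_gen R (x, y))"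

text \<open>For a linear map \<open>\<phi>\<close> into \<open>N\<close>, the induced map \<open>id \<otimes> \<phi>\<close> into \<open>M \<otimes> N\<close>, given by
  \<open>x \<otimes> y \<mapsto> x \<otimes> \<phi> y\<close>.  Its argument is a coset \<open>X\<close> of formal combinations of pairs, and the
  value is the same for all representatives.\<close>

definition tensor_map ::
    "('a, 'r) ring_scheme \<Rightarrow> ('a, 'b, 'm) module_scheme \<Rightarrow> ('a, 'd, 'n) module_scheme \<Rightarrow>
     ('c \<Rightarrow> 'd) \<Rightarrow> ('b \<times> 'c \<Rightarrow> 'a) set \<Rightarrow> ('b \<times> 'd \<Rightarrow> 'a) set"
  where "tensor_map R M N \<phi> X =
    the_elem (lin_ext R (tensor R M N) (\<lambda>(x, y). tensor_elem R M N x (\<phi> y)) ` X)"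


section \<open>The canonical free resolution\<close>

text \<open>\<open>Tor\<close> is computed from the canonical free resolution of \<open>M\<close>: \<open>F\<^sub>0\<close> is free on the elements
  of \<open>M\<close>, and \<open>F\<^bsub>n+1\<^esub>\<close> is free on the relations in \<open>F\<^sub>n\<close>, i.e. on the formal linear combinations
  of basis elements that the previous map sends to zero.  The recursive datatype provides one
  index type for the bases of all the \<open>F\<^sub>n\<close>.\<close>

datatype ('a, 'b) syzygy = Gen 'b | Syz "('a \<times> ('a, 'b) syzygy) list"

primrec list_comb :: "('a, 'r) ring_scheme \<Rightarrow> ('a \<times> 'b) list \<Rightarrow> 'b \<Rightarrow> 'a"
  where
    "list_comb R [] = (\<lambda>b. \<zero>\<^bsub>R\<^esub>)"
  | "list_comb R (p # ps) = (\<lambda>b. fst p \<otimes>\<^bsub>R\<^esub> free_gen R (snd p) b \<oplus>\<^bsub>R\<^esub> list_comb R ps b)"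

definition res_aug ::
    "('a, 'r) ring_scheme \<Rightarrow> ('a, 'b, 'm) module_scheme \<Rightarrow> (('a, 'b) syzygy \<Rightarrow> 'a) \<Rightarrow> 'b"
  where "res_aug R M = lin_ext R M (\<lambda>t. case t of Gen x \<Rightarrow> x | Syz _ \<Rightarrow> \<zero>\<^bsub>M\<^esub>)"

text \<open>One formula serves for all differentials \<open>F\<^bsub>n+1\<^esub> \<rightarrow> F\<^sub>n\<close>; the \<open>Gen\<close> case is irrelevant.\<close>

definition res_diff ::
    "('a, 'r) ring_scheme \<Rightarrow> (('a, 'b) syzygy \<Rightarrow> 'a) \<Rightarrow> (('a, 'b) syzygy \<Rightarrow> 'a)"
  where "res_diff R =
    lin_ext R (free_module R UNIV) (\<lambda>t. case t of Gen _ \<Rightarrow> (\<lambda>_. \<zero>\<^bsub>R\<^esub>) | Syz c \<Rightarrow> list_comb R c)"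

primrec res_basis ::
    "('a, 'r) ring_scheme \<Rightarrow> ('a, 'b, 'm) module_scheme \<Rightarrow> nat \<Rightarrow> ('a, 'b) syzygy set"
  where
    "res_basis R M 0 = Gen ` carrier M"
  | "res_basis R M (Suc n) =
      {Syz c | c. set c \<subseteq> carrier R \<times> res_basis R M n \<and>
        (if n = 0 then res_aug R M (list_comb R c) = \<zero>\<^bsub>M\<^esub>
         else res_diff R (list_comb R c) = (\<lambda>_. \<zero>\<^bsub>R\<^esub>))}"

definition res_module ::
    "('a, 'r) ring_scheme \<Rightarrow> ('a, 'b, 'm) module_scheme \<Rightarrow> nat \<Rightarrow>
     ('a, ('a, 'b) syzygy \<Rightarrow> 'a) module"
  where "res_module R M n = free_module R (res_basis R M n)"

lemma free_module_simps [simp]: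
  "zero (free_module R B) = (\<lambda>b. \<zero>\<^bsub>R\<^esub>)"
  "f \<oplus>\<^bsub>free_module R B\<^esub> g = (\<lambda>b. f b \<oplus>\<^bsub>R\<^esub> g b)"
  "a \<odot>\<^bsub>free_module R B\<^esub> f = (\<lambda>b. a \<otimes>\<^bsub>R\<^esub> f b)"
  by (simp_all add: free_module_def)

lemma free_module_carrier:
  "f \<in> carrier (free_module R B) \<longleftrightarrow>
    (\<forall>b. f b \<in> carrier R) \<and> finite {b. f b \<noteq> \<zero>\<^bsub>R\<^esub>} \<and> {b. f b \<noteq> \<zero>\<^bsub>R\<^esub>} \<subseteq> B"
  by (auto simp: free_module_def)

lemma free_module_closed:
  assumes "cring R"
  shows "(\<lambda>b. \<zero>\<^bsub>R\<^esub>) \<in> carrier (free_module R B)"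
    and "\<lbrakk>f \<in> carrier (free_module R B); g \<in> carrier (free_module R B)\<rbrakk>
      \<Longrightarrow> (\<lambda>b. f b \<oplus>\<^bsub>R\<^esub> g b) \<in> carrier (free_module R B)"
    and "\<lbrakk>a \<in> carrier R; f \<in> carrier (free_module R B)\<rbrakk>
      \<Longrightarrow> (\<lambda>b. a \<otimes>\<^bsub>R\<^esub> f b) \<in> carrier (free_module R B)"
    and "b \<in> B \<Longrightarrow> free_gen R b \<in> carrier (free_module R B)"
proof -
  interpret cring R by fact
  show "(\<lambda>b. \<zero>\<^bsub>R\<^esub>) \<in> carrier (free_module R B)"
    by (simp add: free_module_carrier)
  show "(\<lambda>b. f b \<oplus>\<^bsub>R\<^esub> g b) \<in> carrier (free_module R B)"
    if "f \<in> carrier (free_module R B)" "g \<in> carrier (free_module R B)"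
  proof -
    have "{b. f b \<oplus>\<^bsub>R\<^esub> g b \<noteq> \<zero>\<^bsub>R\<^esub>} \<subseteq> {b. f b \<noteq> \<zero>\<^bsub>R\<^esub>} \<union> {b. g b \<noteq> \<zero>\<^bsub>R\<^esub>}"
      by auto
    with that show ?thesis
      unfolding free_module_carrier by (blast intro: finite_subset)
  qed
  show "(\<lambda>b. a \<otimes>\<^bsub>R\<^esub> f b) \<in> carrier (free_module R B)"
    if "a \<in> carrier R" "f \<in> carrier (free_module R B)"
  proof -
    have "{b. a \<otimes>\<^bsub>R\<^esub> f b \<noteq> \<zero>\<^bsub>R\<^esub>} \<subseteq> {b. f b \<noteq> \<zero>\<^bsub>R\<^esub>}"
      using that by auto
    with that show ?thesis
      unfolding free_module_carrier by (blast intro: finite_subset)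
  qed
  show "free_gen R b \<in> carrier (free_module R B)" if "b \<in> B"
  proof -
    have "{c. free_gen R b c \<noteq> \<zero>\<^bsub>R\<^esub>} \<subseteq> {b}" by (auto simp: free_gen_def)
    with that show ?thesis
      unfolding free_module_carrier by (auto intro: finite_subset simp: free_gen_def)
  qed
qed

lemma free_module_is_module:
  assumes "cring R"
  shows "module R (free_module R B)"
proof -
  interpret cring R by fact
  show ?thesis
  proof (rule moduleI)
    show "abelian_group (free_module R B)"
    proof (rule abelian_groupI)
      fix f assume f: "f \<in> carrier (free_module R B)"
      show "\<exists>g\<in>carrier (free_module R B). g \<oplus>\<^bsub>free_module R B\<^esub> f = \<zero>\<^bsub>free_module R B\<^esub>"
      proof (rule bexI)
        show "(\<lambda>b. \<ominus>\<^bsub>R\<^esub> \<one>\<^bsub>R\<^esub> \<otimes>\<^bsub>R\<^esub> f b) \<in> carrier (free_module R B)"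
          using f by (intro free_module_closed assms) auto
        show "(\<lambda>b. \<ominus>\<^bsub>R\<^esub> \<one>\<^bsub>R\<^esub> \<otimes>\<^bsub>R\<^esub> f b) \<oplus>\<^bsub>free_module R B\<^esub> f = \<zero>\<^bsub>free_module R B\<^esub>"
          using f by (auto simp: free_module_carrier l_minus l_neg)
      qed
    qed (auto simp: free_module_closed[OF assms], auto simp: free_module_carrier a_ac)
  qed (use assms in \<open>auto simp: free_module_closed, auto simp: free_module_carrier l_distr r_distr m_assoc\<close>)
qed

context module
begin

lemma lin_ext_superset:
  assumes "finite S" "{b. f b \<noteq> \<zero>} \<subseteq> S" "\<phi> \<in> S \<rightarrow> carrier M" "\<And>b. f b \<in> carrier R"
  shows "lin_ext R M \<phi> f = (\<Oplus>\<^bsub>M\<^esub>b\<in>S. f b \<odot>\<^bsub>M\<^esub> \<phi> b)"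
  unfolding lin_ext_def
  by (rule M.add.finprod_mono_neutral_cong_left) (use assms in \<open>auto simp: Pi_iff\<close>)

lemma lin_ext_hom:
  assumes \<phi>: "\<phi> \<in> B \<rightarrow> carrier M"
  shows "lin_ext R M \<phi> \<in> module_hom R (free_module R B) M"
proof -
  have closed: "lin_ext R M \<phi> f \<in> carrier M" if "f \<in> carrier (free_module R B)" for f
    unfolding lin_ext_def using that \<phi>
    by (intro M.finsum_closed) (auto simp: free_module_carrier Pi_iff)
  have add: "lin_ext R M \<phi> (\<lambda>b. f b \<oplus> g b) = lin_ext R M \<phi> f \<oplus>\<^bsub>M\<^esub> lin_ext R M \<phi> g"
    if f: "f \<in> carrier (free_module R B)" and g: "g \<in> carrier (free_module R B)" for f g
  proof -
    let ?S = "{b. f b \<noteq> \<zero>} \<union> {b. g b \<noteq> \<zero>}"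
    have S: "finite ?S" "?S \<subseteq> B" using f g by (auto simp: free_module_carrier)
    have \<phi>S: "\<phi> \<in> ?S \<rightarrow> carrier M" using \<phi> S by auto
    have fc: "\<And>b. f b \<in> carrier R" and gc: "\<And>b. g b \<in> carrier R"
      using f g by (auto simp: free_module_carrier)
    have "lin_ext R M \<phi> (\<lambda>b. f b \<oplus> g b) = (\<Oplus>\<^bsub>M\<^esub>b\<in>?S. (f b \<oplus> g b) \<odot>\<^bsub>M\<^esub> \<phi> b)"
      using S \<phi>S fc gc by (intro lin_ext_superset) auto
    also have "\<dots> = (\<Oplus>\<^bsub>M\<^esub>b\<in>?S. f b \<odot>\<^bsub>M\<^esub> \<phi> b \<oplus>\<^bsub>M\<^esub> g b \<odot>\<^bsub>M\<^esub> \<phi> b)"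
      using \<phi>S fc gc by (intro M.finsum_cong') (auto simp: smult_l_distr Pi_iff)
    also have "\<dots> = (\<Oplus>\<^bsub>M\<^esub>b\<in>?S. f b \<odot>\<^bsub>M\<^esub> \<phi> b) \<oplus>\<^bsub>M\<^esub> (\<Oplus>\<^bsub>M\<^esub>b\<in>?S. g b \<odot>\<^bsub>M\<^esub> \<phi> b)"
      using \<phi>S fc gc by (intro M.finsum_addf) (auto simp: Pi_iff)
    also have "(\<Oplus>\<^bsub>M\<^esub>b\<in>?S. f b \<odot>\<^bsub>M\<^esub> \<phi> b) = lin_ext R M \<phi> f"
      using S \<phi>S fc by (intro lin_ext_superset[symmetric]) auto
    also have "(\<Oplus>\<^bsub>M\<^esub>b\<in>?S. g b \<odot>\<^bsub>M\<^esub> \<phi> b) = lin_ext R M \<phi> g"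
      using S \<phi>S gc by (intro lin_ext_superset[symmetric]) auto
    finally show ?thesis .
  qed
  have smult: "lin_ext R M \<phi> (\<lambda>b. a \<otimes> f b) = a \<odot>\<^bsub>M\<^esub> lin_ext R M \<phi> f"
    if a: "a \<in> carrier R" and f: "f \<in> carrier (free_module R B)" for a f
  proof -
    let ?S = "{b. f b \<noteq> \<zero>}"
    have S: "finite ?S" "?S \<subseteq> B" using f by (auto simp: free_module_carrier)
    have \<phi>S: "\<phi> \<in> ?S \<rightarrow> carrier M" using \<phi> S by auto
    have fc: "\<And>b. f b \<in> carrier R" using f by (auto simp: free_module_carrier)
    have "lin_ext R M \<phi> (\<lambda>b. a \<otimes> f b) = (\<Oplus>\<^bsub>M\<^esub>b\<in>?S. (a \<otimes> f b) \<odot>\<^bsub>M\<^esub> \<phi> b)"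
      using S \<phi>S fc a by (intro lin_ext_superset) auto
    also have "\<dots> = (\<Oplus>\<^bsub>M\<^esub>b\<in>?S. a \<odot>\<^bsub>M\<^esub> (f b \<odot>\<^bsub>M\<^esub> \<phi> b))"
      using \<phi>S fc a by (intro M.finsum_cong') (auto simp: smult_assoc1 Pi_iff)
    also have "\<dots> = a \<odot>\<^bsub>M\<^esub> lin_ext R M \<phi> f"
      unfolding lin_ext_def using \<phi>S fc a S
      by (intro finsum_smult_ldistr[symmetric]) (auto simp: Pi_iff)
    finally show ?thesis .
  qed
  show ?thesis
    unfolding module_hom_def using closed add smult by auto
qed

lemma lin_ext_gen:
  assumes "\<phi> b \<in> carrier M"
  shows "lin_ext R M \<phi> (free_gen R b) = \<phi> b"
proof -
  have "lin_ext R M \<phi> (free_gen R b) = (\<Oplus>\<^bsub>M\<^esub>c\<in>{b}. free_gen R b c \<odot>\<^bsub>M\<^esub> \<phi> c)"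
    using assms by (intro lin_ext_superset) (auto simp: free_gen_def)
  also have "\<dots> = \<phi> b" using assms by (simp add: free_gen_def)
  finally show ?thesis .
qed

lemma lin_ext_in_ker:
  assumes N: "module R N" and \<psi>: "\<psi> \<in> module_hom R M N"
    and \<phi>: "\<phi> \<in> B \<rightarrow> a_kernel M N \<psi>" and f: "f \<in> carrier (free_module R B)"
  shows "lin_ext R M \<phi> f \<in> a_kernel M N \<psi>"
proof -
  interpret N: module R N by fact
  interpret mod_hom R M N \<psi> by unfold_locales (rule \<psi>)
  have ker: "a_kernel M N \<psi> = {x \<in> carrier M. \<psi> x = \<zero>\<^bsub>N\<^esub>}" by (rule a_kernel_def')
  have "(\<Oplus>\<^bsub>M\<^esub>b\<in>S. f b \<odot>\<^bsub>M\<^esub> \<phi> b) \<in> a_kernel M N \<psi>" if "finite S" "S \<subseteq> B" for S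
    using that
  proof (induction S)
    case empty
    then show ?case by (simp add: ker)
  next
    case (insert b S)
    have fc: "\<And>b. f b \<in> carrier R" using f by (auto simp: free_module_carrier)
    have \<phi>c: "\<phi> c \<in> carrier M" "\<psi> (\<phi> c) = \<zero>\<^bsub>N\<^esub>" if "c \<in> B" for c
      using \<phi> that by (auto simp: ker Pi_iff)
    have eq: "(\<Oplus>\<^bsub>M\<^esub>b\<in>insert b S. f b \<odot>\<^bsub>M\<^esub> \<phi> b) = f b \<odot>\<^bsub>M\<^esub> \<phi> b \<oplus>\<^bsub>M\<^esub> (\<Oplus>\<^bsub>M\<^esub>b\<in>S. f b \<odot>\<^bsub>M\<^esub> \<phi> b)"
      using insert fc \<phi>c by (intro M.finsum_insert) auto
    have IH: "(\<Oplus>\<^bsub>M\<^esub>b\<in>S. f b \<odot>\<^bsub>M\<^esub> \<phi> b) \<in> carrier M" "\<psi> (\<Oplus>\<^bsub>M\<^esub>b\<in>S. f b \<odot>\<^bsub>M\<^esub> \<phi> b) = \<zero>\<^bsub>N\<^esub>"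
      using insert by (auto simp: ker)
    show ?case unfolding eq using IH fc \<phi>c[of b] insert.prems by (simp add: ker)
  qed
  then show ?thesis
    unfolding lin_ext_def using f by (auto simp: free_module_carrier)
qed

end

lemma list_comb_closed:
  assumes "cring R" "set c \<subseteq> carrier R \<times> B"
  shows "list_comb R c \<in> carrier (free_module R B)"
  using assms(2)
  by (induction c) (auto intro!: free_module_closed[OF assms(1)])

lemma list_comb_surj:
  assumes "cring R" and f: "f \<in> carrier (free_module R B)"
  obtains c where "set c \<subseteq> carrier R \<times> B" "f = list_comb R c"
proof -
  interpret cring R by fact
  have fc: "\<And>b. f b \<in> carrier R" using f by (auto simp: free_module_carrier)
  obtain bs where bs: "set bs = {b. f b \<noteq> \<zero>\<^bsub>R\<^esub>}" "distinct bs"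
    using f finite_distinct_list[of "{b. f b \<noteq> \<zero>\<^bsub>R\<^esub>}"] unfolding free_module_carrier by blast
  have "list_comb R (map (\<lambda>b. (f b, b)) ys) = (\<lambda>b. if b \<in> set ys then f b else \<zero>\<^bsub>R\<^esub>)"
    if "distinct ys" for ys
    using that by (induction ys) (auto simp: fc free_gen_def)
  from this[OF bs(2)] have "f = list_comb R (map (\<lambda>b. (f b, b)) bs)"
    using bs by auto
  moreover have "set (map (\<lambda>b. (f b, b)) bs) \<subseteq> carrier R \<times> B"
    using bs f by (auto simp: free_module_carrier)
  ultimately show ?thesis using that by blast
qed

text \<open>The complex \<open>\<dots> \<rightarrow> F\<^sub>2 \<rightarrow> F\<^sub>1 \<rightarrow> F\<^sub>0 \<rightarrow> M \<rightarrow> 0\<close> consists of linear maps and is exact.\<close>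

context module
begin

lemma res_module_is_module: "module R (res_module R M n)"
  unfolding res_module_def by (rule free_module_is_module) (rule R.is_cring)

lemma res_aug_hom: "res_aug R M \<in> module_hom R (res_module R M 0) M"
  unfolding res_aug_def res_module_def by (rule lin_ext_hom) auto

lemma res_basis_SucD:
  assumes "t \<in> res_basis R M (Suc n)"
  obtains c where "t = Syz c" "list_comb R c \<in> carrier (res_module R M n)"
proof -
  from assms obtain c where c: "t = Syz c" "set c \<subseteq> carrier R \<times> res_basis R M n" by auto
  from list_comb_closed[OF R.is_cring c(2)] c(1) show ?thesis
    by (intro that) (simp_all add: res_module_def)
qed

lemma res_diff_hom_UNIV:
  "res_diff R \<in> module_hom R (res_module R M (Suc n)) (free_module R UNIV)"
proof -
  interpret U: module R "free_module R UNIV" by (rule free_module_is_module) (rule R.is_cring)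
  show ?thesis
    unfolding res_diff_def res_module_def
  proof (rule U.lin_ext_hom, rule Pi_I)
    fix t assume "t \<in> res_basis R M (Suc n)"
    then obtain c where "t = Syz c" "list_comb R c \<in> carrier (res_module R M n)"
      by (rule res_basis_SucD)
    then show "(case t of Gen _ \<Rightarrow> (\<lambda>_. \<zero>) | Syz c \<Rightarrow> list_comb R c) \<in> carrier (free_module R UNIV)"
      by (auto simp: res_module_def free_module_carrier)
  qed
qed

lemma res_diff_eq:
  assumes f: "f \<in> carrier (res_module R M (Suc n))"
  shows "res_diff R f =
    lin_ext R (res_module R M n) (\<lambda>t. case t of Gen _ \<Rightarrow> (\<lambda>_. \<zero>) | Syz c \<Rightarrow> list_comb R c) f"
proof -
  interpret F: module R "res_module R M n" by (rule res_module_is_module)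
  interpret U: module R "free_module R UNIV" by (rule free_module_is_module) (rule R.is_cring)
  let ?\<phi> = "\<lambda>t. case t of Gen _ \<Rightarrow> (\<lambda>_. \<zero>) | Syz c \<Rightarrow> list_comb R c"
  have fc: "\<And>b. f b \<in> carrier R" using f by (auto simp: res_module_def free_module_carrier)
  have \<phi>: "?\<phi> t \<in> carrier (res_module R M n)" if "t \<in> res_basis R M (Suc n)" for t
    using that by (auto elim!: res_basis_SucD simp del: res_basis.simps)
  have sub: "g \<in> carrier (free_module R UNIV)" if "g \<in> carrier (res_module R M n)" for g
    using that by (auto simp: res_module_def free_module_carrier)
  have "(\<Oplus>\<^bsub>free_module R UNIV\<^esub>b\<in>S. f b \<odot>\<^bsub>free_module R UNIV\<^esub> ?\<phi> b) =
        (\<Oplus>\<^bsub>res_module R M n\<^esub>b\<in>S. f b \<odot>\<^bsub>res_module R M n\<^esub> ?\<phi> b)"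
    if "finite S" "S \<subseteq> res_basis R M (Suc n)" for S
    using that
  proof (induction S)
    case empty
    show ?case
      by (simp only: U.M.finsum_empty F.M.finsum_empty) (simp add: res_module_def)
  next
    case (insert b S)
    have 1: "(\<Oplus>\<^bsub>free_module R UNIV\<^esub>b\<in>insert b S. f b \<odot>\<^bsub>free_module R UNIV\<^esub> ?\<phi> b) =
      f b \<odot>\<^bsub>free_module R UNIV\<^esub> ?\<phi> b \<oplus>\<^bsub>free_module R UNIV\<^esub>
        (\<Oplus>\<^bsub>free_module R UNIV\<^esub>b\<in>S. f b \<odot>\<^bsub>free_module R UNIV\<^esub> ?\<phi> b)"
      using insert.hyps insert.prems by (intro U.M.finsum_insert Pi_I U.smult_closed fc sub \<phi>) (auto simp del: res_basis.simps)
    have 2: "(\<Oplus>\<^bsub>res_module R M n\<^esub>b\<in>insert b S. f b \<odot>\<^bsub>res_module R M n\<^esub> ?\<phi> b) =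
      f b \<odot>\<^bsub>res_module R M n\<^esub> ?\<phi> b \<oplus>\<^bsub>res_module R M n\<^esub>
        (\<Oplus>\<^bsub>res_module R M n\<^esub>b\<in>S. f b \<odot>\<^bsub>res_module R M n\<^esub> ?\<phi> b)"
      using insert.hyps insert.prems by (intro F.M.finsum_insert Pi_I F.smult_closed fc \<phi>) (auto simp del: res_basis.simps)
    show ?case unfolding 1 2 using insert by (simp add: res_module_def del: res_basis.simps)
  qed
  from this[of "{b. f b \<noteq> \<zero>}"] show ?thesis
    using f unfolding res_diff_def lin_ext_def by (auto simp: res_module_def free_module_carrier)
qed

lemma res_diff_hom:
  "res_diff R \<in> module_hom R (res_module R M (Suc n)) (res_module R M n)"
proof -
  interpret F: module R "res_module R M n" by (rule res_module_is_module)
  let ?\<phi> = "\<lambda>t. case t of Gen _ \<Rightarrow> (\<lambda>_. \<zero>) | Syz c \<Rightarrow> list_comb R c"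
  have "?\<phi> \<in> res_basis R M (Suc n) \<rightarrow> carrier (res_module R M n)"
    by (auto elim!: res_basis_SucD simp del: res_basis.simps)
  from F.lin_ext_hom[OF this] have "res_diff R f \<in> carrier (res_module R M n)"
    if "f \<in> carrier (res_module R M (Suc n))" for f
    using that res_diff_eq[OF that] by (auto simp: module_hom_def res_module_def[of R M "Suc n"])
  with res_diff_hom_UNIV[of n] show ?thesis
    by (auto simp: module_hom_def res_module_def)
qed

lemma res_aug_surj: "res_aug R M ` carrier (res_module R M 0) = carrier M"
proof
  show "res_aug R M ` carrier (res_module R M 0) \<subseteq> carrier M"
    using res_aug_hom by (auto simp: module_hom_def)
  show "carrier M \<subseteq> res_aug R M ` carrier (res_module R M 0)"
  proof
    fix x assume x: "x \<in> carrier M"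
    then have "res_aug R M (free_gen R (Gen x)) = x"
      unfolding res_aug_def by (subst lin_ext_gen) auto
    moreover have "free_gen R (Gen x) \<in> carrier (res_module R M 0)"
      unfolding res_module_def using x by (intro free_module_closed R.is_cring) auto
    ultimately show "x \<in> res_aug R M ` carrier (res_module R M 0)" by force
  qed
qed

lemma res_exact_step:
  assumes N: "module R N" and \<psi>: "\<psi> \<in> module_hom R (res_module R M n) N"
    and basis: "res_basis R M (Suc n) =
      {Syz c | c. set c \<subseteq> carrier R \<times> res_basis R M n \<and> \<psi> (list_comb R c) = \<zero>\<^bsub>N\<^esub>}"
  shows "res_diff R ` carrier (res_module R M (Suc n)) = a_kernel (res_module R M n) N \<psi>"
proof
  interpret F: module R "res_module R M n" by (rule res_module_is_module)
  interpret U: module R "free_module R UNIV" by (rule free_module_is_module) (rule R.is_cring)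
  let ?\<phi> = "\<lambda>t. case t of Gen _ \<Rightarrow> (\<lambda>_. \<zero>) | Syz c \<Rightarrow> list_comb R c"
  have \<phi>: "?\<phi> \<in> res_basis R M (Suc n) \<rightarrow> a_kernel (res_module R M n) N \<psi>"
    unfolding basis a_kernel_def'
    by (auto simp: res_module_def intro: list_comb_closed[OF R.is_cring])
  show "res_diff R ` carrier (res_module R M (Suc n)) \<subseteq> a_kernel (res_module R M n) N \<psi>"
  proof
    fix y assume "y \<in> res_diff R ` carrier (res_module R M (Suc n))"
    then obtain f where f: "f \<in> carrier (res_module R M (Suc n))" "y = res_diff R f" by blast
    then show "y \<in> a_kernel (res_module R M n) N \<psi>"
      using F.lin_ext_in_ker[OF N \<psi> \<phi>, of f] res_diff_eq[OF f(1)]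
      by (simp add: res_module_def[of R M "Suc n"] del: res_basis.simps)
  qed
  show "a_kernel (res_module R M n) N \<psi> \<subseteq> res_diff R ` carrier (res_module R M (Suc n))"
  proof
    fix y assume "y \<in> a_kernel (res_module R M n) N \<psi>"
    then have y: "y \<in> carrier (res_module R M n)" "\<psi> y = \<zero>\<^bsub>N\<^esub>" by (auto simp: a_kernel_def')
    then obtain c where c: "set c \<subseteq> carrier R \<times> res_basis R M n" "y = list_comb R c"
      using list_comb_surj[OF R.is_cring, of y "res_basis R M n"] by (auto simp: res_module_def)
    then have "Syz c \<in> res_basis R M (Suc n)" using y unfolding basis by blast
    then have "free_gen R (Syz c) \<in> carrier (res_module R M (Suc n))"
      unfolding res_module_def by (intro free_module_closed R.is_cring)
    moreover have "res_diff R (free_gen R (Syz c)) = y"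
      unfolding res_diff_def using c y(1)
      by (subst U.lin_ext_gen) (auto simp: res_module_def free_module_carrier)
    ultimately show "y \<in> res_diff R ` carrier (res_module R M (Suc n))" by force
  qed
qed

theorem res_exact_0:
  "res_diff R ` carrier (res_module R M (Suc 0)) = a_kernel (res_module R M 0) M (res_aug R M)"
  by (rule res_exact_step[OF _ res_aug_hom]) (auto simp: module_axioms)

theorem res_exact_Suc:
  "res_diff R ` carrier (res_module R M (Suc (Suc n))) =
    a_kernel (res_module R M (Suc n)) (res_module R M n) (res_diff R)"
  by (rule res_exact_step[OF res_module_is_module res_diff_hom]) (simp add: res_module_def)

end


section \<open>Tor and Betti numbers\<close>

definition tor_cycles ::
    "('a, 'r) ring_scheme \<Rightarrow> nat \<Rightarrow> ('a, 'c, 'n) module_scheme \<Rightarrow> ('a, 'b, 'm) module_scheme \<Rightarrow>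
     ('c \<times> (('a, 'b) syzygy \<Rightarrow> 'a) \<Rightarrow> 'a) set set"
  where "tor_cycles R i N M =
    (case i of
       0 \<Rightarrow> carrier (tensor R N (res_module R M 0))
     | Suc j \<Rightarrow> a_kernel (tensor R N (res_module R M (Suc j))) (tensor R N (res_module R M j))
                (tensor_map R N (res_module R M j) (res_diff R)))"

definition tor_boundaries ::
    "('a, 'r) ring_scheme \<Rightarrow> nat \<Rightarrow> ('a, 'c, 'n) module_scheme \<Rightarrow> ('a, 'b, 'm) module_scheme \<Rightarrow>
     ('c \<times> (('a, 'b) syzygy \<Rightarrow> 'a) \<Rightarrow> 'a) set set"
  where "tor_boundaries R i N M =
    tensor_map R N (res_module R M i) (res_diff R) ` carrier (tensor R N (res_module R M (Suc i)))"

definition Tor ::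
    "('a, 'r) ring_scheme \<Rightarrow> nat \<Rightarrow> ('a, 'c, 'n) module_scheme \<Rightarrow> ('a, 'b, 'm) module_scheme \<Rightarrow>
     ('a, ('c \<times> (('a, 'b) syzygy \<Rightarrow> 'a) \<Rightarrow> 'a) set set) module"
  where "Tor R i N M =
    quot_module ((tensor R N (res_module R M i))\<lparr>carrier := tor_cycles R i N M\<rparr>)
      (tor_boundaries R i N M)"

text \<open>An \<open>R\<close>-module annihilated by \<open>I\<close>, regarded as a module over \<open>R Quot I\<close>: a coset acts through
  any of its representatives.\<close>

definition module_over_quot :: "('a, 'b, 'm) module_scheme \<Rightarrow> ('a set, 'b) module"
  where "module_over_quot V =
    \<lparr>carrier = carrier V, mult = undefined, one = undefined, zero = \<zero>\<^bsub>V\<^esub>, add = add V,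
     smult = (\<lambda>X v. the_elem ((\<lambda>a. a \<odot>\<^bsub>V\<^esub> v) ` X))\<rparr>"

text \<open>The library's \<open>dim\<close> is only meaningful for finite-dimensional spaces.\<close>

definition vdim :: "('a, 'r) ring_scheme \<Rightarrow> ('a, 'b, 'm) module_scheme \<Rightarrow> enat"
  where "vdim K V = (if vectorspace.fin_dim K V then enat (vectorspace.dim K V) else \<infinity>)"

definition betti :: "('a, 'r) ring_scheme \<Rightarrow> 'a set \<Rightarrow> nat \<Rightarrow> ('a, 'b, 'm) module_scheme \<Rightarrow> enat"
  where "betti R \<mm> i M =
    vdim (R Quot \<mm>) (module_over_quot (Tor R i (quot_ring_module R \<mm>) M))"

end

theory Submission
  imports Defs
begin

text \<open>Let \<open>x\<^sub>1, \<dots>, x\<^sub>d\<close> be a regular sequence in \<open>\<mm>\<close> and \<open>I = (x\<^sub>1, \<dots>, x\<^sub>d)\<close>. Passing from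
  \<open>(x\<^sub>1, \<dots>, x\<^bsub>i-1\<^esub>)\<close> to \<open>(x\<^sub>1, \<dots>, x\<^sub>i)\<close>, the long exact sequence identifies \<open>Tor\<^sub>i\<close> with the kernel of
  \<open>x\<^sub>i\<close> on the previous \<open>Tor\<^bsub>i-1\<^esub>\<close>, which is nonzero as long as the latter is nonzero and torsion;
  starting from \<open>\<Omega> \<noteq> 0\<close> this gives \<open>Tor\<^sub>d(R/I, \<Omega>) \<noteq> 0\<close>. A nonzerodivisor avoids minimal primes, so
  a prime \<open>P \<supseteq> I\<close> other than \<open>\<mm>\<close> would yield a chain of primes of length \<open>d + 1\<close>; hence \<open>\<mm>\<close> is the
  only prime over \<open>I\<close>. By Noetherian induction over the ideals \<open>J \<supseteq> I\<close>, each proper one of which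
  admits \<open>a\<close> with \<open>(J : a) = \<mm>\<close>, the vanishing of \<open>Tor\<^sub>d(R/\<mm>, \<Omega>)\<close> would imply that of
  \<open>Tor\<^sub>d(R/I, \<Omega>)\<close>.\<close>

text \<open>As \<Omega> need not be finitely generated, Nakayama's lemma and minimal resolutions
  cannot be invoked; torsion takes their place. The connecting homomorphism into
  \<open>Tor_(i-1)\<close> is injective because \<open>Tor_i\<close> of the previous quotient
  vanishes, its degree exceeding the number of elements used so far. Hence the induction along the
  sequence carries three facts together: vanishing in higher degrees, torsion, and nonvanishing in
  the critical degree. The Cohen-Macaulay hypothesis makes one number d serve twice: as depth it
  supplies a sequence of length d, as dimension it forbids the chain of length d + 1. The case
  \<Omega> = 0 is not immediate either: the canonical resolution of the zero module has a free
  module of rank one in degree 0, so the complex must be shown to be contractible. Only the cyclic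
  modules R/J are tensored with the resolution, so the homological part works with elements of free
  modules modulo those with coefficients in J. The official Tor is compared with this description
  once, for J = \<mm>.\<close>

section \<open>Prime ideals in Noetherian rings\<close>

text \<open>By \<open>ideal_chain_is_trivial\<close> the union of a nonempty chain of ideals is
  itself a member of the chain, so Zorn's lemma applies to an arbitrary property \<open>Q\<close>,
  even one that unions do not preserve. This is the form of Noetherian induction used below.\<close>

lemma (in noetherian_ring) exists_maximal_ideal_with:
  assumes "ideal I R" "Q I"
  obtains M where "ideal M R" "Q M" "\<forall>J. ideal J R \<longrightarrow> Q J \<longrightarrow> M \<subseteq> J \<longrightarrow> J = M"
proof -
  let ?A = "{J. ideal J R \<and> Q J}"
  have "\<exists>M\<in>?A. \<forall>J\<in>?A. M \<subseteq> J \<longrightarrow> J = M"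
  proof (rule subset_Zorn_nonempty)
    show "?A \<noteq> {}" using assms by auto
    fix C assume C: "C \<noteq> {}" "subset.chain ?A C"
    then have "subset.chain {I. ideal I R} C"
      unfolding pred_on.chain_def by auto
    from ideal_chain_is_trivial[OF C(1) this] C(2) show "\<Union>C \<in> ?A"
      unfolding pred_on.chain_def by auto
  qed
  then show ?thesis using that by auto
qed

context cring
begin

text \<open>Injectivity of multiplication by \<open>x\<close> on R/I, phrased inside R so that later
  arguments can cancel \<open>x\<close> coefficient by coefficient;
  \<open>nonzerodivisor_imp_nzd_mod\<close> translates from the quotient ring.\<close>

definition nzd_mod :: "'a set \<Rightarrow> 'a \<Rightarrow> bool"
  where "nzd_mod I x \<longleftrightarrow> x \<in> carrier R \<and> (\<forall>y\<in>carrier R. x \<otimes> y \<in> I \<longrightarrow> y \<in> I)"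

lemma nzd_modD: "\<lbrakk>nzd_mod I x; y \<in> carrier R; x \<otimes> y \<in> I\<rbrakk> \<Longrightarrow> y \<in> I"
  and nzd_mod_carrier: "nzd_mod I x \<Longrightarrow> x \<in> carrier R"
  unfolding nzd_mod_def by blast+

lemma mem_add_PIdl_iff:
  assumes "ideal I R" "x \<in> carrier R"
  shows "y \<in> I <+>\<^bsub>R\<^esub> PIdl x \<longleftrightarrow> (\<exists>h\<in>I. \<exists>e\<in>carrier R. y = h \<oplus> x \<otimes> e)"
  using assms(2) unfolding set_add_def' cgenideal_def by (auto simp: m_comm)

lemma add_PIdl:
  assumes "ideal I R" "x \<in> carrier R"
  shows "ideal (I <+>\<^bsub>R\<^esub> PIdl x) R" "I \<subseteq> I <+>\<^bsub>R\<^esub> PIdl x" "x \<in> I <+>\<^bsub>R\<^esub> PIdl x"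
proof -
  interpret ideal I R by fact
  show "ideal (I <+>\<^bsub>R\<^esub> PIdl x) R"
    using assms by (intro add_ideals cgenideal_ideal)
  show "I \<subseteq> I <+>\<^bsub>R\<^esub> PIdl x"
  proof
    fix y assume "y \<in> I"
    then show "y \<in> I <+>\<^bsub>R\<^esub> PIdl x"
      unfolding mem_add_PIdl_iff[OF assms] using assms(2)
      by (intro bexI[of _ y] bexI[of _ \<zero>]) auto
  qed
  show "x \<in> I <+>\<^bsub>R\<^esub> PIdl x"
    unfolding mem_add_PIdl_iff[OF assms] using assms(2)
    by (intro bexI[of _ \<zero>] bexI[of _ \<one>]) auto
qed

text \<open>An ideal \<open>M\<close> that is maximal among those over \<open>I\<close> missing
  \<open>S\<close> is prime. For a, b outside \<open>M\<close>, both M + aR and M + bR meet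
  \<open>S\<close>; the product of the two elements found there lies in \<open>S\<close> and, if ab
  were in \<open>M\<close>, also in \<open>M\<close>.\<close>

lemma exists_prime_disjoint:
  assumes noeth: "noetherian_ring R" and I: "ideal I R"
    and S: "\<one> \<in> S" "S \<subseteq> carrier R" "\<And>s t. s \<in> S \<Longrightarrow> t \<in> S \<Longrightarrow> s \<otimes> t \<in> S" "S \<inter> I = {}"
  obtains P where "primeideal P R" "I \<subseteq> P" "S \<inter> P = {}"
proof -
  interpret noetherian_ring R by fact
  have "I \<subseteq> I \<and> S \<inter> I = {}" using S(4) by simp
  then obtain M where idM: "ideal M R" and M: "I \<subseteq> M \<and> S \<inter> M = {}"
    and max: "\<forall>J. ideal J R \<longrightarrow> I \<subseteq> J \<and> S \<inter> J = {} \<longrightarrow> M \<subseteq> J \<longrightarrow> J = M"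
    by (rule exists_maximal_ideal_with[OF I, where Q = "\<lambda>J. I \<subseteq> J \<and> S \<inter> J = {}"])
  interpret M: ideal M R by fact
  have meet: "\<exists>h\<in>M. \<exists>e\<in>carrier R. h \<oplus> a \<otimes> e \<in> S" if a: "a \<in> carrier R" "a \<notin> M" for a
  proof -
    have "S \<inter> (M <+>\<^bsub>R\<^esub> PIdl a) \<noteq> {}"
    proof
      assume "S \<inter> (M <+>\<^bsub>R\<^esub> PIdl a) = {}"
      then have "M <+>\<^bsub>R\<^esub> PIdl a = M"
        using max[rule_format, OF add_PIdl(1)[OF idM a(1)]] add_PIdl(2)[OF idM a(1)] M by auto
      then show False using add_PIdl(3)[OF idM a(1)] a(2) by simp
    qed
    then obtain y where "y \<in> S" "y \<in> M <+>\<^bsub>R\<^esub> PIdl a" by blast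
    then show ?thesis
      unfolding mem_add_PIdl_iff[OF idM a(1)] by auto
  qed
  have "primeideal M R"
  proof (rule primeidealI[OF idM is_cring])
    show "carrier R \<noteq> M" using M S(1,2) by auto
    fix a b assume ab: "a \<in> carrier R" "b \<in> carrier R" "a \<otimes> b \<in> M"
    show "a \<in> M \<or> b \<in> M"
    proof (rule ccontr)
      assume "\<not> (a \<in> M \<or> b \<in> M)"
      then obtain h e h' e' where h: "h \<in> M" "e \<in> carrier R" "h \<oplus> a \<otimes> e \<in> S"
        and h': "h' \<in> M" "e' \<in> carrier R" "h' \<oplus> b \<otimes> e' \<in> S"
        using meet ab by meson
      have carr: "h \<in> carrier R" "h' \<in> carrier R" using h h' by auto
      have "(h \<oplus> a \<otimes> e) \<otimes> (h' \<oplus> b \<otimes> e') =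
        h \<otimes> (h' \<oplus> b \<otimes> e') \<oplus> (a \<otimes> e) \<otimes> h' \<oplus> (a \<otimes> b) \<otimes> (e \<otimes> e')"
        using carr h(2) h'(2) ab(1,2) by algebra
      also have "\<dots> \<in> M"
        using M.I_r_closed[OF h(1), of "h' \<oplus> b \<otimes> e'"] M.I_l_closed[OF h'(1), of "a \<otimes> e"]
          M.I_r_closed[OF ab(3), of "e \<otimes> e'"] carr h(2) h'(2) ab(1,2) by simp
      finally show False using S(3)[OF h(3) h'(3)] M by auto
    qed
  qed
  with M that show ?thesis by auto
qed

text \<open>The multiplicative set generated by \<open>x\<close> and the complement of \<open>P\<close> does not meet \<open>I\<close>,
  because \<open>x\<close> can be cancelled modulo \<open>I\<close>.\<close>

lemma prime_below_avoiding_nzd: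
  assumes noeth: "noetherian_ring R" and I: "ideal I R" and P: "primeideal P R" "I \<subseteq> P"
    and x: "nzd_mod I x"
  obtains Q where "primeideal Q R" "I \<subseteq> Q" "Q \<subseteq> P" "x \<notin> Q"
proof -
  interpret P: primeideal P R by fact
  have xc: "x \<in> carrier R" using x by (rule nzd_mod_carrier)
  let ?S = "{s \<otimes> x [^] (n::nat) | s n. s \<in> carrier R \<and> s \<notin> P}"
  have oneP: "\<one> \<notin> P" using P.I_notcarr P.one_imp_carrier by auto
  have memS: "s \<otimes> x [^] (n::nat) \<in> ?S" if "s \<in> carrier R" "s \<notin> P" for s n using that by blast
  have pow: "s \<in> I" if "s \<in> carrier R" "s \<otimes> x [^] (n::nat) \<in> I" for s n
    using that(2)
  proof (induction n)
    case 0 then show ?case using that by simp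
  next
    case (Suc n)
    have "s \<otimes> x [^] Suc n = x \<otimes> (s \<otimes> x [^] n)" using xc that(1) by (simp add: m_ac)
    then have "x \<otimes> (s \<otimes> x [^] n) \<in> I" using Suc.prems by simp
    moreover have "s \<otimes> x [^] n \<in> carrier R" using that(1) xc by simp
    ultimately have "s \<otimes> x [^] n \<in> I" using nzd_modD[OF x, of "s \<otimes> x [^] n"] by simp
    then show ?case by (rule Suc.IH)
  qed
  obtain Q where Q: "primeideal Q R" "I \<subseteq> Q" "?S \<inter> Q = {}"
  proof (rule exists_prime_disjoint[OF noeth I, of ?S])
    show "\<one> \<in> ?S" using memS[of \<one> 0] oneP by simp
    show "?S \<subseteq> carrier R" using xc by auto
    show "?S \<inter> I = {}" using pow P(2) by auto
    fix s t assume "s \<in> ?S" "t \<in> ?S"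
    then obtain a n b m where a: "a \<in> carrier R" "a \<notin> P" "s = a \<otimes> x [^] (n::nat)"
      and b: "b \<in> carrier R" "b \<notin> P" "t = b \<otimes> x [^] (m::nat)" by auto
    have "(a \<otimes> u) \<otimes> (b \<otimes> v) = (a \<otimes> b) \<otimes> (u \<otimes> v)" if "u \<in> carrier R" "v \<in> carrier R" for u v
      using a(1) b(1) that by algebra
    from this[of "x [^] n" "x [^] m"] have "s \<otimes> t = (a \<otimes> b) \<otimes> x [^] (n + m)"
      using xc by (simp add: a(3) b(3) nat_pow_mult)
    moreover have "a \<otimes> b \<notin> P" using a b P.I_prime by blast
    ultimately show "s \<otimes> t \<in> ?S" using a b memS[of "a \<otimes> b" "n+m"] by auto
  qed blast
  show thesis
  proof (rule that[OF Q(1,2)])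
    \<comment> \<open>With exponent 0, \<open>?S\<close> contains the whole complement of
      \<open>P\<close>, which keeps \<open>Q\<close> inside \<open>P\<close>; with s = 1 and
      exponent 1 it contains \<open>x\<close>.\<close>
    show "Q \<subseteq> P"
    proof
      fix q assume q: "q \<in> Q"
      then have qc: "q \<in> carrier R"
        using Q(1) by (meson additive_subgroup.a_Hcarr ideal.axioms(1) primeideal.axioms(1))
      show "q \<in> P"
      proof (rule ccontr)
        assume "q \<notin> P"
        with memS[of q 0] qc Q(3) q show False by auto
      qed
    qed
    show "x \<notin> Q" using memS[of \<one> 1] oneP Q(3) xc by auto
  qed
qed

text \<open>Each \<open>x i\<close> yields one more prime at the bottom of the chain:
  \<open>x d\<close> lies in \<open>J (Suc d)\<close>, hence in \<open>P 0\<close>, so a prime over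
  \<open>J d\<close> inside \<open>P 0\<close> that avoids \<open>x d\<close> is strictly smaller.
  The induction descends through the ideals \<open>J i\<close>, with the chain \<open>P\<close> and
  its length generalised so that the new prime can be prepended.\<close>

lemma prime_chain_extend:
  assumes noeth: "noetherian_ring R"
    and J: "\<And>i. i \<le> d \<Longrightarrow> ideal (J i) R"
    and mono: "\<And>i. i < d \<Longrightarrow> J i \<subseteq> J (Suc i)"
    and x: "\<And>i. i < d \<Longrightarrow> x i \<in> J (Suc i) \<and> nzd_mod (J i) (x i)"
    and "J d \<subseteq> P 0" "\<And>i. i \<le> n \<Longrightarrow> primeideal (P i) R" "\<And>i. i < n \<Longrightarrow> P i \<subset> P (Suc i)"
  shows "\<exists>P'. (\<forall>i\<le>n + d. primeideal (P' i) R) \<and> (\<forall>i<n + d. P' i \<subset> P' (Suc i))"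
  using J mono x assms(5-7)
proof (induction d arbitrary: P n)
  case 0
  then show ?case by auto
next
  case (Suc d)
  obtain Q where Q: "primeideal Q R" "J d \<subseteq> Q" "Q \<subseteq> P 0" "x d \<notin> Q"
  proof (rule prime_below_avoiding_nzd[OF noeth])
    show "ideal (J d) R" using Suc.prems(1) by simp
    show "primeideal (P 0) R" using Suc.prems(5) by simp
    show "J d \<subseteq> P 0" using Suc.prems(2)[of d] Suc.prems(4) by auto
    show "nzd_mod (J d) (x d)" using Suc.prems(3) by simp
  qed blast
  have "Q \<subset> P 0" using Q Suc.prems(3)[of d] Suc.prems(4) by auto
  then have "\<exists>P'. (\<forall>i\<le>Suc n + d. primeideal (P' i) R) \<and> (\<forall>i<Suc n + d. P' i \<subset> P' (Suc i))"
    using Suc.prems Q(1,2)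
    by (intro Suc.IH[of "case_nat Q P" "Suc n"]) (auto split: nat.split simp: less_Suc_eq_le)
  then show ?case by simp
qed

text \<open>A colon ideal (J : a) that is maximal among those with a outside \<open>J\<close> is
  prime: if rs lies in it but s does not, then (J : sa) contains it, so equals it, and contains r.
  Being a prime over \<open>J\<close>, it can only be \<mm>. Thus r |-> ra embeds R/\<mm> into R/J,
  which is the input of \<open>tor_zero_colon\<close>.\<close>

lemma exists_colon_eq_prime:
  assumes noeth: "noetherian_ring R" and J: "ideal J R" "J \<noteq> carrier R"
    and only: "\<And>P. primeideal P R \<Longrightarrow> J \<subseteq> P \<Longrightarrow> P = \<mm>"
  obtains a where "a \<in> carrier R" "a \<notin> J" "\<And>r. r \<in> carrier R \<Longrightarrow> r \<otimes> a \<in> J \<longleftrightarrow> r \<in> \<mm>"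
proof -
  interpret noetherian_ring R by fact
  interpret J: ideal J R by fact
  define col where "col a = {r \<in> carrier R. r \<otimes> a \<in> J}" for a
  have col: "ideal (col a) R" if a: "a \<in> carrier R" for a
  proof (rule idealI)
    show "ring R" by (rule ring_axioms)
    show "subgroup (col a) (add_monoid R)"
      unfolding subgroup_def using a
      by (auto simp: col_def l_distr l_minus a_inv_def[symmetric])
    fix r s assume rs: "r \<in> col a" "s \<in> carrier R"
    have "(s \<otimes> r) \<otimes> a = s \<otimes> (r \<otimes> a)" using rs a by (simp add: col_def m_assoc)
    then show "s \<otimes> r \<in> col a" using rs a by (simp add: col_def J.I_l_closed)
    then show "r \<otimes> s \<in> col a" using rs by (simp add: col_def m_comm)
  qed
  obtain a0 where a0: "a0 \<in> carrier R" "a0 \<notin> J" using J J.a_subset by auto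
  then have "col a0 \<in> col ` (carrier R - J)" by auto
  then obtain M where "ideal M R" and M: "M \<in> col ` (carrier R - J)"
    and max: "\<forall>I. ideal I R \<longrightarrow> I \<in> col ` (carrier R - J) \<longrightarrow> M \<subseteq> I \<longrightarrow> I = M"
    by (rule exists_maximal_ideal_with[OF col[OF a0(1)], where Q = "\<lambda>I. I \<in> col ` (carrier R - J)"])
  then obtain a where a: "a \<in> carrier R" "a \<notin> J" "M = col a" by auto
  have "primeideal M R"
  proof (rule primeidealI)
    show "ideal M R" using a col by simp
    show "cring R" by (rule is_cring)
    show "carrier R \<noteq> M"
    proof
      assume "carrier R = M"
      then have "\<one> \<in> col a" using a(3) by blast
      then show False using a(1,2) by (simp add: col_def)
    qed
    fix r s assume rs: "r \<in> carrier R" "s \<in> carrier R" "r \<otimes> s \<in> M"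
    show "r \<in> M \<or> s \<in> M"
    proof (rule ccontr)
      assume n: "\<not> (r \<in> M \<or> s \<in> M)"
      then have sa: "s \<otimes> a \<notin> J" using a rs by (simp add: col_def)
      have "M \<subseteq> col (s \<otimes> a)"
      proof
        fix t assume "t \<in> M"
        then have t: "t \<in> carrier R" "t \<otimes> a \<in> J" using a by (auto simp: col_def)
        have "t \<otimes> (s \<otimes> a) = s \<otimes> (t \<otimes> a)" using t rs a by (simp add: m_lcomm)
        then show "t \<in> col (s \<otimes> a)" using t rs by (simp add: col_def J.I_l_closed)
      qed
      then have "col (s \<otimes> a) = M" using max[rule_format, OF col[of "s \<otimes> a"]] sa rs a by simp
      moreover have "r \<in> col (s \<otimes> a)" using rs a by (simp add: col_def m_assoc)
      ultimately show False using n by simp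
    qed
  qed
  moreover have "J \<subseteq> M" using a J.a_subset by (auto simp: col_def J.I_r_closed)
  ultimately have "M = \<mm>" by (rule only)
  then show ?thesis using that[of a] a by (auto simp: col_def)
qed

end

text \<open>A proper ideal that is maximal over \<open>I\<close> is a maximal ideal of
  \<open>R\<close>, and \<open>local_ring\<close> allows only one.\<close>

lemma local_ring_prime_le:
  assumes noeth: "noetherian_ring R" and loc: "local_ring R \<mm>" and I: "ideal I R" "I \<noteq> carrier R"
  shows "I \<subseteq> \<mm>"
proof -
  interpret noetherian_ring R by fact
  have "I \<noteq> carrier R \<and> I \<subseteq> I" using I(2) by simp
  then obtain M where M: "ideal M R" "M \<noteq> carrier R \<and> I \<subseteq> M"
    and max: "\<forall>J. ideal J R \<longrightarrow> J \<noteq> carrier R \<and> I \<subseteq> J \<longrightarrow> M \<subseteq> J \<longrightarrow> J = M"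
    by (rule exists_maximal_ideal_with[OF I(1), where Q = "\<lambda>J. J \<noteq> carrier R \<and> I \<subseteq> J"])
  have "maximalideal M R"
  proof (rule maximalidealI)
    show "ideal M R" "carrier R \<noteq> M" using M by auto
    fix J assume "ideal J R" "M \<subseteq> J" "J \<subseteq> carrier R"
    then show "J = M \<or> J = carrier R" using max M by (meson order_trans)
  qed
  then have "M = \<mm>" using loc by (auto simp: local_ring_def)
  then show ?thesis using M by auto
qed

section \<open>Complexes of free modules modulo an ideal\<close>

context cring
begin

text \<open>For the free module \<open>F\<close> on \<open>B\<close> this is the submodule \<open>J F\<close>.\<close>

definition ideal_valued :: "'a set \<Rightarrow> 'c set \<Rightarrow> ('c \<Rightarrow> 'a) set"
  where "ideal_valued J B = {f \<in> carrier (free_module R B). \<forall>b. f b \<in> J}"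

lemma ideal_valued_carrier: "ideal_valued (carrier R) B = carrier (free_module R B)"
  by (auto simp: ideal_valued_def free_module_carrier)

lemma free_module_minus_closed:
  assumes "f \<in> carrier (free_module R B)" "g \<in> carrier (free_module R B)"
  shows "(\<lambda>b. f b \<ominus> g b) \<in> carrier (free_module R B)"
proof -
  have "{b. f b \<ominus> g b \<noteq> \<zero>} \<subseteq> {b. f b \<noteq> \<zero>} \<union> {b. g b \<noteq> \<zero>}"
    by (auto simp: a_minus_def)
  with assms show ?thesis
    unfolding free_module_carrier by (blast intro: finite_subset)
qed

lemma ideal_valuedD:
  assumes "f \<in> ideal_valued J B"
  shows "f \<in> carrier (free_module R B)" "f b \<in> J"
  using assms by (auto simp: ideal_valued_def)

lemma ideal_valued_closed:
  assumes J: "ideal J R"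
  shows "(\<lambda>_. \<zero>) \<in> ideal_valued J B"
    and "\<lbrakk>f \<in> ideal_valued J B; g \<in> ideal_valued J B\<rbrakk> \<Longrightarrow> (\<lambda>b. f b \<oplus> g b) \<in> ideal_valued J B"
    and "\<lbrakk>a \<in> carrier R; f \<in> ideal_valued J B\<rbrakk> \<Longrightarrow> (\<lambda>b. a \<otimes> f b) \<in> ideal_valued J B"
    and "\<lbrakk>a \<in> J; f \<in> carrier (free_module R B)\<rbrakk> \<Longrightarrow> (\<lambda>b. a \<otimes> f b) \<in> ideal_valued J B"
proof -
  interpret J: ideal J R by fact
  note cl = free_module_closed[OF is_cring]
  show "(\<lambda>_. \<zero>) \<in> ideal_valued J B" by (auto simp: ideal_valued_def cl)
  show "(\<lambda>b. f b \<oplus> g b) \<in> ideal_valued J B" if "f \<in> ideal_valued J B" "g \<in> ideal_valued J B"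
    using that by (auto simp: ideal_valued_def cl)
  show "(\<lambda>b. a \<otimes> f b) \<in> ideal_valued J B" if "a \<in> carrier R" "f \<in> ideal_valued J B"
    using that by (auto simp: ideal_valued_def cl J.I_l_closed)
  show "(\<lambda>b. a \<otimes> f b) \<in> ideal_valued J B" if "a \<in> J" "f \<in> carrier (free_module R B)"
  proof -
    have "f b \<in> carrier R" for b using that by (simp add: free_module_carrier)
    then show ?thesis using that cl(3)[of a f B] J.a_Hcarr J.I_r_closed by (simp add: ideal_valued_def)
  qed
qed

text \<open>The products of an element of \<open>J\<close> with a basis vector span J F. For
  \<open>J = carrier R\<close> this becomes, through \<open>ideal_valued_carrier\<close>, an
  induction principle for the free module itself. In the proof \<open>S\<close> merely bounds the
  support, so that clearing the coordinate \<open>c\<close> makes the bound smaller.\<close>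

lemma ideal_valued_induct [consumes 1, case_names zero add]:
  assumes f: "f \<in> ideal_valued J B"
    and zero: "P (\<lambda>_. \<zero>)"
    and add: "\<And>a c g. \<lbrakk>a \<in> J; a \<in> carrier R; c \<in> B; g \<in> carrier (free_module R B); P g\<rbrakk>
      \<Longrightarrow> P (\<lambda>b. a \<otimes> free_gen R c b \<oplus> g b)"
    and J: "\<zero> \<in> J"
  shows "P f"
proof -
  have "P f" if "finite S" "f \<in> ideal_valued J B" "{b. f b \<noteq> \<zero>} \<subseteq> S" for S f
    using that
  proof (induction S arbitrary: f)
    case empty
    then have "f = (\<lambda>_. \<zero>)" by auto
    then show ?case using zero by simp
  next
    case (insert c S)
    show ?case
    proof (cases "f c = \<zero>")
      case True
      then show ?thesis using insert.prems by (intro insert.IH) auto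
    next
      case False
      let ?g = "f(c := \<zero>)"
      have fc: "\<And>b. f b \<in> carrier R" using insert.prems(1) by (auto simp: ideal_valued_def free_module_carrier)
      have "{b. ?g b \<noteq> \<zero>} \<subseteq> {b. f b \<noteq> \<zero>}" by auto
      then have g: "?g \<in> ideal_valued J B"
        using insert.prems(1) J unfolding ideal_valued_def free_module_carrier
        by (auto intro: finite_subset[of _ "{b. f b \<noteq> \<zero>}"])
      have "P ?g" using insert.prems(2) by (intro insert.IH[OF g]) auto
      moreover have "c \<in> B" using False insert.prems(1) by (auto simp: ideal_valued_def free_module_carrier)
      moreover have "f c \<in> J" using insert.prems(1) by (auto simp: ideal_valued_def)
      ultimately have "P (\<lambda>b. f c \<otimes> free_gen R c b \<oplus> ?g b)"
        using fc by (intro add ideal_valuedD(1)[OF g])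
      also have "(\<lambda>b. f c \<otimes> free_gen R c b \<oplus> ?g b) = f"
        using fc by (auto simp: free_gen_def)
      finally show ?thesis .
    qed
  qed
  from this[of "{b. f b \<noteq> \<zero>}" f] f show ?thesis
    by (auto simp: ideal_valued_def free_module_carrier)
qed

lemma ideal_valued_add_PIdlE:
  assumes J: "ideal J R" and a: "a \<in> carrier R" and f: "f \<in> ideal_valued (J <+>\<^bsub>R\<^esub> PIdl a) B"
  obtains h e where "h \<in> ideal_valued J B" "e \<in> carrier (free_module R B)" "f = (\<lambda>b. h b \<oplus> a \<otimes> e b)"
proof -
  interpret J: ideal J R by fact
  \<comment> \<open>The decomposition is chosen separately for every coefficient; asking for h = e =
    0 wherever \<open>f b\<close> is zero keeps the supports of the chosen families finite and
    inside \<open>B\<close>.\<close>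
  have "\<exists>h e. h \<in> J \<and> e \<in> carrier R \<and> f b = h \<oplus> a \<otimes> e \<and> (f b = \<zero> \<longrightarrow> h = \<zero> \<and> e = \<zero>)" for b
  proof (cases "f b = \<zero>")
    case True
    then show ?thesis using a by (intro exI[of _ \<zero>]) auto
  next
    case False
    moreover have "\<exists>h\<in>J. \<exists>e\<in>carrier R. f b = h \<oplus> a \<otimes> e"
      using f mem_add_PIdl_iff[OF J a, of "f b"] by (auto simp: ideal_valued_def)
    ultimately show ?thesis by blast
  qed
  then obtain h e where he: "\<And>b. h b \<in> J" "\<And>b. e b \<in> carrier R" "\<And>b. f b = h b \<oplus> a \<otimes> e b"
    and zero: "\<And>b. f b = \<zero> \<Longrightarrow> h b = \<zero>" "\<And>b. f b = \<zero> \<Longrightarrow> e b = \<zero>"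
    by metis
  have sub: "{b. h b \<noteq> \<zero>} \<subseteq> {b. f b \<noteq> \<zero>}" "{b. e b \<noteq> \<zero>} \<subseteq> {b. f b \<noteq> \<zero>}"
    using zero by blast+
  have fin: "finite {b. f b \<noteq> \<zero>}" "{b. f b \<noteq> \<zero>} \<subseteq> B"
    using f by (auto simp: ideal_valued_def free_module_carrier)
  have "h \<in> ideal_valued J B"
    unfolding ideal_valued_def free_module_carrier
    using he(1) J.a_Hcarr sub(1) fin finite_subset[OF sub(1) fin(1)] by simp
  moreover have "e \<in> carrier (free_module R B)"
    unfolding free_module_carrier using he(2) sub(2) fin finite_subset[OF sub(2) fin(1)] by simp
  moreover have "f = (\<lambda>b. h b \<oplus> a \<otimes> e b)" using he(3) by (rule ext)
  ultimately show thesis by (rule that)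
qed

lemma free_homD:
  assumes "\<phi> \<in> module_hom R (free_module R A) (free_module R B)"
  shows "f \<in> carrier (free_module R A) \<Longrightarrow> \<phi> f \<in> carrier (free_module R B)"
    and "\<lbrakk>f \<in> carrier (free_module R A); g \<in> carrier (free_module R A)\<rbrakk>
      \<Longrightarrow> \<phi> (\<lambda>b. f b \<oplus> g b) = (\<lambda>b. \<phi> f b \<oplus> \<phi> g b)"
    and "\<lbrakk>a \<in> carrier R; f \<in> carrier (free_module R A)\<rbrakk> \<Longrightarrow> \<phi> (\<lambda>b. a \<otimes> f b) = (\<lambda>b. a \<otimes> \<phi> f b)"
    and "\<phi> (\<lambda>_. \<zero>) = (\<lambda>_. \<zero>)"
    and "\<lbrakk>f \<in> carrier (free_module R A); g \<in> carrier (free_module R A)\<rbrakk>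
      \<Longrightarrow> \<phi> (\<lambda>b. f b \<ominus> g b) = (\<lambda>b. \<phi> f b \<ominus> \<phi> g b)"
proof -
  note cl = free_module_closed[OF is_cring]
  show closed: "\<phi> f \<in> carrier (free_module R B)" if "f \<in> carrier (free_module R A)" for f
    using assms that by (auto simp: module_hom_def)
  show add: "\<phi> (\<lambda>b. f b \<oplus> g b) = (\<lambda>b. \<phi> f b \<oplus> \<phi> g b)"
    if "f \<in> carrier (free_module R A)" "g \<in> carrier (free_module R A)" for f g
    using assms that by (auto simp: module_hom_def)
  show smult: "\<phi> (\<lambda>b. a \<otimes> f b) = (\<lambda>b. a \<otimes> \<phi> f b)"
    if "a \<in> carrier R" "f \<in> carrier (free_module R A)" for a f
    using assms that by (auto simp: module_hom_def)
  have z: "(\<lambda>_. \<zero>) \<in> carrier (free_module R A)" by (rule cl(1))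
  have "\<phi> (\<lambda>b. \<zero> \<otimes> (\<lambda>_. \<zero>) b) = (\<lambda>b. \<zero> \<otimes> \<phi> (\<lambda>_. \<zero>) b)" by (rule smult[OF _ z]) simp
  moreover have "\<And>b. \<phi> (\<lambda>_. \<zero>) b \<in> carrier R" using closed[OF z] by (simp add: free_module_carrier)
  ultimately show "\<phi> (\<lambda>_. \<zero>) = (\<lambda>_. \<zero>)" by simp
  show "\<phi> (\<lambda>b. f b \<ominus> g b) = (\<lambda>b. \<phi> f b \<ominus> \<phi> g b)"
    if f: "f \<in> carrier (free_module R A)" and g: "g \<in> carrier (free_module R A)" for f g
  proof -
    have gc: "\<And>b. g b \<in> carrier R" "\<And>b. \<phi> g b \<in> carrier R" "\<And>b. \<phi> f b \<in> carrier R"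
      using f g closed[OF g] closed[OF f] by (auto simp: free_module_carrier)
    have "(\<lambda>b. f b \<ominus> g b) = (\<lambda>b. f b \<oplus> (\<lambda>b. \<ominus> \<one> \<otimes> g b) b)"
      using gc by (simp add: a_minus_def l_minus)
    moreover have "(\<lambda>b. \<ominus> \<one> \<otimes> g b) \<in> carrier (free_module R A)" using g by (intro cl) auto
    ultimately have "\<phi> (\<lambda>b. f b \<ominus> g b) = (\<lambda>b. \<phi> f b \<oplus> (\<ominus> \<one> \<otimes> \<phi> g b))"
      using add[OF f, of "\<lambda>b. \<ominus> \<one> \<otimes> g b"] smult[OF _ g, of "\<ominus> \<one>"] by simp
    then show ?thesis using gc by (simp add: a_minus_def l_minus)
  qed
qed

text \<open>A scalar from \<open>J\<close> can be pulled out of the image of each generator. So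
  every linear map of free modules induces one on the quotients F / J F; this is applied to
  differentials and, later, to a splitting.\<close>

lemma free_hom_ideal_valued:
  assumes J: "ideal J R" and \<phi>: "\<phi> \<in> module_hom R (free_module R A) (free_module R B)"
    and f: "f \<in> ideal_valued J A"
  shows "\<phi> f \<in> ideal_valued J B"
  using f
proof (induction rule: ideal_valued_induct)
  case zero
  show ?case using free_homD(4)[OF \<phi>] ideal_valued_closed(1)[OF J] by simp
next
  case (add a c g)
  have gen: "free_gen R c \<in> carrier (free_module R A)" by (rule free_module_closed[OF is_cring]) fact
  have "(\<lambda>b. a \<otimes> free_gen R c b) \<in> carrier (free_module R A)"
    using gen add by (intro free_module_closed[OF is_cring]) auto
  then have "\<phi> (\<lambda>b. a \<otimes> free_gen R c b \<oplus> g b) = (\<lambda>b. (\<lambda>b. a \<otimes> \<phi> (free_gen R c) b) b \<oplus> \<phi> g b)"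
    using free_homD(2)[OF \<phi>, of "\<lambda>b. a \<otimes> free_gen R c b" g] free_homD(3)[OF \<phi> add(2) gen] add by simp
  moreover have "(\<lambda>b. a \<otimes> \<phi> (free_gen R c) b) \<in> ideal_valued J B"
    using add(1) free_homD(1)[OF \<phi> gen] by (rule ideal_valued_closed(4)[OF J])
  ultimately show ?case using add(5) ideal_valued_closed(2)[OF J] by simp
next
  show "\<zero> \<in> J" using J additive_subgroup.zero_closed ideal.axioms(1) by blast
qed

lemma free_hom_eqI:
  assumes \<phi>: "\<phi> \<in> module_hom R (free_module R A) (free_module R B)"
    and \<psi>: "\<psi> \<in> module_hom R (free_module R A) (free_module R B)"
    and eq: "\<And>a. a \<in> A \<Longrightarrow> \<phi> (free_gen R a) = \<psi> (free_gen R a)"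
    and f: "f \<in> carrier (free_module R A)"
  shows "\<phi> f = \<psi> f"
proof -
  from f have "f \<in> ideal_valued (carrier R) A" by (simp add: ideal_valued_carrier)
  then show ?thesis
  proof (induction rule: ideal_valued_induct)
    case zero
    show ?case using free_homD(4)[OF \<phi>] free_homD(4)[OF \<psi>] by simp
  next
    case (add a c g)
    have gen: "free_gen R c \<in> carrier (free_module R A)" by (rule free_module_closed[OF is_cring]) fact
    have ag: "(\<lambda>b. a \<otimes> free_gen R c b) \<in> carrier (free_module R A)"
      using gen add by (intro free_module_closed[OF is_cring]) auto
    show ?case
      using free_homD(2)[OF \<phi> ag add(4)] free_homD(2)[OF \<psi> ag add(4)]
        free_homD(3)[OF \<phi> add(2) gen] free_homD(3)[OF \<psi> add(2) gen] eq[OF add(3)] add(5) by simp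
  qed simp
qed

end

section \<open>Tor of cyclic modules, computed inside a free complex\<close>

text \<open>Exactness is imposed in positive degrees only: the cokernel of \<open>D\<close> in
  degree 0 is the resolved module, which stays outside the locale. A single \<open>D\<close> acts in
  all degrees, matching \<open>res_diff\<close>.\<close>

locale free_complex = cring R for R (structure) +
  fixes B :: "nat \<Rightarrow> 'i set" and D :: "('i \<Rightarrow> 'a) \<Rightarrow> ('i \<Rightarrow> 'a)"
  assumes D_hom: "D \<in> module_hom R (free_module R (B (Suc n))) (free_module R (B n))"
    and D_D: "f \<in> carrier (free_module R (B (Suc (Suc n)))) \<Longrightarrow> D (D f) = (\<lambda>_. \<zero>)"
    and exact: "\<lbrakk>f \<in> carrier (free_module R (B (Suc n))); D f = (\<lambda>_. \<zero>)\<rbrakk>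
      \<Longrightarrow> f \<in> D ` carrier (free_module R (B (Suc (Suc n))))"
begin

abbreviation C where "C n \<equiv> carrier (free_module R (B n))"
abbreviation V where "V J n \<equiv> ideal_valued J (B n)"

text \<open>As the terms \<open>F\<^sub>i\<close> are free, \<open>R/J \<otimes> F\<^sub>i = F\<^sub>i / J F\<^sub>i\<close>. The preimages in \<open>F\<^sub>i\<close> of the cycles and
  boundaries of this quotient complex define \<open>Tor\<^sub>i(R/J, -)\<close> without any tensor product, and
  \<open>tor_zero J i\<close> says that it vanishes.\<close>

definition cycle :: "'a set \<Rightarrow> nat \<Rightarrow> ('i \<Rightarrow> 'a) \<Rightarrow> bool"
  where "cycle J i f \<longleftrightarrow> f \<in> C i \<and> (\<forall>j. i = Suc j \<longrightarrow> D f \<in> V J j)"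

definition boundary :: "'a set \<Rightarrow> nat \<Rightarrow> ('i \<Rightarrow> 'a) \<Rightarrow> bool"
  where "boundary J i f \<longleftrightarrow> (\<exists>g\<in>C (Suc i). \<exists>h\<in>V J i. f = (\<lambda>b. D g b \<oplus> h b))"

definition tor_zero :: "'a set \<Rightarrow> nat \<Rightarrow> bool"
  where "tor_zero J i \<longleftrightarrow> (\<forall>f. cycle J i f \<longrightarrow> boundary J i f)"

lemmas DD = free_homD[OF D_hom]
lemmas C_closed = free_module_closed[OF is_cring] free_module_minus_closed

lemma C_carrier [intro, simp]: "f \<in> C n \<Longrightarrow> f b \<in> carrier R"
  by (auto simp: free_module_carrier)

lemma DC_carrier [intro, simp]: "f \<in> C (Suc n) \<Longrightarrow> D f b \<in> carrier R"
  using DD(1)[of f n] by (auto simp: free_module_carrier)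

lemma DV: "\<lbrakk>ideal J R; f \<in> V J (Suc n)\<rbrakk> \<Longrightarrow> D f \<in> V J n"
  using free_hom_ideal_valued[OF _ D_hom] by blast

lemma VD: "f \<in> V J n \<Longrightarrow> f \<in> C n" "f \<in> V J n \<Longrightarrow> f b \<in> J"
  by (auto simp: ideal_valued_def)

lemma VI: "f \<in> C n \<Longrightarrow> (\<And>b. f b \<in> J) \<Longrightarrow> f \<in> V J n"
  by (auto simp: ideal_valued_def)

text \<open>The trivial end of the Noetherian induction: modulo the unit ideal every element is a
  boundary, with g = 0 and all of f as error term.\<close>

lemma tor_zero_carrier: "tor_zero (carrier R) i"
  unfolding tor_zero_def
proof (intro allI impI)
  fix f assume "cycle (carrier R) i f"
  then have f: "f \<in> C i" by (simp add: cycle_def)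
  show "boundary (carrier R) i f"
    unfolding boundary_def
  proof (intro bexI)
    show "f = (\<lambda>b. D (\<lambda>_. \<zero>) b \<oplus> f b)" using f DD(4) by auto
  qed (use f C_closed in \<open>auto simp: ideal_valued_carrier\<close>)
qed

text \<open>Exactness of \<open>Tor\<^sub>i\<close> in the middle of \<open>0 \<rightarrow> R/\<mm> \<rightarrow> R/J \<rightarrow> R/(J + aR) \<rightarrow> 0\<close>, where the first map is
  multiplication by \<open>a\<close>.\<close>

lemma tor_zero_colon:
  assumes J: "ideal J R" and \<mm>: "ideal \<mm> R" and a: "a \<in> carrier R"
    and col: "\<And>r. r \<in> carrier R \<Longrightarrow> r \<otimes> a \<in> J \<longleftrightarrow> r \<in> \<mm>"
    and V1: "tor_zero \<mm> i" and V2: "tor_zero (J <+>\<^bsub>R\<^esub> PIdl a) i"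
  shows "tor_zero J i"
  unfolding tor_zero_def
proof (intro allI impI)
  interpret J: ideal J R by fact
  interpret M: ideal \<mm> R by fact
  fix f assume f: "cycle J i f"
  then have fC: "f \<in> C i" by (simp add: cycle_def)
  have "V J j \<subseteq> V (J <+>\<^bsub>R\<^esub> PIdl a) j" for j
    using add_PIdl(2)[OF J a] by (auto simp: ideal_valued_def)
  then have "cycle (J <+>\<^bsub>R\<^esub> PIdl a) i f" using f by (auto simp: cycle_def)
  then obtain g k where g: "g \<in> C (Suc i)" "k \<in> V (J <+>\<^bsub>R\<^esub> PIdl a) i" "f = (\<lambda>b. D g b \<oplus> k b)"
    using V2 by (auto simp: tor_zero_def boundary_def)
  obtain h e where h: "h \<in> V J i" "e \<in> C i" "k = (\<lambda>b. h b \<oplus> a \<otimes> e b)"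
    using ideal_valued_add_PIdlE[OF J a g(2)] .
  have hC: "h \<in> C i" using VD(1) h by auto
  have aeC: "(\<lambda>b. a \<otimes> e b) \<in> C i" using h a by (intro C_closed)
  \<comment> \<open>Applying \<open>D\<close> to f = D g + h + a e gives a D e = D f - D h, which
    has coefficients in \<open>J\<close>; the colon condition then puts the coefficients of D e into
    \<mm>.\<close>
  have "cycle \<mm> i e"
    unfolding cycle_def
  proof (intro conjI allI impI)
    show "e \<in> C i" by fact
    fix j assume j: "i = Suc j"
    have "D f = (\<lambda>b. D (D g) b \<oplus> D k b)"
      using DD(2)[of "D g" j k] DD(1)[of g i] g j VD(1) by auto
    also have "D k = (\<lambda>b. D h b \<oplus> a \<otimes> D e b)"
      using DD(2)[of h j "\<lambda>b. a \<otimes> e b"] DD(3)[of a e j] h hC aeC a j by simp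
    finally have Df: "D f = (\<lambda>b. D h b \<oplus> a \<otimes> D e b)"
      using D_D g j hC h(2) a by auto
    have eC: "D e \<in> C j" using DD(1) h j by auto
    show "D e \<in> V \<mm> j"
    proof (rule VI[OF eC])
      fix b
      have c: "D h b \<in> carrier R" "D e b \<in> carrier R" using hC h j by auto
      have "D e b \<otimes> a = D f b \<ominus> D h b" unfolding Df using c a by algebra
      also have "\<dots> \<in> J"
        using VD(2)[of "D f" J j b] VD(2)[OF DV[OF J, of h j], of b] f h(1) j
        by (simp add: cycle_def a_minus_def)
      finally show "D e b \<in> \<mm>" using col c by simp
    qed
  qed
  then obtain g' e' where g': "g' \<in> C (Suc i)" "e' \<in> V \<mm> i" "e = (\<lambda>b. D g' b \<oplus> e' b)"
    using V1 by (auto simp: tor_zero_def boundary_def)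
  have ag: "(\<lambda>b. a \<otimes> g' b) \<in> C (Suc i)" using g' a by (intro C_closed)
  have e'C: "e' \<in> C i" using g' VD by auto
  \<comment> \<open>Substituting e = D g' + e' gives f = D (g + a g') + (h + a e'), and a e' is
    \<open>J\<close>-valued because e' is \<mm>-valued.\<close>
  show "boundary J i f"
    unfolding boundary_def
  proof (intro bexI)
    show "(\<lambda>b. g b \<oplus> a \<otimes> g' b) \<in> C (Suc i)" using g(1) ag by (intro C_closed(2))
    have "(\<lambda>b. a \<otimes> e' b) \<in> V J i"
    proof (rule VI)
      show "(\<lambda>b. a \<otimes> e' b) \<in> C i" using a e'C by (intro C_closed)
      show "a \<otimes> e' b \<in> J" for b using col[of "e' b"] VD(2)[OF g'(2)] M.a_Hcarr a by (simp add: m_comm)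
    qed
    then show "(\<lambda>b. h b \<oplus> a \<otimes> e' b) \<in> V J i" using h ideal_valued_closed(2)[OF J] by auto
    have "D (\<lambda>b. g b \<oplus> a \<otimes> g' b) = (\<lambda>b. D g b \<oplus> a \<otimes> D g' b)"
      using DD(2)[OF g(1) ag] DD(3)[OF a g'(1)] by simp
    moreover have "f b = (D g b \<oplus> a \<otimes> D g' b) \<oplus> (h b \<oplus> a \<otimes> e' b)" for b
    proof -
      have c: "D g b \<in> carrier R" "D g' b \<in> carrier R" "h b \<in> carrier R" "e' b \<in> carrier R"
        using g g' hC e'C by auto
      show ?thesis unfolding g(3) h(3) g'(3) using c a by algebra
    qed
    ultimately show "f = (\<lambda>b. D (\<lambda>b. g b \<oplus> a \<otimes> g' b) b \<oplus> (h b \<oplus> a \<otimes> e' b))" by auto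
  qed
qed

text \<open>In effect R/I is built from R/\<mm> by finitely many extensions. A maximal
  counterexample \<open>J\<close> replaces the composition series: it is proper by
  \<open>tor_zero_carrier\<close>, the strictly larger J + aR is no counterexample, and the kernel
  of R/J \<rightarrow> R/(J + aR) is a copy of R/\<mm>.\<close>

lemma tor_zero_of_residue_field:
  assumes noeth: "noetherian_ring R" and \<mm>: "ideal \<mm> R"
    and only: "\<And>P. primeideal P R \<Longrightarrow> I \<subseteq> P \<Longrightarrow> P = \<mm>"
    and V: "tor_zero \<mm> i" and I: "ideal I R"
  shows "tor_zero I i"
proof (rule ccontr)
  interpret noetherian_ring R by fact
  assume "\<not> tor_zero I i"
  then have "I \<subseteq> I \<and> \<not> tor_zero I i" by simp
  then obtain J where idJ: "ideal J R" and J: "I \<subseteq> J \<and> \<not> tor_zero J i"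
    and max: "\<forall>J'. ideal J' R \<longrightarrow> I \<subseteq> J' \<and> \<not> tor_zero J' i \<longrightarrow> J \<subseteq> J' \<longrightarrow> J' = J"
    by (rule exists_maximal_ideal_with[OF I, where Q = "\<lambda>J. I \<subseteq> J \<and> \<not> tor_zero J i"])
  have ne: "J \<noteq> carrier R" using J tor_zero_carrier by auto
  have "P = \<mm>" if "primeideal P R" "J \<subseteq> P" for P using only that J by blast
  then obtain a where a: "a \<in> carrier R" "a \<notin> J" "\<And>r. r \<in> carrier R \<Longrightarrow> r \<otimes> a \<in> J \<longleftrightarrow> r \<in> \<mm>"
    using exists_colon_eq_prime[OF noeth idJ ne, of \<mm>] by metis
  have "tor_zero (J <+>\<^bsub>R\<^esub> PIdl a) i"
  proof (rule ccontr)
    assume "\<not> ?thesis"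
    then have "J <+>\<^bsub>R\<^esub> PIdl a = J"
      using max[rule_format, OF add_PIdl(1)[OF idJ a(1)]] add_PIdl(2)[OF idJ a(1)] J by auto
    then show False using add_PIdl(3)[OF idJ a(1)] a(2) by simp
  qed
  then have "tor_zero J i" using tor_zero_colon[OF idJ \<mm> a(1,3) V] by blast
  then show False using J by simp
qed

section \<open>Tor along a regular sequence\<close>

text \<open>Torsion of Tor_i(R/J, -), tested one element \<open>y\<close> at a time with an exponent
  that may depend on the class. This is the strength that a step by a single \<open>x\<close>
  consumes, and it passes through injective maps.\<close>

definition torsion_cycles :: "'a set \<Rightarrow> 'a set \<Rightarrow> nat \<Rightarrow> bool"
  where "torsion_cycles T J i \<longleftrightarrow>
    (\<forall>f y. cycle J i f \<longrightarrow> y \<in> T \<longrightarrow> (\<exists>n::nat. boundary J i (\<lambda>b. y [^] n \<otimes> f b)))"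

text \<open>The map \<open>f \<mapsto> e\<close> is the connecting homomorphism \<open>Tor\<^bsub>i+1\<^esub>(R/(J + xR), -) \<rightarrow> Tor\<^sub>i(R/J, -)\<close> of
  \<open>0 \<rightarrow> R/J \<rightarrow> R/J \<rightarrow> R/(J + xR) \<rightarrow> 0\<close>, with multiplication by \<open>x\<close> as first map.\<close>

lemma connecting:
  assumes J: "ideal J R" and x: "nzd_mod J x" and f: "cycle (J <+>\<^bsub>R\<^esub> PIdl x) (Suc i) f"
  obtains h e where "h \<in> V J i" "cycle J i e" "D f = (\<lambda>b. h b \<oplus> x \<otimes> e b)"
proof -
  interpret J: ideal J R by fact
  have xc: "x \<in> carrier R" using x by (rule nzd_mod_carrier)
  have fC: "f \<in> C (Suc i)" using f by (simp add: cycle_def)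
  obtain h e where h: "h \<in> V J i" "e \<in> C i" "D f = (\<lambda>b. h b \<oplus> x \<otimes> e b)"
    using ideal_valued_add_PIdlE[OF J xc, of "D f" "B i"] f by (auto simp: cycle_def)
  have "cycle J i e"
    unfolding cycle_def
  proof (intro conjI allI impI)
    show "e \<in> C i" by fact
    fix j assume j: "i = Suc j"
    have hC: "h \<in> C (Suc j)" using h j VD by auto
    have xe: "(\<lambda>b. x \<otimes> e b) \<in> C (Suc j)" using h xc j by (intro C_closed) auto
    have z: "(\<lambda>b. D h b \<oplus> x \<otimes> D e b) = (\<lambda>_. \<zero>)"
      using D_D[of f j] fC j h(2,3) DD(2)[OF hC xe] DD(3)[OF xc, of e j] by simp
    have eC: "D e \<in> C j" using h j DD(1) by auto
    show "D e \<in> V J j"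
    proof (rule VI[OF eC])
      fix b
      have c: "D h b \<in> carrier R" "D e b \<in> carrier R" using hC h j by auto
      have "D h b \<oplus> x \<otimes> D e b = \<zero>" using z by meson
      then have "x \<otimes> D e b = \<ominus> D h b" using c xc by (metis m_closed minus_equality minus_minus)
      then have "x \<otimes> D e b \<in> J" using VD(2) DV[OF J, of h j] h(1) j by simp
      then show "D e b \<in> J" by (rule nzd_modD[OF x c(2)])
    qed
  qed
  with h that show ?thesis by blast
qed

text \<open>Multiples of \<open>x\<close> vanish modulo \<open>J'\<close>, and an error term in
  \<open>J\<close> is also one in \<open>J'\<close>.\<close>

lemma boundary_add_smult:
  assumes J: "ideal J R" and J': "ideal J' R" and x: "x \<in> J'" "x \<in> carrier R" and sub: "J \<subseteq> J'"
    and f: "boundary J i f" and g: "g \<in> C i"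
  shows "boundary J' i (\<lambda>b. x \<otimes> g b \<oplus> f b)"
proof -
  obtain k h where k: "k \<in> C (Suc i)" "h \<in> V J i" "f = (\<lambda>b. D k b \<oplus> h b)"
    using f by (auto simp: boundary_def)
  have hC: "h \<in> C i" using VD k by auto
  have "(\<lambda>b. x \<otimes> g b) \<in> V J' i" using ideal_valued_closed(4)[OF J' x(1) g] .
  moreover have "h \<in> V J' i" using k sub by (auto simp: ideal_valued_def)
  ultimately have "(\<lambda>b. x \<otimes> g b \<oplus> h b) \<in> V J' i" using ideal_valued_closed(2)[OF J'] by auto
  moreover have "x \<otimes> g b \<oplus> f b = D k b \<oplus> (x \<otimes> g b \<oplus> h b)" for b
  proof -
    have "D k b \<in> carrier R" "h b \<in> carrier R" "g b \<in> carrier R" using k hC g by auto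
    then show ?thesis unfolding k(3) using x(2) by algebra
  qed
  ultimately show ?thesis using k(1) unfolding boundary_def by auto
qed

text \<open>Injectivity of the connecting homomorphism: \<open>bd\<close> expresses that it sends
  the class of \<open>f\<close> to the boundary D g. Then f - x g is a cycle modulo
  \<open>J\<close>, hence a boundary there by \<open>V\<close>, and adding x g back is harmless
  modulo J + xR.\<close>

lemma regular_step_aux:
  assumes J: "ideal J R" and x: "nzd_mod J x" and V: "tor_zero J (Suc i)"
    and f: "f \<in> C (Suc i)" and bd: "g \<in> C (Suc i)" "h \<in> V J i" "D f = (\<lambda>b. x \<otimes> D g b \<oplus> h b)"
  shows "boundary (J <+>\<^bsub>R\<^esub> PIdl x) (Suc i) f"
proof -
  have xc: "x \<in> carrier R" using x by (rule nzd_mod_carrier)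
  have xg: "(\<lambda>b. x \<otimes> g b) \<in> C (Suc i)" using xc bd(1) by (intro C_closed)
  have hC: "h \<in> C i" using VD bd by auto
  let ?f = "\<lambda>b. f b \<ominus> x \<otimes> g b"
  have "?f \<in> C (Suc i)" using f xg by (rule C_closed(5))
  moreover have "D ?f = (\<lambda>b. D f b \<ominus> x \<otimes> D g b)"
    using DD(5)[OF f xg] DD(3)[OF xc bd(1)] by simp
  then have "D ?f = h"
  proof (rule trans, intro ext)
    fix b
    have "D g b \<in> carrier R" "h b \<in> carrier R" using bd(1) hC by auto
    then show "D f b \<ominus> x \<otimes> D g b = h b" unfolding bd(3) using xc by algebra
  qed
  ultimately have "cycle J (Suc i) ?f" using bd(2) by (simp add: cycle_def)
  then have "boundary J (Suc i) ?f" using V by (simp add: tor_zero_def)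
  then have "boundary (J <+>\<^bsub>R\<^esub> PIdl x) (Suc i) (\<lambda>b. x \<otimes> g b \<oplus> ?f b)"
    using boundary_add_smult[OF J add_PIdl(1)[OF J xc] add_PIdl(3)[OF J xc] xc add_PIdl(2)[OF J xc]] bd(1) by blast
  also have "(\<lambda>b. x \<otimes> g b \<oplus> ?f b) = f"
  proof
    fix b
    have "f b \<in> carrier R" "g b \<in> carrier R" using f bd(1) by auto
    then show "x \<otimes> g b \<oplus> ?f b = f b" using xc by algebra
  qed
  finally show ?thesis .
qed

text \<open>In the long exact sequence the group sits between Tor_(i+1)(R/J, -) and Tor_i(R/J, -),
  both zero. Concretely, writing the connecting image as e = D g + k brings \<open>D f\<close> into
  the form required by \<open>regular_step_aux\<close>.\<close>

lemma tor_zero_regular_step: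
  assumes J: "ideal J R" and x: "nzd_mod J x" and V: "tor_zero J i" "tor_zero J (Suc i)"
  shows "tor_zero (J <+>\<^bsub>R\<^esub> PIdl x) (Suc i)"
  unfolding tor_zero_def
proof (intro allI impI)
  fix f assume f: "cycle (J <+>\<^bsub>R\<^esub> PIdl x) (Suc i) f"
  then have fC: "f \<in> C (Suc i)" by (simp add: cycle_def)
  have xc: "x \<in> carrier R" using x by (rule nzd_mod_carrier)
  obtain h e where h: "h \<in> V J i" "cycle J i e" "D f = (\<lambda>b. h b \<oplus> x \<otimes> e b)"
    using connecting[OF J x f] .
  obtain g k where g: "g \<in> C (Suc i)" "k \<in> V J i" "e = (\<lambda>b. D g b \<oplus> k b)"
    using V(1) h(2) by (auto simp: tor_zero_def boundary_def)
  have hk: "h \<in> C i" "k \<in> C i" using h g VD by auto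
  have "(\<lambda>b. x \<otimes> k b) \<in> V J i" using g(2) xc ideal_valued_closed(3)[OF J] by auto
  then have "(\<lambda>b. x \<otimes> k b \<oplus> h b) \<in> V J i" using h(1) ideal_valued_closed(2)[OF J] by auto
  moreover have "D f = (\<lambda>b. x \<otimes> D g b \<oplus> (x \<otimes> k b \<oplus> h b))"
  proof
    fix b
    have "D g b \<in> carrier R" "h b \<in> carrier R" "k b \<in> carrier R" using g(1) hk by auto
    then show "D f b = x \<otimes> D g b \<oplus> (x \<otimes> k b \<oplus> h b)" unfolding h(3) g(3) using xc by algebra
  qed
  ultimately show "boundary (J <+>\<^bsub>R\<^esub> PIdl x) (Suc i) f"
    by (intro regular_step_aux[OF J x V(2) fC g(1)])
qed

text \<open>The injective connecting homomorphism embeds the new Tor into the old one, so the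
  exponent found for the image \<open>e\<close> works for \<open>f\<close> as well.\<close>

lemma torsion_cycles_regular_step:
  assumes J: "ideal J R" and x: "nzd_mod J x" and V: "tor_zero J (Suc i)"
    and T: "torsion_cycles T J i" "T \<subseteq> carrier R"
  shows "torsion_cycles T (J <+>\<^bsub>R\<^esub> PIdl x) (Suc i)"
  unfolding torsion_cycles_def
proof (intro allI impI)
  fix f y assume f: "cycle (J <+>\<^bsub>R\<^esub> PIdl x) (Suc i) f" and y: "y \<in> T"
  then have fC: "f \<in> C (Suc i)" by (simp add: cycle_def)
  have xc: "x \<in> carrier R" using x by (rule nzd_mod_carrier)
  obtain h e where h: "h \<in> V J i" "cycle J i e" "D f = (\<lambda>b. h b \<oplus> x \<otimes> e b)"
    using connecting[OF J x f] .
  obtain n where "boundary J i (\<lambda>b. y [^] (n::nat) \<otimes> e b)"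
    using T(1) h(2) y by (auto simp: torsion_cycles_def)
  then obtain g k where g: "g \<in> C (Suc i)" "k \<in> V J i" "(\<lambda>b. y [^] n \<otimes> e b) = (\<lambda>b. D g b \<oplus> k b)"
    by (auto simp: boundary_def)
  define z where "z = y [^] n"
  have z: "z \<in> carrier R" using y T(2) by (auto simp: z_def)
  have hk: "h \<in> C i" "k \<in> C i" "e \<in> C i" using h g VD by (auto simp: cycle_def)
  have "(\<lambda>b. x \<otimes> k b) \<in> V J i" using g(2) xc ideal_valued_closed(3)[OF J] by auto
  moreover have "(\<lambda>b. z \<otimes> h b) \<in> V J i" using h(1) z ideal_valued_closed(3)[OF J] by auto
  ultimately have "(\<lambda>b. x \<otimes> k b \<oplus> z \<otimes> h b) \<in> V J i" using ideal_valued_closed(2)[OF J] by auto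
  moreover have "D (\<lambda>b. z \<otimes> f b) = (\<lambda>b. x \<otimes> D g b \<oplus> (x \<otimes> k b \<oplus> z \<otimes> h b))"
  proof
    fix b
    have c: "D g b \<in> carrier R" "h b \<in> carrier R" "k b \<in> carrier R" "e b \<in> carrier R"
      using g(1) hk by auto
    have "D (\<lambda>b. z \<otimes> f b) b = z \<otimes> (h b \<oplus> x \<otimes> e b)"
      using DD(3)[OF z fC] h(3) by simp
    also have "\<dots> = z \<otimes> h b \<oplus> x \<otimes> (z \<otimes> e b)" using c z xc by algebra
    also have "z \<otimes> e b = D g b \<oplus> k b" using g(3) unfolding z_def by meson
    also have "z \<otimes> h b \<oplus> x \<otimes> (D g b \<oplus> k b) = x \<otimes> D g b \<oplus> (x \<otimes> k b \<oplus> z \<otimes> h b)" using c z xc by algebra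
    finally show "D (\<lambda>b. z \<otimes> f b) b = x \<otimes> D g b \<oplus> (x \<otimes> k b \<oplus> z \<otimes> h b)" .
  qed
  moreover have "(\<lambda>b. z \<otimes> f b) \<in> C (Suc i)" using z fC by (intro C_closed)
  ultimately have "boundary (J <+>\<^bsub>R\<^esub> PIdl x) (Suc i) (\<lambda>b. z \<otimes> f b)"
    by (intro regular_step_aux[OF J x V _ g(1)])
  then show "\<exists>n::nat. boundary (J <+>\<^bsub>R\<^esub> PIdl x) (Suc i) (\<lambda>b. y [^] n \<otimes> f b)"
    unfolding z_def by blast
qed

text \<open>Among the multiples \<open>x\<^sup>n e\<close> of a nonzero class \<open>e\<close>, the last nonzero one is killed by \<open>x\<close>, hence
  lies in the image of the connecting homomorphism.\<close>

lemma not_tor_zero_regular_step: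
  assumes J: "ideal J R" and x: "nzd_mod J x" "x \<in> T"
    and T: "torsion_cycles T J i" and V: "\<not> tor_zero J i"
  shows "\<not> tor_zero (J <+>\<^bsub>R\<^esub> PIdl x) (Suc i)"
proof
  interpret J: ideal J R by fact
  assume V': "tor_zero (J <+>\<^bsub>R\<^esub> PIdl x) (Suc i)"
  have xc: "x \<in> carrier R" using x(1) by (rule nzd_mod_carrier)
  obtain e0 where e0: "cycle J i e0" "\<not> boundary J i e0" using V by (auto simp: tor_zero_def)
  have e0C: "e0 \<in> C i" using e0 by (simp add: cycle_def)
  have ex: "\<exists>n::nat. boundary J i (\<lambda>b. x [^] n \<otimes> e0 b)" using T e0 x by (auto simp: torsion_cycles_def)
  \<comment> \<open>The least exponent is positive because \<open>e0\<close> itself is no boundary;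
    its predecessor gives the last nonzero multiple.\<close>
  define n where "n = (LEAST n::nat. boundary J i (\<lambda>b. x [^] n \<otimes> e0 b))"
  have n: "boundary J i (\<lambda>b. x [^] n \<otimes> e0 b)" unfolding n_def by (rule LeastI_ex[OF ex])
  have "n \<noteq> 0"
  proof
    assume "n = 0"
    then show False using n e0 e0C by simp
  qed
  then obtain m where m: "n = Suc m" by (cases n) auto
  let ?e = "\<lambda>b. x [^] m \<otimes> e0 b"
  have "\<not> boundary J i ?e"
    using not_less_Least[of m "\<lambda>n::nat. boundary J i (\<lambda>b. x [^] n \<otimes> e0 b)"] m unfolding n_def by simp
  define e where "e = ?e"
  have ne: "\<not> boundary J i e" unfolding e_def by fact
  have eC: "e \<in> C i" unfolding e_def using e0C xc by (intro C_closed) auto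
  have "(\<lambda>b. x [^] n \<otimes> e0 b) = (\<lambda>b. x \<otimes> e b)"
    unfolding m e_def using e0C xc by (auto simp: m_assoc m_lcomm)
  then obtain f h where f: "f \<in> C (Suc i)" "h \<in> V J i" "(\<lambda>b. x \<otimes> e b) = (\<lambda>b. D f b \<oplus> h b)"
    using n by (auto simp: boundary_def)
  have hC: "h \<in> C i" using VD f by auto
  have xe: "x \<otimes> e b = D f b \<oplus> h b" for b using f(3) by meson
  \<comment> \<open>From x e = D f + h it follows that D f = -h + x e, so \<open>f\<close> is a
    cycle modulo J + xR whose connecting image is the class of \<open>e\<close>.\<close>
  have "cycle (J <+>\<^bsub>R\<^esub> PIdl x) (Suc i) f"
    unfolding cycle_def
  proof (intro conjI allI impI)
    show "f \<in> C (Suc i)" by fact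
    fix j assume "Suc i = Suc j"
    then have j: "j = i" by simp
    show "D f \<in> V (J <+>\<^bsub>R\<^esub> PIdl x) j"
      unfolding j
    proof (rule VI)
      show "D f \<in> C i" using f DD(1) by blast
      fix b
      have c: "D f b \<in> carrier R" "h b \<in> carrier R" "e b \<in> carrier R" using f hC eC by auto
      have "D f b = \<ominus> h b \<oplus> (D f b \<oplus> h b)" using c by algebra
      also have "\<dots> = \<ominus> h b \<oplus> x \<otimes> e b" by (simp add: xe)
      finally show "D f b \<in> J <+>\<^bsub>R\<^esub> PIdl x"
        unfolding mem_add_PIdl_iff[OF J xc] using c VD(2)[OF f(2)]
        by (intro bexI[of _ "\<ominus> h b"] bexI[of _ "e b"]) auto
    qed
  qed
  then obtain g k where g: "g \<in> C (Suc (Suc i))" "k \<in> V (J <+>\<^bsub>R\<^esub> PIdl x) (Suc i)" "f = (\<lambda>b. D g b \<oplus> k b)"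
    using V' by (auto simp: tor_zero_def boundary_def)
  obtain h' e' where h': "h' \<in> V J (Suc i)" "e' \<in> C (Suc i)" "k = (\<lambda>b. h' b \<oplus> x \<otimes> e' b)"
    using ideal_valued_add_PIdlE[OF J xc g(2)] .
  have hC': "h' \<in> C (Suc i)" using h' VD by auto
  have xe': "(\<lambda>b. x \<otimes> e' b) \<in> C (Suc i)" using xc h' by (intro C_closed) auto
  have kC: "k \<in> C (Suc i)" using g VD by auto
  have "D f = (\<lambda>b. D (D g) b \<oplus> D k b)"
    using DD(2)[of "D g" i k] DD(1)[of g "Suc i"] g kC by auto
  moreover have "D k = (\<lambda>b. D h' b \<oplus> x \<otimes> D e' b)"
    using DD(2)[OF hC' xe'] DD(3)[OF xc h'(2)] h'(3) by simp
  ultimately have Df: "D f = (\<lambda>b. D h' b \<oplus> x \<otimes> D e' b)"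
    using D_D[OF g(1)] hC' h'(2) xc by auto
  let ?r = "\<lambda>b. e b \<ominus> D e' b"
  \<comment> \<open>Writing f = D g + h' + x e' gives x (e - D e') = D h' + h, with coefficients in
    \<open>J\<close>. Cancelling \<open>x\<close> modulo \<open>J\<close> makes \<open>e\<close> a
    boundary, against its choice.\<close>
  have "?r \<in> V J i"
  proof (rule VI)
    show "?r \<in> C i" using eC DD(1)[OF h'(2)] by (rule C_closed(5))
    fix b
    have c: "D h' b \<in> carrier R" "h b \<in> carrier R" "e b \<in> carrier R" "D e' b \<in> carrier R"
      using hC' hC eC h' by auto
    have "x \<otimes> ?r b = x \<otimes> e b \<ominus> x \<otimes> D e' b" using c xc by algebra
    also have "\<dots> = (D h' b \<oplus> x \<otimes> D e' b) \<oplus> h b \<ominus> x \<otimes> D e' b" by (simp add: xe Df)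
    also have "\<dots> = D h' b \<oplus> h b" using c xc by algebra
    also have "\<dots> \<in> J" using VD(2) DV[OF J h'(1)] f(2) by auto
    finally have "x \<otimes> ?r b \<in> J" .
    moreover have "?r b \<in> carrier R" using c by simp
    ultimately show "?r b \<in> J" using nzd_modD[OF x(1)] by blast
  qed
  moreover have "e = (\<lambda>b. D e' b \<oplus> ?r b)"
  proof
    fix b
    have "e b \<in> carrier R" "D e' b \<in> carrier R" using eC h' by auto
    then show "e b = D e' b \<oplus> ?r b" by algebra
  qed
  moreover note h'(2)
  ultimately have "boundary J i e" unfolding boundary_def by (intro bexI)
  then show False using ne by simp
qed

lemma ideal_zero: "ideal {\<zero>} R" by (rule zeroideal)

lemma V_zero: "V {\<zero>} n = {\<lambda>_. \<zero>}"
  using C_closed(1) by (auto simp: ideal_valued_def)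

text \<open>Modulo the zero ideal there are no error terms, so this is exactness of the complex,
  i.e. Tor_j(R, -) = 0 for j > 0.\<close>

lemma tor_zero_zero: "tor_zero {\<zero>} (Suc i)"
  unfolding tor_zero_def
proof (intro allI impI)
  fix f assume "cycle {\<zero>} (Suc i) f"
  then have "f \<in> C (Suc i)" "D f = (\<lambda>_. \<zero>)" by (auto simp: cycle_def V_zero)
  then obtain g where g: "g \<in> C (Suc (Suc i))" "f = D g" using exact by blast
  then show "boundary {\<zero>} (Suc i) f" by (auto simp: boundary_def V_zero intro!: bexI[of _ g])
qed

text \<open>The conjuncts support each other: vanishing in degree d + 1 makes the connecting
  homomorphism injective, which passes torsion on, and torsion is what keeps the critical Tor from
  vanishing.\<close>

lemma tor_regular_sequence:
  assumes J0: "J 0 = {\<zero>}"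
    and Js: "\<And>i. i < d \<Longrightarrow> J (Suc i) = J i <+>\<^bsub>R\<^esub> PIdl (x i)"
    and x: "\<And>i. i < d \<Longrightarrow> nzd_mod (J i) (x i) \<and> x i \<in> T" and T: "T \<subseteq> carrier R"
    and tors: "torsion_cycles T {\<zero>} 0" and nz: "\<not> tor_zero {\<zero>} 0"
  shows "ideal (J d) R \<and> (\<forall>j>d. tor_zero (J d) j) \<and> torsion_cycles T (J d) d \<and> \<not> tor_zero (J d) d"
  using Js x
proof (induction d)
  case 0
  then show ?case using J0 tors nz ideal_zero tor_zero_zero by (auto simp: gr0_conv_Suc)
next
  case (Suc d)
  then have IH: "ideal (J d) R" "\<And>j. j > d \<Longrightarrow> tor_zero (J d) j" "torsion_cycles T (J d) d" "\<not> tor_zero (J d) d"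
    by auto
  have x: "nzd_mod (J d) (x d)" "x d \<in> T" using Suc.prems(2) by auto
  have xc: "x d \<in> carrier R" using x(1) by (rule nzd_mod_carrier)
  have Js: "J (Suc d) = J d <+>\<^bsub>R\<^esub> PIdl (x d)" using Suc.prems(1) by simp
  show ?case unfolding Js
  proof (intro conjI allI impI)
    show "ideal (J d <+>\<^bsub>R\<^esub> PIdl (x d)) R" using add_PIdl[OF IH(1) xc] by simp
    \<comment> \<open>The step consumes vanishing in degrees j - 1 and j, and both exceed d when j >
      d + 1.\<close>
    show "tor_zero (J d <+>\<^bsub>R\<^esub> PIdl (x d)) j" if "Suc d < j" for j
      using that tor_zero_regular_step[OF IH(1) x(1), of "j - 1"] IH(2)[of "j - 1"] IH(2)[of j] by auto
    show "torsion_cycles T (J d <+>\<^bsub>R\<^esub> PIdl (x d)) (Suc d)"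
      using torsion_cycles_regular_step[OF IH(1) x(1) IH(2)[of "Suc d"] IH(3) T] by simp
    show "\<not> tor_zero (J d <+>\<^bsub>R\<^esub> PIdl (x d)) (Suc d)"
      by (rule not_tor_zero_regular_step[OF IH(1) x IH(3,4)])
  qed
qed

section \<open>Contractible complexes\<close>

text \<open>A complex of free modules that is exact everywhere splits; a splitting is linear, so it
  respects \<open>J\<close>-valued elements, which keeps the complex exact modulo \<open>J\<close>.\<close>

lemma exists_section:
  assumes p: "p \<in> module_hom R (free_module R (B n)) (free_module R (B n))"
    and im: "p ` C n \<subseteq> D ` C (Suc n)"
  obtains s where "s \<in> module_hom R (free_module R (B n)) (free_module R (B (Suc n)))"
    "\<forall>f \<in> C n. D (s f) = p f"
proof -
  interpret F: module R "free_module R (B (Suc n))" by (rule free_module_is_module) (rule is_cring)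
  define \<phi> where "\<phi> b = (SOME g. g \<in> C (Suc n) \<and> D g = p (free_gen R b))" for b
  have \<phi>: "\<phi> b \<in> C (Suc n) \<and> D (\<phi> b) = p (free_gen R b)" if "b \<in> B n" for b
  proof -
    have "p (free_gen R b) \<in> D ` C (Suc n)" using im C_closed(4)[OF that] by blast
    then have "\<exists>g. g \<in> C (Suc n) \<and> D g = p (free_gen R b)" by auto
    then show ?thesis unfolding \<phi>_def by (rule someI_ex)
  qed
  define s where "s = lin_ext R (free_module R (B (Suc n))) \<phi>"
  have s: "s \<in> module_hom R (free_module R (B n)) (free_module R (B (Suc n)))"
    unfolding s_def using \<phi> by (intro F.lin_ext_hom) auto
  have Ds: "(\<lambda>f. D (s f)) \<in> module_hom R (free_module R (B n)) (free_module R (B n))"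
    using s D_hom[of n] by (auto simp: module_hom_def Pi_iff)
  have "D (s f) = p f" if "f \<in> C n" for f
    by (rule free_hom_eqI[OF Ds p _ that]) (use \<phi> in \<open>simp add: s_def F.lin_ext_gen\<close>)
  with s that show ?thesis by blast
qed

text \<open>The splitting is built upwards. In degree 0 the image of \<open>D\<close> is everything,
  so the identity serves. Given \<open>p\<close> in degree n and a section \<open>s\<close> over it,
  f - s (D f) projects onto the kernel of \<open>D\<close>, which exactness identifies with the
  image from above.\<close>

lemma exists_projection:
  assumes surj: "C 0 \<subseteq> D ` C (Suc 0)"
  shows "\<exists>p \<in> module_hom R (free_module R (B n)) (free_module R (B n)).
    p ` C n \<subseteq> D ` C (Suc n) \<and> (\<forall>f \<in> D ` C (Suc n). p f = f)"
proof (induction n)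
  case 0
  show ?case using surj by (intro bexI[of _ "\<lambda>f. f"]) (auto simp: module_hom_def)
next
  case (Suc n)
  then obtain p where p: "p \<in> module_hom R (free_module R (B n)) (free_module R (B n))"
    "p ` C n \<subseteq> D ` C (Suc n)" "\<And>f. f \<in> D ` C (Suc n) \<Longrightarrow> p f = f" by auto
  obtain s where s: "s \<in> module_hom R (free_module R (B n)) (free_module R (B (Suc n)))"
    "\<forall>f \<in> C n. D (s f) = p f" using exists_section[OF p(1,2)] .
  let ?q = "\<lambda>f b. f b \<ominus> s (D f) b"
  have sC: "s (D f) \<in> C (Suc n)" if "f \<in> C (Suc n)" for f
    using that DD(1) free_homD(1)[OF s(1)] by blast
  have qC: "?q f \<in> C (Suc n)" if "f \<in> C (Suc n)" for f
    using C_closed(5)[OF that sC[OF that]] .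
  show ?case
  proof (intro bexI[of _ ?q] conjI ballI subsetI)
    show "?q \<in> module_hom R (free_module R (B (Suc n))) (free_module R (B (Suc n)))"
      unfolding module_hom_def
    proof (intro CollectI conjI allI impI)
      show "?q \<in> C (Suc n) \<rightarrow> C (Suc n)" using qC by blast
    next
      fix f g assume fg: "f \<in> C (Suc n) \<and> g \<in> C (Suc n)"
      then have sfg: "s (D (\<lambda>b. f b \<oplus> g b)) = (\<lambda>b. s (D f) b \<oplus> s (D g) b)"
        using DD(1,2) free_homD(2)[OF s(1)] by auto
      have "(f b \<oplus> g b) \<ominus> (s (D f) b \<oplus> s (D g) b) = (f b \<ominus> s (D f) b) \<oplus> (g b \<ominus> s (D g) b)" for b
      proof -
        have "f b \<in> carrier R" "g b \<in> carrier R" "s (D f) b \<in> carrier R" "s (D g) b \<in> carrier R"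
          using fg sC by auto
        then show ?thesis by algebra
      qed
      then show "?q (f \<oplus>\<^bsub>free_module R (B (Suc n))\<^esub> g) = ?q f \<oplus>\<^bsub>free_module R (B (Suc n))\<^esub> ?q g"
        by (simp add: sfg)
    next
      fix a f assume af: "a \<in> carrier R \<and> f \<in> C (Suc n)"
      then have saf: "s (D (\<lambda>b. a \<otimes> f b)) = (\<lambda>b. a \<otimes> s (D f) b)"
        using DD(1,3) free_homD(3)[OF s(1)] by auto
      have "a \<otimes> f b \<ominus> a \<otimes> s (D f) b = a \<otimes> (f b \<ominus> s (D f) b)" for b
      proof -
        have "a \<in> carrier R" "f b \<in> carrier R" "s (D f) b \<in> carrier R"
          using af sC by auto
        then show ?thesis by algebra
      qed
      then show "?q (a \<odot>\<^bsub>free_module R (B (Suc n))\<^esub> f) = a \<odot>\<^bsub>free_module R (B (Suc n))\<^esub> ?q f"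
        by (simp add: saf)
    qed
  next
    \<comment> \<open>Since \<open>p\<close> fixes the image of \<open>D\<close>, D (s (D f)) = p (D
      f) = D f; hence \<open>?q\<close> takes values in cycles.\<close>
    fix y assume "y \<in> ?q ` C (Suc n)"
    then obtain f where f: "f \<in> C (Suc n)" "y = ?q f" by auto
    have "D y = (\<lambda>b. D f b \<ominus> D (s (D f)) b)" using DD(5)[OF f(1) sC[OF f(1)]] f(2) by simp
    also have "D (s (D f)) = D f" using s(2) p(3) DD(1) f by auto
    finally have "D y = (\<lambda>_. \<zero>)" using f(1) by (simp add: r_neg a_minus_def)
    then show "y \<in> D ` C (Suc (Suc n))" using exact qC f by auto
  next
    fix f assume "f \<in> D ` C (Suc (Suc n))"
    then have f: "f \<in> C (Suc n)" "D f = (\<lambda>_. \<zero>)" using DD(1) D_D by auto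
    then show "?q f = f" using free_homD(4)[OF s(1)] by (simp add: a_minus_def)
  qed
qed

text \<open>Needed for the zero module, whose canonical resolution is not the zero complex: degree 0
  is free on the generator \<open>Gen\<close> of zero.\<close>

lemma tor_zero_of_contractible:
  assumes surj: "C 0 \<subseteq> D ` C (Suc 0)" and J: "ideal J R"
  shows "tor_zero J i"
  unfolding tor_zero_def
proof (intro allI impI)
  fix f assume f: "cycle J i f"
  show "boundary J i f"
  proof (cases i)
    case 0
    then obtain g where g: "g \<in> C (Suc 0)" "f = D g" using f surj by (auto simp: cycle_def)
    then have "f = (\<lambda>b. D g b \<oplus> \<zero>)" by auto
    then show ?thesis unfolding boundary_def 0
      by (rule bexI[OF bexI[OF _ ideal_valued_closed(1)[OF J]] g(1)])
  next
    case (Suc n)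
    have fC: "f \<in> C (Suc n)" and Df: "D f \<in> V J n" using f Suc by (auto simp: cycle_def)
    obtain p where p: "p \<in> module_hom R (free_module R (B n)) (free_module R (B n))"
      "p ` C n \<subseteq> D ` C (Suc n)" "\<And>f. f \<in> D ` C (Suc n) \<Longrightarrow> p f = f"
      using exists_projection[OF surj, of n] by auto
    obtain s where s: "s \<in> module_hom R (free_module R (B n)) (free_module R (B (Suc n)))"
      "\<forall>f \<in> C n. D (s f) = p f" using exists_section[OF p(1,2)] .
    \<comment> \<open>Linearity keeps s (D f) \<open>J\<close>-valued, so it is an admissible error
      term; what remains, f - s (D f), is a genuine cycle and exactness applies.\<close>
    have sV: "s (D f) \<in> V J (Suc n)" using free_hom_ideal_valued[OF J s(1) Df] .
    then have sC: "s (D f) \<in> C (Suc n)" by (rule VD)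
    let ?q = "\<lambda>b. f b \<ominus> s (D f) b"
    have "D ?q = (\<lambda>b. D f b \<ominus> D (s (D f)) b)" using DD(5)[OF fC sC] by simp
    also have "D (s (D f)) = D f" using s(2) p(3) DD(1) fC by auto
    finally have "D ?q = (\<lambda>_. \<zero>)" using fC by (simp add: r_neg a_minus_def)
    then obtain g where g: "g \<in> C (Suc (Suc n))" "?q = D g" using exact C_closed(5)[OF fC sC] by auto
    have "f = (\<lambda>b. D g b \<oplus> s (D f) b)"
    proof
      fix b
      have "f b \<in> carrier R" "s (D f) b \<in> carrier R" using fC sC by auto
      then have "f b = ?q b \<oplus> s (D f) b" by algebra
      then show "f b = D g b \<oplus> s (D f) b" using fun_cong[OF g(2), of b] by simp
    qed
    then show ?thesis using g(1) sV Suc unfolding boundary_def by blast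
  qed
qed

end

section \<open>Quotient modules and tensor products\<close>

lemma module_hom_abelian_group_hom:
  assumes "module R M" "module R N" "h \<in> module_hom R M N"
  shows "abelian_group_hom M N h"
proof -
  interpret M: module R M by fact
  interpret N: module R N by fact
  show ?thesis
    using assms(3)
    by (intro abelian_group_homI M.abelian_group_axioms N.abelian_group_axioms
        group_hom.intro group_hom_axioms.intro M.a_group N.a_group)
      (auto simp: module_hom_def hom_def)
qed

lemma module_hom_minus:
  assumes "module R M" "module R N" "h \<in> module_hom R M N" "x \<in> carrier M" "y \<in> carrier M"
  shows "h (x \<ominus>\<^bsub>M\<^esub> y) = h x \<ominus>\<^bsub>N\<^esub> h y"
proof -
  interpret abelian_group_hom M N h using assms(1-3) by (rule module_hom_abelian_group_hom)
  show ?thesis using assms by (simp add: a_minus_def)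
qed

lemma module_hom_zero:
  assumes "module R M" "module R N" "h \<in> module_hom R M N"
  shows "h \<zero>\<^bsub>M\<^esub> = \<zero>\<^bsub>N\<^esub>"
proof -
  interpret abelian_group_hom M N h using assms(1-3) by (rule module_hom_abelian_group_hom)
  show ?thesis by simp
qed

lemma submodule_a_kernel:
  assumes "module R M" "module R N" "h \<in> module_hom R M N"
  shows "submodule R (a_kernel M N h) M"
proof -
  interpret M: module R M by fact
  interpret N: module R N by fact
  show ?thesis
    using assms module_hom_zero[OF assms]
    by (intro submodule.intro) (auto simp: a_kernel_def' module_hom_def)
qed

lemma submodule_image:
  assumes "module R M" "module R N" "h \<in> module_hom R M N"
  shows "submodule R (h ` carrier M) N"
proof -
  interpret M: module R M by fact
  interpret N: module R N by fact
  have h: "h x \<in> carrier N" if "x \<in> carrier M" for x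
    using assms(3) that by (auto simp: module_hom_def)
  show ?thesis
  proof (rule submodule.intro)
    show "h ` carrier M \<subseteq> carrier N" using h by blast
    show "\<zero>\<^bsub>N\<^esub> \<in> h ` carrier M"
      using module_hom_zero[OF assms] M.zero_closed by (metis imageI)
    show "v \<oplus>\<^bsub>N\<^esub> w \<in> h ` carrier M" if vw: "v \<in> h ` carrier M" "w \<in> h ` carrier M" for v w
    proof -
      obtain x y where "x \<in> carrier M" "y \<in> carrier M" "v = h x" "w = h y" using vw by auto
      then have "v \<oplus>\<^bsub>N\<^esub> w = h (x \<oplus>\<^bsub>M\<^esub> y)" "x \<oplus>\<^bsub>M\<^esub> y \<in> carrier M"
        using module_hom_add[OF assms(3)] by auto
      then show ?thesis by blast
    qed
    show "c \<odot>\<^bsub>N\<^esub> v \<in> h ` carrier M" if cv: "c \<in> carrier R" "v \<in> h ` carrier M" for c v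
    proof -
      obtain x where "x \<in> carrier M" "v = h x" using cv by auto
      then have "c \<odot>\<^bsub>N\<^esub> v = h (c \<odot>\<^bsub>M\<^esub> x)" "c \<odot>\<^bsub>M\<^esub> x \<in> carrier M"
        using module_hom_smult[OF assms(3)] cv by auto
      then show ?thesis by blast
    qed
  qed (rule assms(2))
qed

lemma quot_module_simps:
  "carrier (quot_module M N) = a_rcosets\<^bsub>M\<^esub> N"
  "\<zero>\<^bsub>quot_module M N\<^esub> = N"
  "X \<oplus>\<^bsub>quot_module M N\<^esub> Y = X <+>\<^bsub>M\<^esub> Y"
  "a \<odot>\<^bsub>quot_module M N\<^esub> X = (\<Union>x\<in>X. N +>\<^bsub>M\<^esub> (a \<odot>\<^bsub>M\<^esub> x))"
  by (simp_all add: quot_module_def)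

context module
begin

lemma submodule_abelian_subgroup:
  assumes "submodule R N M"
  shows "abelian_subgroup N M"
proof (rule abelian_subgroupI3)
  interpret N: submodule R N M by fact
  have "\<ominus>\<^bsub>M\<^esub> x \<in> N" if "x \<in> N" for x
  proof -
    have "x \<in> carrier M" using that N.subset by auto
    then have "\<ominus>\<^bsub>M\<^esub> x = (\<ominus> \<one>) \<odot>\<^bsub>M\<^esub> x" by (simp add: smult_l_minus)
    then show ?thesis using that by simp
  qed
  then show "additive_subgroup N M"
    using N.subset by (intro additive_subgroup.intro) (auto simp: subgroup_def a_inv_def)
qed (rule M.abelian_group_axioms)

text \<open>All representatives give the same coset, so the union in \<open>quot_module\<close>
  collapses to a single one.\<close>

lemma quot_smult:
  assumes N: "submodule R N M" and a: "a \<in> carrier R" and x: "x \<in> carrier M"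
  shows "a \<odot>\<^bsub>quot_module M N\<^esub> (N +>\<^bsub>M\<^esub> x) = N +>\<^bsub>M\<^esub> (a \<odot>\<^bsub>M\<^esub> x)"
proof -
  interpret N: submodule R N M by fact
  interpret A: abelian_subgroup N M using N by (rule submodule_abelian_subgroup)
  have eq: "N +>\<^bsub>M\<^esub> (a \<odot>\<^bsub>M\<^esub> z) = N +>\<^bsub>M\<^esub> (a \<odot>\<^bsub>M\<^esub> x)" if "z \<in> N +>\<^bsub>M\<^esub> x" for z
  proof -
    from that obtain n where n: "n \<in> N" "z = n \<oplus>\<^bsub>M\<^esub> x" by (auto simp: a_r_coset_def')
    then have "a \<odot>\<^bsub>M\<^esub> z = a \<odot>\<^bsub>M\<^esub> n \<oplus>\<^bsub>M\<^esub> a \<odot>\<^bsub>M\<^esub> x"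
      using a x N.subset by (auto simp: smult_r_distr)
    then have "a \<odot>\<^bsub>M\<^esub> z \<in> N +>\<^bsub>M\<^esub> (a \<odot>\<^bsub>M\<^esub> x)"
      using n a by (auto simp: a_r_coset_def')
    then show ?thesis using A.a_repr_independence' a x by auto
  qed
  have "N +>\<^bsub>M\<^esub> x \<noteq> {}" using A.a_rcos_self[OF x] by blast
  moreover have "(\<Union>z\<in>N +>\<^bsub>M\<^esub> x. N +>\<^bsub>M\<^esub> (a \<odot>\<^bsub>M\<^esub> z)) = (\<Union>z\<in>N +>\<^bsub>M\<^esub> x. N +>\<^bsub>M\<^esub> (a \<odot>\<^bsub>M\<^esub> x))"
    by (rule SUP_cong[OF refl eq])
  ultimately show ?thesis unfolding quot_module_simps by simp
qed

lemma quot_carrierE: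
  assumes "X \<in> carrier (quot_module M N)"
  obtains x where "x \<in> carrier M" "X = N +>\<^bsub>M\<^esub> x"
  using assms by (auto simp: quot_module_simps A_RCOSETS_def')

lemma quot_carrierI: "x \<in> carrier M \<Longrightarrow> N +>\<^bsub>M\<^esub> x \<in> carrier (quot_module M N)"
  by (auto simp: quot_module_simps A_RCOSETS_def')

lemma quot_add:
  assumes "submodule R N M" "x \<in> carrier M" "y \<in> carrier M"
  shows "(N +>\<^bsub>M\<^esub> x) \<oplus>\<^bsub>quot_module M N\<^esub> (N +>\<^bsub>M\<^esub> y) = N +>\<^bsub>M\<^esub> (x \<oplus>\<^bsub>M\<^esub> y)"
  using abelian_subgroup.a_rcos_sum[OF submodule_abelian_subgroup] assms
  by (auto simp: quot_module_simps)

lemma quot_module_is_module: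
  assumes N: "submodule R N M"
  shows "module R (quot_module M N)"
proof -
  interpret A: abelian_subgroup N M using N by (rule submodule_abelian_subgroup)
  let ?Q = "quot_module M N"
  have zero: "\<zero>\<^bsub>?Q\<^esub> = N +>\<^bsub>M\<^esub> \<zero>\<^bsub>M\<^esub>"
    using A.a_rcos_const[of "\<zero>\<^bsub>M\<^esub>"] by (simp add: quot_module_simps)
  note quot = quot_smult[OF N] quot_add[OF N]
  have "abelian_group ?Q"
  proof (rule abelian_groupI)
    show "\<zero>\<^bsub>?Q\<^esub> \<in> carrier ?Q" unfolding zero by (rule quot_carrierI) simp
    fix X assume "X \<in> carrier ?Q"
    then obtain x where x: "x \<in> carrier M" "X = N +>\<^bsub>M\<^esub> x" by (rule quot_carrierE)
    show "\<zero>\<^bsub>?Q\<^esub> \<oplus>\<^bsub>?Q\<^esub> X = X" using x by (simp add: zero quot)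
    have "(N +>\<^bsub>M\<^esub> \<ominus>\<^bsub>M\<^esub> x) \<oplus>\<^bsub>?Q\<^esub> X = \<zero>\<^bsub>?Q\<^esub>" using x by (simp add: zero quot M.l_neg)
    then show "\<exists>Y\<in>carrier ?Q. Y \<oplus>\<^bsub>?Q\<^esub> X = \<zero>\<^bsub>?Q\<^esub>"
      using quot_carrierI[of "\<ominus>\<^bsub>M\<^esub> x" N] x(1) by blast
    fix Y assume "Y \<in> carrier ?Q"
    then obtain y where y: "y \<in> carrier M" "Y = N +>\<^bsub>M\<^esub> y" by (rule quot_carrierE)
    show "X \<oplus>\<^bsub>?Q\<^esub> Y \<in> carrier ?Q" using x y by (simp add: quot quot_carrierI)
    show "X \<oplus>\<^bsub>?Q\<^esub> Y = Y \<oplus>\<^bsub>?Q\<^esub> X" using x y by (simp add: quot M.a_comm)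
    fix Z assume "Z \<in> carrier ?Q"
    then obtain z where z: "z \<in> carrier M" "Z = N +>\<^bsub>M\<^esub> z" by (rule quot_carrierE)
    show "X \<oplus>\<^bsub>?Q\<^esub> Y \<oplus>\<^bsub>?Q\<^esub> Z = X \<oplus>\<^bsub>?Q\<^esub> (Y \<oplus>\<^bsub>?Q\<^esub> Z)"
      using x y z by (simp add: quot M.a_assoc)
  qed
  then show ?thesis
    by (intro moduleI R.is_cring)
      (auto elim!: quot_carrierE intro: quot_carrierI simp: quot quot_carrierI smult_l_distr smult_r_distr smult_assoc1)
qed

lemma quot_proj_hom:
  assumes N: "submodule R N M"
  shows "(\<lambda>x. N +>\<^bsub>M\<^esub> x) \<in> module_hom R M (quot_module M N)"
  by (auto simp: module_hom_def quot_smult[OF N] quot_add[OF N] intro: quot_carrierI)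

lemma quot_eq_iff:
  assumes N: "submodule R N M" and x: "x \<in> carrier M" "y \<in> carrier M"
  shows "N +>\<^bsub>M\<^esub> x = N +>\<^bsub>M\<^esub> y \<longleftrightarrow> x \<ominus>\<^bsub>M\<^esub> y \<in> N"
proof -
  interpret A: abelian_subgroup N M using N by (rule submodule_abelian_subgroup)
  have "N +>\<^bsub>M\<^esub> x = N +>\<^bsub>M\<^esub> y \<longleftrightarrow> x \<in> N +>\<^bsub>M\<^esub> y"
    using A.a_repr_independence'[of x y] A.a_rcos_self[of x] x by auto
  also have "\<dots> \<longleftrightarrow> x \<ominus>\<^bsub>M\<^esub> y \<in> N"
    using A.a_rcos_module x by (simp add: a_minus_def)
  finally show ?thesis .
qed

lemma quot_eq_zero_iff:
  assumes N: "submodule R N M" and x: "x \<in> carrier M"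
  shows "N +>\<^bsub>M\<^esub> x = N \<longleftrightarrow> x \<in> N"
proof -
  interpret A: abelian_subgroup N M using N by (rule submodule_abelian_subgroup)
  show ?thesis using A.a_rcos_self[OF x] A.a_rcos_const[of x] by auto
qed

end

section \<open>Tensor products and bilinear maps\<close>

context cring
begin

abbreviation tensor_free where
  "tensor_free M N \<equiv> free_module R (carrier M \<times> carrier N)"

abbreviation tensor_span where
  "tensor_span M N \<equiv> module.span R (tensor_free M N) (tensor_relations R M N)"

lemma tensor_relations_subset:
  assumes "module R M" "module R N"
  shows "tensor_relations R M N \<subseteq> carrier (tensor_free M N)"
proof -
  interpret M: module R M by fact
  interpret N: module R N by fact
  interpret F: module R "tensor_free M N" by (rule free_module_is_module) (rule is_cring)
  have gen: "free_gen R (x, y) \<in> carrier (tensor_free M N)" if "x \<in> carrier M" "y \<in> carrier N" for x y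
    using that by (intro free_module_closed is_cring) auto
  show ?thesis
    unfolding tensor_relations_def Let_def
    by (auto simp del: free_module_simps intro!: F.minus_closed F.add.m_closed F.smult_closed gen)
qed

lemma tensor_relationsI:
  fixes M N
  defines "F \<equiv> tensor_free M N"
  shows "\<lbrakk>x \<in> carrier M; x' \<in> carrier M; y \<in> carrier N\<rbrakk> \<Longrightarrow>
      free_gen R (x \<oplus>\<^bsub>M\<^esub> x', y) \<ominus>\<^bsub>F\<^esub> (free_gen R (x, y) \<oplus>\<^bsub>F\<^esub> free_gen R (x', y)) \<in> tensor_relations R M N"
    and "\<lbrakk>x \<in> carrier M; y \<in> carrier N; y' \<in> carrier N\<rbrakk> \<Longrightarrow>
      free_gen R (x, y \<oplus>\<^bsub>N\<^esub> y') \<ominus>\<^bsub>F\<^esub> (free_gen R (x, y) \<oplus>\<^bsub>F\<^esub> free_gen R (x, y')) \<in> tensor_relations R M N"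
    and "\<lbrakk>a \<in> carrier R; x \<in> carrier M; y \<in> carrier N\<rbrakk> \<Longrightarrow>
      free_gen R (a \<odot>\<^bsub>M\<^esub> x, y) \<ominus>\<^bsub>F\<^esub> (a \<odot>\<^bsub>F\<^esub> free_gen R (x, y)) \<in> tensor_relations R M N"
    and "\<lbrakk>a \<in> carrier R; x \<in> carrier M; y \<in> carrier N\<rbrakk> \<Longrightarrow>
      free_gen R (x, a \<odot>\<^bsub>N\<^esub> y) \<ominus>\<^bsub>F\<^esub> (a \<odot>\<^bsub>F\<^esub> free_gen R (x, y)) \<in> tensor_relations R M N"
  unfolding tensor_relations_def Let_def F_def by blast+

lemma tensor_submodule:
  assumes "module R M" "module R N"
  shows "submodule R (tensor_span M N) (tensor_free M N)"
proof -
  interpret F: module R "tensor_free M N" by (rule free_module_is_module) (rule is_cring)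
  show ?thesis by (rule F.span_is_submodule) (rule tensor_relations_subset[OF assms])
qed

lemma tensor_eq: "tensor R M N = quot_module (tensor_free M N) (tensor_span M N)"
  by (simp add: tensor_def Let_def)

lemma tensor_elem_eq: "tensor_elem R M N x y = tensor_span M N +>\<^bsub>tensor_free M N\<^esub> free_gen R (x, y)"
  by (simp add: tensor_elem_def Let_def)

lemma tensor_is_module:
  assumes "module R M" "module R N"
  shows "module R (tensor R M N)"
proof -
  interpret F: module R "tensor_free M N" by (rule free_module_is_module) (rule is_cring)
  show ?thesis unfolding tensor_eq by (rule F.quot_module_is_module[OF tensor_submodule[OF assms]])
qed

lemma tensor_elem_simps:
  assumes M: "module R M" and N: "module R N"
  shows "\<lbrakk>x \<in> carrier M; y \<in> carrier N\<rbrakk> \<Longrightarrow> tensor_elem R M N x y \<in> carrier (tensor R M N)"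
    and "\<lbrakk>x \<in> carrier M; x' \<in> carrier M; y \<in> carrier N\<rbrakk> \<Longrightarrow>
      tensor_elem R M N (x \<oplus>\<^bsub>M\<^esub> x') y = tensor_elem R M N x y \<oplus>\<^bsub>tensor R M N\<^esub> tensor_elem R M N x' y"
    and "\<lbrakk>x \<in> carrier M; y \<in> carrier N; y' \<in> carrier N\<rbrakk> \<Longrightarrow>
      tensor_elem R M N x (y \<oplus>\<^bsub>N\<^esub> y') = tensor_elem R M N x y \<oplus>\<^bsub>tensor R M N\<^esub> tensor_elem R M N x y'"
    and "\<lbrakk>a \<in> carrier R; x \<in> carrier M; y \<in> carrier N\<rbrakk> \<Longrightarrow>
      tensor_elem R M N (a \<odot>\<^bsub>M\<^esub> x) y = a \<odot>\<^bsub>tensor R M N\<^esub> tensor_elem R M N x y"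
    and "\<lbrakk>a \<in> carrier R; x \<in> carrier M; y \<in> carrier N\<rbrakk> \<Longrightarrow>
      tensor_elem R M N x (a \<odot>\<^bsub>N\<^esub> y) = a \<odot>\<^bsub>tensor R M N\<^esub> tensor_elem R M N x y"
proof -
  interpret M: module R M by fact
  interpret N: module R N by fact
  interpret F: module R "tensor_free M N" by (rule free_module_is_module) (rule is_cring)
  let ?F = "tensor_free M N"
  note S = tensor_submodule[OF M N]
  have gen: "free_gen R (x, y) \<in> carrier ?F" if "x \<in> carrier M" "y \<in> carrier N" for x y
    using that by (intro free_module_closed is_cring) auto
  have rel: "r \<in> tensor_span M N" if "r \<in> tensor_relations R M N" for r
    using F.in_own_span[OF tensor_relations_subset[OF M N]] that by auto
  show "tensor_elem R M N x y \<in> carrier (tensor R M N)" if "x \<in> carrier M" "y \<in> carrier N"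
    unfolding tensor_eq tensor_elem_eq by (intro F.quot_carrierI gen that)
  show "tensor_elem R M N (x \<oplus>\<^bsub>M\<^esub> x') y = tensor_elem R M N x y \<oplus>\<^bsub>tensor R M N\<^esub> tensor_elem R M N x' y"
    if "x \<in> carrier M" "x' \<in> carrier M" "y \<in> carrier N"
    unfolding tensor_eq tensor_elem_eq F.quot_add[OF S gen[OF that(1,3)] gen[OF that(2,3)]]
    by (subst F.quot_eq_iff[OF S], (intro gen that M.a_closed F.add.m_closed)+, rule rel)
      (rule tensor_relationsI; rule that)
  show "tensor_elem R M N x (y \<oplus>\<^bsub>N\<^esub> y') = tensor_elem R M N x y \<oplus>\<^bsub>tensor R M N\<^esub> tensor_elem R M N x y'"
    if "x \<in> carrier M" "y \<in> carrier N" "y' \<in> carrier N"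
    unfolding tensor_eq tensor_elem_eq F.quot_add[OF S gen[OF that(1,2)] gen[OF that(1,3)]]
    by (subst F.quot_eq_iff[OF S], (intro gen that N.a_closed F.add.m_closed)+, rule rel)
      (rule tensor_relationsI; rule that)
  show "tensor_elem R M N (a \<odot>\<^bsub>M\<^esub> x) y = a \<odot>\<^bsub>tensor R M N\<^esub> tensor_elem R M N x y"
    if "a \<in> carrier R" "x \<in> carrier M" "y \<in> carrier N"
    unfolding tensor_eq tensor_elem_eq F.quot_smult[OF S that(1) gen[OF that(2,3)]]
    by (subst F.quot_eq_iff[OF S], (intro gen that M.smult_closed F.smult_closed)+, rule rel)
      (rule tensor_relationsI; rule that)
  show "tensor_elem R M N x (a \<odot>\<^bsub>N\<^esub> y) = a \<odot>\<^bsub>tensor R M N\<^esub> tensor_elem R M N x y"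
    if "a \<in> carrier R" "x \<in> carrier M" "y \<in> carrier N"
    unfolding tensor_eq tensor_elem_eq F.quot_smult[OF S that(1) gen[OF that(2,3)]]
    by (subst F.quot_eq_iff[OF S], (intro gen that N.smult_closed F.smult_closed)+, rule rel)
      (rule tensor_relationsI; rule that)
qed

definition bilinear where
  "bilinear M N P \<phi> \<longleftrightarrow>
    (\<forall>x\<in>carrier M. \<forall>y\<in>carrier N. \<phi> (x, y) \<in> carrier P) \<and>
    (\<forall>x\<in>carrier M. \<forall>x'\<in>carrier M. \<forall>y\<in>carrier N. \<phi> (x \<oplus>\<^bsub>M\<^esub> x', y) = \<phi> (x, y) \<oplus>\<^bsub>P\<^esub> \<phi> (x', y)) \<and>
    (\<forall>x\<in>carrier M. \<forall>y\<in>carrier N. \<forall>y'\<in>carrier N. \<phi> (x, y \<oplus>\<^bsub>N\<^esub> y') = \<phi> (x, y) \<oplus>\<^bsub>P\<^esub> \<phi> (x, y')) \<and>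
    (\<forall>a\<in>carrier R. \<forall>x\<in>carrier M. \<forall>y\<in>carrier N. \<phi> (a \<odot>\<^bsub>M\<^esub> x, y) = a \<odot>\<^bsub>P\<^esub> \<phi> (x, y)) \<and>
    (\<forall>a\<in>carrier R. \<forall>x\<in>carrier M. \<forall>y\<in>carrier N. \<phi> (x, a \<odot>\<^bsub>N\<^esub> y) = a \<odot>\<^bsub>P\<^esub> \<phi> (x, y))"

text \<open>Bilinearity puts each of the four families of relations into the kernel of the linear
  extension; the kernel is a submodule, so it contains their span.\<close>

lemma bilinear_lin_ext_zero:
  assumes M: "module R M" and N: "module R N" and P: "module R P" and \<phi>: "bilinear M N P \<phi>"
    and g: "g \<in> tensor_span M N"
  shows "lin_ext R P \<phi> g = \<zero>\<^bsub>P\<^esub>"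
proof -
  let ?F = "tensor_free M N"
  interpret M: module R M by fact
  interpret N: module R N by fact
  interpret P: module R P by fact
  have F: "module R ?F" by (rule free_module_is_module) (rule is_cring)
  then interpret F: module R ?F .
  let ?h = "lin_ext R P \<phi>"
  have \<phi>c: "\<phi> (x, y) \<in> carrier P" if "x \<in> carrier M" "y \<in> carrier N" for x y
    using \<phi> that by (simp add: bilinear_def)
  have h: "?h \<in> module_hom R ?F P" using \<phi>c by (intro P.lin_ext_hom) auto
  have gen: "free_gen R (x, y) \<in> carrier ?F" "?h (free_gen R (x, y)) = \<phi> (x, y)"
    if "x \<in> carrier M" "y \<in> carrier N" for x y
    using that \<phi>c by (auto intro: free_module_closed is_cring P.lin_ext_gen)
  have hadd: "?h (u \<oplus>\<^bsub>?F\<^esub> v) = ?h u \<oplus>\<^bsub>P\<^esub> ?h v" if "u \<in> carrier ?F" "v \<in> carrier ?F" for u v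
    using h that unfolding module_hom_def by blast
  have hsm: "?h (a \<odot>\<^bsub>?F\<^esub> u) = a \<odot>\<^bsub>P\<^esub> ?h u" if "a \<in> carrier R" "u \<in> carrier ?F" for a u
    using h that unfolding module_hom_def by blast
  have ker: "u \<ominus>\<^bsub>?F\<^esub> v \<in> a_kernel ?F P ?h" if "u \<in> carrier ?F" "v \<in> carrier ?F" "?h u = ?h v" "?h v \<in> carrier P" for u v
    using that module_hom_minus[OF F P h that(1,2)] F.minus_closed[OF that(1,2)]
    unfolding a_kernel_def' by (simp add: P.r_neg a_minus_def[of P])
  have "tensor_relations R M N \<subseteq> a_kernel ?F P ?h"
    unfolding tensor_relations_def Let_def
    using \<phi> \<phi>c
    by (auto simp del: free_module_simps simp: bilinear_def hadd hsm gen intro!: ker gen F.add.m_closed F.smult_closed)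
  from F.span_is_subset[OF this submodule_a_kernel[OF F P h]] g
  show ?thesis by (auto simp: a_kernel_def')
qed

text \<open>This is what gives the \<open>the_elem\<close> in \<open>tensor_map\<close> a meaning:
  the image of a coset is a singleton.\<close>

lemma bilinear_lin_ext_coset:
  assumes M: "module R M" and N: "module R N" and P: "module R P" and \<phi>: "bilinear M N P \<phi>"
    and g: "g \<in> carrier (tensor_free M N)"
  shows "lin_ext R P \<phi> ` (tensor_span M N +>\<^bsub>tensor_free M N\<^esub> g) = {lin_ext R P \<phi> g}"
proof -
  let ?F = "tensor_free M N"
  interpret P: module R P by fact
  interpret F: module R ?F by (rule free_module_is_module) (rule is_cring)
  interpret S: submodule R "tensor_span M N" ?F using tensor_submodule[OF M N] .
  interpret A: abelian_subgroup "tensor_span M N" ?F by (rule F.submodule_abelian_subgroup) (rule tensor_submodule[OF M N])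
  have h: "lin_ext R P \<phi> \<in> module_hom R ?F P"
    using \<phi> by (intro P.lin_ext_hom) (auto simp: bilinear_def)
  have "lin_ext R P \<phi> z = lin_ext R P \<phi> g" if "z \<in> tensor_span M N +>\<^bsub>?F\<^esub> g" for z
  proof -
    from that obtain s where s: "s \<in> tensor_span M N" "z = s \<oplus>\<^bsub>?F\<^esub> g"
      unfolding a_r_coset_def' by blast
    then have "lin_ext R P \<phi> z = lin_ext R P \<phi> s \<oplus>\<^bsub>P\<^esub> lin_ext R P \<phi> g"
      using module_hom_add[OF h _ g, of s] S.subset by blast
    then show ?thesis
      using bilinear_lin_ext_zero[OF M N P \<phi> s(1)] module_hom_closed[OF h] g by (auto simp: Pi_iff)
  qed
  moreover have "g \<in> tensor_span M N +>\<^bsub>?F\<^esub> g" using A.a_rcos_self[OF g] .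
  ultimately show ?thesis by blast
qed

lemma tensor_map_elem:
  assumes M: "module R M" and N: "module R N" and N': "module R N'" and \<phi>: "\<phi> \<in> module_hom R N N'"
    and x: "x \<in> carrier M" and y: "y \<in> carrier N"
  shows "tensor_map R M N' \<phi> (tensor_elem R M N x y) = tensor_elem R M N' x (\<phi> y)"
proof -
  let ?T = "tensor R M N'"
  let ?\<psi> = "\<lambda>(x, y). tensor_elem R M N' x (\<phi> y)"
  have T: "module R ?T" by (rule tensor_is_module[OF M N'])
  interpret T: module R ?T by fact
  have \<phi>': "\<phi> y \<in> carrier N'" if "y \<in> carrier N" for y
    using module_hom_closed[OF \<phi>] that by auto
  have "bilinear M N ?T ?\<psi>"
    unfolding bilinear_def
    by (simp add: module_hom_add[OF \<phi>] module_hom_smult[OF \<phi>] \<phi>' tensor_elem_simps[OF M N'])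
  moreover have "free_gen R (x, y) \<in> carrier (tensor_free M N)"
    using x y by (intro free_module_closed is_cring) auto
  ultimately have "tensor_map R M N' \<phi> (tensor_elem R M N x y) = lin_ext R ?T ?\<psi> (free_gen R (x, y))"
    unfolding tensor_map_def tensor_elem_eq[of M N] using bilinear_lin_ext_coset[OF M N T] by simp
  also have "\<dots> = tensor_elem R M N' x (\<phi> y)"
    using tensor_elem_simps(1)[OF M N' x] \<phi>'[OF y] by (subst T.lin_ext_gen) auto
  finally show ?thesis .
qed

end

section \<open>Tensoring with a quotient ring\<close>

context cring
begin

lemma quot_ring_module_simps:
  "carrier (quot_ring_module R J) = carrier (R Quot J)"
  "\<zero>\<^bsub>quot_ring_module R J\<^esub> = \<zero>\<^bsub>R Quot J\<^esub>"
  "X \<oplus>\<^bsub>quot_ring_module R J\<^esub> Y = X \<oplus>\<^bsub>R Quot J\<^esub> Y"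
  "a \<odot>\<^bsub>quot_ring_module R J\<^esub> X = (J +> a) \<otimes>\<^bsub>R Quot J\<^esub> X"
  by (simp_all add: quot_ring_module_def)

lemma quot_ring_coset:
  assumes J: "ideal J R" and ab: "a \<in> carrier R" "b \<in> carrier R"
  shows "J +> a \<in> carrier (R Quot J)"
    and "(J +> a) \<oplus>\<^bsub>R Quot J\<^esub> (J +> b) = J +> (a \<oplus> b)"
    and "(J +> a) \<otimes>\<^bsub>R Quot J\<^esub> (J +> b) = J +> (a \<otimes> b)"
    and "J +> a = J +> b \<longleftrightarrow> a \<ominus> b \<in> J"
    and "J +> a = \<zero>\<^bsub>R Quot J\<^esub> \<longleftrightarrow> a \<in> J"
proof -
  have zero: "\<zero>\<^bsub>R Quot J\<^esub> = J" by (simp add: FactRing_def)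
  interpret J: ideal J R by fact
  interpret h: ring_hom_ring R "R Quot J" "(+>) J" by (rule J.rcos_ring_hom_ring)
  show "J +> a \<in> carrier (R Quot J)" using ab by simp
  show "(J +> a) \<oplus>\<^bsub>R Quot J\<^esub> (J +> b) = J +> (a \<oplus> b)" using ab by simp
  show "(J +> a) \<otimes>\<^bsub>R Quot J\<^esub> (J +> b) = J +> (a \<otimes> b)" using ab by simp
  have "J +> a = J +> b \<longleftrightarrow> a \<in> J +> b"
    using J.a_repr_independence'[of a b] J.a_rcos_self[of a] ab by metis
  also have "\<dots> \<longleftrightarrow> a \<ominus> b \<in> J"
    unfolding a_minus_def by (rule J.a_rcos_module[OF ab(2,1)])
  finally show "J +> a = J +> b \<longleftrightarrow> a \<ominus> b \<in> J" .
  show "J +> a = \<zero>\<^bsub>R Quot J\<^esub> \<longleftrightarrow> a \<in> J"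
    unfolding zero using J.a_rcos_self[OF ab(1)] J.a_rcos_const[of a] by metis
qed

lemma quot_ring_carrierE:
  assumes "X \<in> carrier (R Quot J)"
  obtains x where "x \<in> carrier R" "X = J +> x"
  using assms by (auto simp: FactRing_def A_RCOSETS_def')

lemma quot_ring_module_is_module:
  assumes J: "ideal J R"
  shows "module R (quot_ring_module R J)"
proof -
  interpret J: ideal J R by fact
  interpret Q: cring "R Quot J" by (rule J.quotient_is_cring) (rule is_cring)
  let ?N = "quot_ring_module R J"
  have "abelian_group ?N"
  proof (rule abelian_groupI)
    fix X assume X: "X \<in> carrier ?N"
    then have "(\<ominus>\<^bsub>R Quot J\<^esub> X) \<oplus>\<^bsub>?N\<^esub> X = \<zero>\<^bsub>?N\<^esub>" "\<ominus>\<^bsub>R Quot J\<^esub> X \<in> carrier ?N"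
      by (simp_all add: quot_ring_module_simps Q.l_neg)
    then show "\<exists>Y\<in>carrier ?N. Y \<oplus>\<^bsub>?N\<^esub> X = \<zero>\<^bsub>?N\<^esub>" by blast
  qed (simp_all add: quot_ring_module_simps Q.a_ac)
  then show ?thesis
  proof (intro moduleI is_cring)
    show "\<one> \<odot>\<^bsub>?N\<^esub> X = X" if "X \<in> carrier ?N" for X
      using that quot_ring_coset(3)[OF J one_closed]
      by (auto simp: quot_ring_module_simps elim!: quot_ring_carrierE)
    show "(a \<otimes> b) \<odot>\<^bsub>?N\<^esub> X = a \<odot>\<^bsub>?N\<^esub> (b \<odot>\<^bsub>?N\<^esub> X)"
      if ab: "a \<in> carrier R" "b \<in> carrier R" "X \<in> carrier ?N" for a b X
      using ab quot_ring_coset(1)[OF J, of _ \<zero>]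
      by (simp add: quot_ring_module_simps quot_ring_coset(3)[OF J, symmetric] Q.m_assoc)
    show "(a \<oplus> b) \<odot>\<^bsub>?N\<^esub> X = a \<odot>\<^bsub>?N\<^esub> X \<oplus>\<^bsub>?N\<^esub> b \<odot>\<^bsub>?N\<^esub> X"
      if ab: "a \<in> carrier R" "b \<in> carrier R" "X \<in> carrier ?N" for a b X
      using ab quot_ring_coset(1)[OF J, of _ \<zero>]
      by (simp add: quot_ring_module_simps quot_ring_coset(2)[OF J, symmetric] Q.l_distr)
  qed (use quot_ring_coset(1)[OF J, of _ \<zero>] in \<open>simp_all add: quot_ring_module_simps Q.r_distr\<close>)
qed

text \<open>The reduction \<open>F \<rightarrow> R/J \<otimes> F\<close>, \<open>f \<mapsto> 1 \<otimes> f\<close>.\<close>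

definition red where
  "red J B f = tensor_elem R (quot_ring_module R J) (free_module R B) (J +> \<one>) f"

abbreviation quot_tensor where
  "quot_tensor J B \<equiv> tensor R (quot_ring_module R J) (free_module R B)"

lemma ideal_valued_submodule:
  assumes "ideal J R"
  shows "submodule R (ideal_valued J B) (free_module R B)"
  using ideal_valued_closed[OF assms] ideal_valuedD(1)
  by (intro submodule.intro free_module_is_module is_cring) auto

context
  fixes J assumes J: "ideal J R"
begin

lemma quot_tensor_is_module: "module R (quot_tensor J B)"
  by (intro tensor_is_module quot_ring_module_is_module J free_module_is_module is_cring)

lemma coset_one_closed: "J +> \<one> \<in> carrier (quot_ring_module R J)"
  using quot_ring_coset(1)[OF J one_closed one_closed] by (simp add: quot_ring_module_simps)

lemma red_hom: "red J B \<in> module_hom R (free_module R B) (quot_tensor J B)"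
proof -
  have N: "module R (quot_ring_module R J)" by (rule quot_ring_module_is_module[OF J])
  have F: "module R (free_module R B)" by (rule free_module_is_module) (rule is_cring)
  note te = tensor_elem_simps[OF N F]
  show ?thesis
    unfolding module_hom_def red_def using coset_one_closed
    by (simp del: free_module_simps add: te)
qed

text \<open>The coset of x tensored with y equals 1 tensored with x y, so sums of simple tensors
  collapse to the form 1 tensored with f.\<close>

lemma red_surj: "red J B ` carrier (free_module R B) = carrier (quot_tensor J B)"
proof (intro equalityI subsetI)
  fix t assume "t \<in> red J B ` carrier (free_module R B)"
  then show "t \<in> carrier (quot_tensor J B)" using module_hom_closed[OF red_hom[of B]] by auto
next
  let ?N = "quot_ring_module R J" and ?F = "free_module R B"
  let ?G = "tensor_free ?N ?F" and ?S = "tensor_span ?N ?F" and ?T = "quot_tensor J B"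
  have N: "module R ?N" by (rule quot_ring_module_is_module[OF J])
  have F: "module R ?F" by (rule free_module_is_module) (rule is_cring)
  interpret N: module R ?N by fact
  interpret F: module R ?F by fact
  interpret G: module R ?G by (rule free_module_is_module) (rule is_cring)
  note S = tensor_submodule[OF N F]
  fix t assume "t \<in> carrier ?T"
  then obtain g where g: "g \<in> carrier ?G" "t = ?S +>\<^bsub>?G\<^esub> g"
    unfolding tensor_eq by (rule G.quot_carrierE)
  have "g \<in> ideal_valued (carrier R) (carrier ?N \<times> carrier ?F)" using g by (simp add: ideal_valued_carrier)
  then have "?S +>\<^bsub>?G\<^esub> g \<in> red J B ` carrier ?F"
  proof (induction rule: ideal_valued_induct)
    case zero
    have "?S +>\<^bsub>?G\<^esub> \<zero>\<^bsub>?G\<^esub> = \<zero>\<^bsub>?T\<^esub>"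
      unfolding tensor_eq by (rule module_hom_zero[OF G.module_axioms G.quot_module_is_module[OF S] G.quot_proj_hom[OF S]])
    also have "\<dots> = red J B \<zero>\<^bsub>?F\<^esub>"
      using module_hom_zero[OF F quot_tensor_is_module red_hom] by simp
    finally show ?case using F.zero_closed by auto
  next
    case (add a c g)
    obtain X y where c: "c = (X, y)" "X \<in> carrier ?N" "y \<in> carrier ?F" using add by auto
    obtain x where x: "x \<in> carrier R" "X = J +> x"
      using c(2) by (auto simp: quot_ring_module_simps elim: quot_ring_carrierE)
    have X: "X = x \<odot>\<^bsub>?N\<^esub> (J +> \<one>)"
      using x quot_ring_coset(3)[OF J x(1) one_closed] by (simp add: quot_ring_module_simps)
    obtain f where f: "f \<in> carrier ?F" "?S +>\<^bsub>?G\<^esub> g = red J B f" using add by auto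
    have gen: "free_gen R c \<in> carrier ?G" using add by (intro free_module_closed is_cring)
    have "?S +>\<^bsub>?G\<^esub> (a \<odot>\<^bsub>?G\<^esub> free_gen R c \<oplus>\<^bsub>?G\<^esub> g) =
      a \<odot>\<^bsub>?T\<^esub> (?S +>\<^bsub>?G\<^esub> free_gen R c) \<oplus>\<^bsub>?T\<^esub> (?S +>\<^bsub>?G\<^esub> g)"
      unfolding tensor_eq G.quot_smult[OF S add(2) gen]
      by (subst G.quot_add[OF S _ add(4)]) (use gen add(2) in \<open>simp_all del: free_module_simps\<close>)
    also have "?S +>\<^bsub>?G\<^esub> free_gen R c = red J B (x \<odot>\<^bsub>?F\<^esub> y)"
      unfolding red_def tensor_elem_simps(5)[OF N F x(1) coset_one_closed c(3)]
      unfolding tensor_elem_simps(4)[OF N F x(1) coset_one_closed c(3), symmetric] X[symmetric] c(1)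
      by (rule tensor_elem_eq[symmetric])
    also have "a \<odot>\<^bsub>?T\<^esub> red J B (x \<odot>\<^bsub>?F\<^esub> y) \<oplus>\<^bsub>?T\<^esub> (?S +>\<^bsub>?G\<^esub> g) =
      red J B (a \<odot>\<^bsub>?F\<^esub> (x \<odot>\<^bsub>?F\<^esub> y) \<oplus>\<^bsub>?F\<^esub> f)"
      using f add(2) x(1) c(3)
      by (simp del: free_module_simps add: module_hom_add[OF red_hom] module_hom_smult[OF red_hom])
    finally have "?S +>\<^bsub>?G\<^esub> (a \<odot>\<^bsub>?G\<^esub> free_gen R c \<oplus>\<^bsub>?G\<^esub> g) = red J B (a \<odot>\<^bsub>?F\<^esub> (x \<odot>\<^bsub>?F\<^esub> y) \<oplus>\<^bsub>?F\<^esub> f)" .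
    moreover have "a \<odot>\<^bsub>?F\<^esub> (x \<odot>\<^bsub>?F\<^esub> y) \<oplus>\<^bsub>?F\<^esub> f \<in> carrier ?F"
      using f add(2) x(1) c(3) by (simp del: free_module_simps)
    ultimately have "?S +>\<^bsub>?G\<^esub> (a \<odot>\<^bsub>?G\<^esub> free_gen R c \<oplus>\<^bsub>?G\<^esub> g) \<in> red J B ` carrier ?F"
      by (simp only: imageI)
    then show ?case by simp
  qed simp
  then show "t \<in> red J B ` carrier ?F" using g(2) by simp
qed

lemma quot_tensor_smult_zero:
  assumes a: "a \<in> J" and t: "t \<in> carrier (quot_tensor J B)"
  shows "a \<odot>\<^bsub>quot_tensor J B\<^esub> t = \<zero>\<^bsub>quot_tensor J B\<^esub>"
proof -
  let ?N = "quot_ring_module R J" and ?F = "free_module R B" and ?T = "quot_tensor J B"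
  have N: "module R ?N" by (rule quot_ring_module_is_module[OF J])
  have F: "module R ?F" by (rule free_module_is_module) (rule is_cring)
  interpret N: module R ?N by fact
  interpret T: module R ?T by (rule quot_tensor_is_module)
  have "t \<in> red J B ` carrier ?F" unfolding red_surj by (rule t)
  then obtain f where f: "f \<in> carrier ?F" "t = red J B f" by (rule imageE) (rule that)
  have ac: "a \<in> carrier R" by (rule ideal.Icarr[OF J a])
  have "a \<odot>\<^bsub>?N\<^esub> (J +> \<one>) = \<zero>\<^bsub>?N\<^esub>"
    using quot_ring_coset(3)[OF J ac one_closed] quot_ring_coset(5)[OF J ac ac] a ac
    by (simp add: quot_ring_module_simps)
  \<comment> \<open>Written as a multiple by the scalar 0, the left factor lets the scalar 0 move
    out of the tensor, which is therefore zero.\<close>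
  also have "\<dots> = \<zero> \<odot>\<^bsub>?N\<^esub> \<zero>\<^bsub>?N\<^esub>" by simp
  finally have "a \<odot>\<^bsub>?T\<^esub> t = \<zero> \<odot>\<^bsub>?T\<^esub> tensor_elem R ?N ?F \<zero>\<^bsub>?N\<^esub> f"
    unfolding f(2) red_def
    using tensor_elem_simps(4)[OF N F ac coset_one_closed f(1)]
      tensor_elem_simps(4)[OF N F zero_closed N.zero_closed f(1)] by argo
  then show ?thesis using tensor_elem_simps(1)[OF N F _ f(1)] by simp
qed

text \<open>The identification of the tensor product with F / J F. Elements of J F die because
  \<open>J\<close> kills the tensor product; conversely the bilinear map sending the coset of r and
  y to the class of r y in F / J F sends (1, f) to the class of f.\<close>

lemma red_eq_zero_iff:
  assumes f: "f \<in> carrier (free_module R B)"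
  shows "red J B f = \<zero>\<^bsub>quot_tensor J B\<^esub> \<longleftrightarrow> f \<in> ideal_valued J B"
proof
  let ?N = "quot_ring_module R J" and ?F = "free_module R B"
  let ?G = "tensor_free ?N ?F" and ?S = "tensor_span ?N ?F" and ?T = "quot_tensor J B"
  have N: "module R ?N" by (rule quot_ring_module_is_module[OF J])
  have F: "module R ?F" by (rule free_module_is_module) (rule is_cring)
  interpret J: ideal J R by (rule J)
  interpret N: module R ?N by fact
  interpret F: module R ?F by fact
  interpret G: module R ?G by (rule free_module_is_module) (rule is_cring)
  interpret T: module R ?T by (rule quot_tensor_is_module)
  note S = tensor_submodule[OF N F]
  show "red J B f = \<zero>\<^bsub>?T\<^esub>" if "f \<in> ideal_valued J B"
    using that
  proof (induction rule: ideal_valued_induct)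
    case zero
    then show ?case using module_hom_zero[OF F quot_tensor_is_module red_hom] by simp
  next
    case (add a c g)
    have gen: "free_gen R c \<in> carrier ?F" using add by (intro free_module_closed is_cring)
    have "red J B (a \<odot>\<^bsub>?F\<^esub> free_gen R c \<oplus>\<^bsub>?F\<^esub> g) = a \<odot>\<^bsub>?T\<^esub> red J B (free_gen R c) \<oplus>\<^bsub>?T\<^esub> red J B g"
      using gen add(2,4)
      by (simp del: free_module_simps add: module_hom_add[OF red_hom] module_hom_smult[OF red_hom])
    moreover have "red J B (free_gen R c) \<in> carrier ?T" using module_hom_closed[OF red_hom] gen by auto
    from quot_tensor_smult_zero[OF add(1) this]
    have "a \<odot>\<^bsub>?T\<^esub> red J B (free_gen R c) = \<zero>\<^bsub>?T\<^esub>" .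
    ultimately show ?case using add(5) by simp
  qed simp
  assume zero: "red J B f = \<zero>\<^bsub>?T\<^esub>"
  let ?V = "ideal_valued J B"
  let ?P = "quot_module ?F ?V"
  note V = ideal_valued_submodule[OF J, of B]
  have P: "module R ?P" by (rule F.quot_module_is_module[OF V])
  interpret P: module R ?P by fact
  define rep where "rep X = (SOME r. r \<in> carrier R \<and> X = J +> r)" for X
  have rep: "rep X \<in> carrier R" "X = J +> rep X" if "X \<in> carrier ?N" for X
  proof -
    have "\<exists>r. r \<in> carrier R \<and> X = J +> r"
      using that by (auto simp: quot_ring_module_simps elim: quot_ring_carrierE)
    from someI_ex[OF this] show "rep X \<in> carrier R" "X = J +> rep X" unfolding rep_def by blast+
  qed
  define \<psi> where "\<psi> p = ?V +>\<^bsub>?F\<^esub> (rep (fst p) \<odot>\<^bsub>?F\<^esub> snd p)" for p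
  \<comment> \<open>The choice made by \<open>rep\<close> is immaterial: two representatives differ
    by an element of \<open>J\<close>, which moves \<open>y\<close> into J F.\<close>
  have \<psi>: "\<psi> (X, y) = ?V +>\<^bsub>?F\<^esub> (r \<odot>\<^bsub>?F\<^esub> y)"
    if "X \<in> carrier ?N" "r \<in> carrier R" "X = J +> r" "y \<in> carrier ?F" for X r y
  proof -
    have "rep X \<ominus> r \<in> J" using rep[OF that(1)] quot_ring_coset(4)[OF J, of "rep X" r] that by simp
    then have "(rep X \<ominus> r) \<odot>\<^bsub>?F\<^esub> y \<in> ?V"
      using ideal_valued_closed(4)[OF J _ that(4)] by simp
    also have "(rep X \<ominus> r) \<odot>\<^bsub>?F\<^esub> y = rep X \<odot>\<^bsub>?F\<^esub> y \<ominus>\<^bsub>?F\<^esub> r \<odot>\<^bsub>?F\<^esub> y"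
      using rep[OF that(1)] that
      by (simp del: free_module_simps add: a_minus_def F.smult_l_distr F.smult_l_minus)
    finally show ?thesis
      unfolding \<psi>_def using rep[OF that(1)] that
      by (subst F.quot_eq_iff[OF V]) (simp_all del: free_module_simps)
  qed
  note P_add = F.quot_add[OF V, symmetric] and P_smult = F.quot_smult[OF V, symmetric]
  have "bilinear ?N ?F ?P \<psi>"
    unfolding bilinear_def
  proof (intro conjI ballI)
    fix X y assume X: "X \<in> carrier ?N" and y: "y \<in> carrier ?F"
    note rX = rep[OF X]
    have eq: "\<psi> (X, y) = ?V +>\<^bsub>?F\<^esub> (rep X \<odot>\<^bsub>?F\<^esub> y)" by (simp add: \<psi>_def)
    show "\<psi> (X, y) \<in> carrier ?P"
      unfolding eq using rX y by (intro F.quot_carrierI F.smult_closed)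
    fix y' assume y': "y' \<in> carrier ?F"
    have "\<psi> (X, y \<oplus>\<^bsub>?F\<^esub> y') = ?V +>\<^bsub>?F\<^esub> (rep X \<odot>\<^bsub>?F\<^esub> y \<oplus>\<^bsub>?F\<^esub> rep X \<odot>\<^bsub>?F\<^esub> y')"
      unfolding \<psi>_def fst_conv snd_conv using rX y y' by (simp only: F.smult_r_distr)
    also have "\<dots> = \<psi> (X, y) \<oplus>\<^bsub>?P\<^esub> \<psi> (X, y')"
      unfolding \<psi>_def fst_conv snd_conv using rX y y' by (intro P_add F.smult_closed)
    finally show "\<psi> (X, y \<oplus>\<^bsub>?F\<^esub> y') = \<psi> (X, y) \<oplus>\<^bsub>?P\<^esub> \<psi> (X, y')" .
  next
    fix X X' y assume X: "X \<in> carrier ?N" and X': "X' \<in> carrier ?N" and y: "y \<in> carrier ?F"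
    note rX = rep[OF X] rep[OF X']
    have "X \<oplus>\<^bsub>?N\<^esub> X' = J +> (rep X \<oplus> rep X')"
      using rX quot_ring_coset(2)[OF J rX(1) rX(3)] by (simp add: quot_ring_module_simps)
    then have "\<psi> (X \<oplus>\<^bsub>?N\<^esub> X', y) = ?V +>\<^bsub>?F\<^esub> ((rep X \<oplus> rep X') \<odot>\<^bsub>?F\<^esub> y)"
      by (rule \<psi>[OF N.a_closed[OF X X'] a_closed[OF rX(1,3)] _ y])
    also have "\<dots> = ?V +>\<^bsub>?F\<^esub> (rep X \<odot>\<^bsub>?F\<^esub> y \<oplus>\<^bsub>?F\<^esub> rep X' \<odot>\<^bsub>?F\<^esub> y)"
      using rX y by (simp only: F.smult_l_distr)
    also have "\<dots> = \<psi> (X, y) \<oplus>\<^bsub>?P\<^esub> \<psi> (X', y)"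
      unfolding \<psi>_def fst_conv snd_conv using rX y by (intro P_add F.smult_closed)
    finally show "\<psi> (X \<oplus>\<^bsub>?N\<^esub> X', y) = \<psi> (X, y) \<oplus>\<^bsub>?P\<^esub> \<psi> (X', y)" .
  next
    fix a X y assume a: "a \<in> carrier R" and X: "X \<in> carrier ?N" and y: "y \<in> carrier ?F"
    note rX = rep[OF X]
    have "a \<odot>\<^bsub>?N\<^esub> X = J +> (a \<otimes> rep X)"
      using rX quot_ring_coset(3)[OF J a rX(1)] by (simp add: quot_ring_module_simps)
    then have "\<psi> (a \<odot>\<^bsub>?N\<^esub> X, y) = ?V +>\<^bsub>?F\<^esub> ((a \<otimes> rep X) \<odot>\<^bsub>?F\<^esub> y)"
      by (rule \<psi>[OF N.smult_closed[OF a X] m_closed[OF a rX(1)] _ y])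
    also have "\<dots> = ?V +>\<^bsub>?F\<^esub> (a \<odot>\<^bsub>?F\<^esub> (rep X \<odot>\<^bsub>?F\<^esub> y))"
      using rX y a by (simp only: F.smult_assoc1)
    also have "\<dots> = a \<odot>\<^bsub>?P\<^esub> \<psi> (X, y)"
      unfolding \<psi>_def fst_conv snd_conv using rX y a by (intro P_smult F.smult_closed)
    finally show 1: "\<psi> (a \<odot>\<^bsub>?N\<^esub> X, y) = a \<odot>\<^bsub>?P\<^esub> \<psi> (X, y)" .
    have "\<psi> (X, a \<odot>\<^bsub>?F\<^esub> y) = ?V +>\<^bsub>?F\<^esub> ((rep X \<otimes> a) \<odot>\<^bsub>?F\<^esub> y)"
      unfolding \<psi>_def fst_conv snd_conv using rX y a by (simp only: F.smult_assoc1)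
    also have "(rep X \<otimes> a) = (a \<otimes> rep X)" using a rX by (simp add: m_comm)
    also have "?V +>\<^bsub>?F\<^esub> ((a \<otimes> rep X) \<odot>\<^bsub>?F\<^esub> y) = \<psi> (a \<odot>\<^bsub>?N\<^esub> X, y)"
      using \<open>\<psi> (a \<odot>\<^bsub>?N\<^esub> X, y) = ?V +>\<^bsub>?F\<^esub> ((a \<otimes> rep X) \<odot>\<^bsub>?F\<^esub> y)\<close> by simp
    finally show "\<psi> (X, a \<odot>\<^bsub>?F\<^esub> y) = a \<odot>\<^bsub>?P\<^esub> \<psi> (X, y)" using 1 by simp
  qed
  moreover have gen: "free_gen R (J +> \<one>, f) \<in> carrier ?G"
    using coset_one_closed f by (intro free_module_closed is_cring) auto
  have "free_gen R (J +> \<one>, f) \<in> ?S"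
    using zero G.quot_eq_zero_iff[OF S gen]
    unfolding red_def tensor_elem_eq tensor_eq by (simp add: quot_module_simps)
  ultimately have "lin_ext R ?P \<psi> (free_gen R (J +> \<one>, f)) = \<zero>\<^bsub>?P\<^esub>"
    by (rule bilinear_lin_ext_zero[OF N F P])
  moreover have \<psi>f: "\<psi> (J +> \<one>, f) = ?V +>\<^bsub>?F\<^esub> f"
    using \<psi>[OF coset_one_closed one_closed refl f] f by (simp del: free_module_simps)
  moreover have "?V +>\<^bsub>?F\<^esub> f \<in> carrier ?P" using f by (rule F.quot_carrierI)
  ultimately have "?V +>\<^bsub>?F\<^esub> f = ?V"
    using P.lin_ext_gen[of \<psi> "(J +> \<one>, f)"] by (simp add: quot_module_simps)
  then show "f \<in> ?V" using F.quot_eq_zero_iff[OF V f] by simp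
qed

lemma tensor_map_red:
  assumes "\<phi> \<in> module_hom R (free_module R A) (free_module R B)" "f \<in> carrier (free_module R A)"
  shows "tensor_map R (quot_ring_module R J) (free_module R B) \<phi> (red J A f) = red J B (\<phi> f)"
  unfolding red_def
  by (rule tensor_map_elem) (intro assms quot_ring_module_is_module J free_module_is_module is_cring coset_one_closed)+

lemma tensor_map_hom:
  assumes \<phi>: "\<phi> \<in> module_hom R (free_module R A) (free_module R B)"
  shows "tensor_map R (quot_ring_module R J) (free_module R B) \<phi>
    \<in> module_hom R (quot_tensor J A) (quot_tensor J B)"
proof -
  let ?t = "tensor_map R (quot_ring_module R J) (free_module R B) \<phi>"
  interpret A: module R "free_module R A" by (rule free_module_is_module) (rule is_cring)
  note [simp del] = free_module_simps
  note [simp] = module_hom_add[OF red_hom, symmetric] module_hom_smult[OF red_hom, symmetric]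
    tensor_map_red[OF \<phi>] module_hom_add[OF \<phi>] module_hom_smult[OF \<phi>]
  have \<phi>c: "\<phi> f \<in> carrier (free_module R B)" if "f \<in> carrier (free_module R A)" for f
    using module_hom_closed[OF \<phi>] that by auto
  show ?thesis
    unfolding module_hom_def red_surj[symmetric]
    by (auto simp: \<phi>c)
qed

end

end

section \<open>Modules over the residue field and their dimension\<close>

lemma module_over_quot_simps:
  "carrier (module_over_quot V) = carrier V"
  "\<zero>\<^bsub>module_over_quot V\<^esub> = \<zero>\<^bsub>V\<^esub>"
  "x \<oplus>\<^bsub>module_over_quot V\<^esub> y = x \<oplus>\<^bsub>V\<^esub> y"
  "X \<odot>\<^bsub>module_over_quot V\<^esub> v = the_elem ((\<lambda>a. a \<odot>\<^bsub>V\<^esub> v) ` X)"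
  by (simp_all add: module_over_quot_def)

context module
begin

lemma module_over_quot_smult:
  assumes J: "ideal J R" and kill: "\<And>a v. a \<in> J \<Longrightarrow> v \<in> carrier M \<Longrightarrow> a \<odot>\<^bsub>M\<^esub> v = \<zero>\<^bsub>M\<^esub>"
    and a: "a \<in> carrier R" and v: "v \<in> carrier M"
  shows "(J +> a) \<odot>\<^bsub>module_over_quot M\<^esub> v = a \<odot>\<^bsub>M\<^esub> v"
proof -
  interpret J: ideal J R by fact
  have "b \<odot>\<^bsub>M\<^esub> v = a \<odot>\<^bsub>M\<^esub> v" if b: "b \<in> J +> a" for b
  proof -
    obtain h where h: "h \<in> J" "b = h \<oplus> a" using b by (auto simp: a_r_coset_def')
    then show ?thesis using kill[OF h(1) v] a v by (simp add: smult_l_distr)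
  qed
  moreover have "a \<in> J +> a" using J.a_rcos_self[OF a] .
  ultimately have "(\<lambda>b. b \<odot>\<^bsub>M\<^esub> v) ` (J +> a) = {a \<odot>\<^bsub>M\<^esub> v}" by blast
  then show ?thesis by (simp add: module_over_quot_simps)
qed

lemma module_over_quot_is_module:
  assumes J: "ideal J R" and kill: "\<And>a v. a \<in> J \<Longrightarrow> v \<in> carrier M \<Longrightarrow> a \<odot>\<^bsub>M\<^esub> v = \<zero>\<^bsub>M\<^esub>"
  shows "module (R Quot J) (module_over_quot M)"
proof -
  interpret J: ideal J R by fact
  interpret Q: cring "R Quot J" by (rule J.quotient_is_cring) (rule R.is_cring)
  let ?V = "module_over_quot M"
  have sm: "(J +> a) \<odot>\<^bsub>?V\<^esub> v = a \<odot>\<^bsub>M\<^esub> v" if "a \<in> carrier R" "v \<in> carrier M" for a v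
    by (rule module_over_quot_smult[OF J kill that])
  have "abelian_group ?V"
  proof (rule abelian_groupI)
    fix x assume x: "x \<in> carrier ?V"
    then have "(\<ominus>\<^bsub>M\<^esub> x) \<oplus>\<^bsub>?V\<^esub> x = \<zero>\<^bsub>?V\<^esub>" "\<ominus>\<^bsub>M\<^esub> x \<in> carrier ?V"
      by (simp_all add: module_over_quot_simps M.l_neg)
    then show "\<exists>y\<in>carrier ?V. y \<oplus>\<^bsub>?V\<^esub> x = \<zero>\<^bsub>?V\<^esub>" by blast
  qed (simp_all add: module_over_quot_simps M.a_ac)
  then show ?thesis
  proof (intro moduleI Q.is_cring)
    show "\<one>\<^bsub>R Quot J\<^esub> \<odot>\<^bsub>?V\<^esub> v = v" if "v \<in> carrier ?V" for v
      using sm[OF R.one_closed, of v] that by (simp add: FactRing_def module_over_quot_simps(1))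
  next
    fix X v assume "X \<in> carrier (R Quot J)" and v: "v \<in> carrier ?V"
    then obtain a where a: "a \<in> carrier R" "X = J +> a" by (auto elim: R.quot_ring_carrierE)
    have v': "v \<in> carrier M" using v by (simp add: module_over_quot_simps)
    show "X \<odot>\<^bsub>?V\<^esub> v \<in> carrier ?V" using a v' sm by (simp add: module_over_quot_simps(1))
    show "X \<odot>\<^bsub>?V\<^esub> (v \<oplus>\<^bsub>?V\<^esub> w) = X \<odot>\<^bsub>?V\<^esub> v \<oplus>\<^bsub>?V\<^esub> X \<odot>\<^bsub>?V\<^esub> w" if "w \<in> carrier ?V" for w
      using a v' that sm by (simp add: module_over_quot_simps(1,3) smult_r_distr)
    fix Y assume "Y \<in> carrier (R Quot J)"
    then obtain b where b: "b \<in> carrier R" "Y = J +> b" by (auto elim: R.quot_ring_carrierE)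
    show "(X \<oplus>\<^bsub>R Quot J\<^esub> Y) \<odot>\<^bsub>?V\<^esub> v = X \<odot>\<^bsub>?V\<^esub> v \<oplus>\<^bsub>?V\<^esub> Y \<odot>\<^bsub>?V\<^esub> v"
      using a b v' sm R.quot_ring_coset(2)[OF J a(1) b(1)] by (simp add: module_over_quot_simps(3) smult_l_distr)
    show "(X \<otimes>\<^bsub>R Quot J\<^esub> Y) \<odot>\<^bsub>?V\<^esub> v = X \<odot>\<^bsub>?V\<^esub> (Y \<odot>\<^bsub>?V\<^esub> v)"
      using a b v' sm R.quot_ring_coset(3)[OF J a(1) b(1)] by (simp add: smult_assoc1)
  qed
qed

end

lemma vdim_eq_0_iff:
  assumes "vectorspace K V"
  shows "vdim K V = 0 \<longleftrightarrow> carrier V = {\<zero>\<^bsub>V\<^esub>}"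
proof -
  interpret vectorspace K V by fact
  have span: "span {} = {\<zero>\<^bsub>V\<^esub>}" by (auto simp: span_def lincomb_def)
  show ?thesis
  proof
    assume "vdim K V = 0"
    then have fin: "fin_dim" and dim: "dim = 0" by (auto simp: vdim_def zero_enat_def split: if_splits)
    \<comment> \<open>\<open>dim\<close> is a least cardinality of generating sets, attained because
      \<open>fin_dim\<close> provides one; cardinality 0 leaves only the empty set.\<close>
    from fin have "\<exists>n A. finite A \<and> card A = n \<and> A \<subseteq> carrier V \<and> gen_set A"
      unfolding fin_dim_def by blast
    from LeastI_ex[OF this] have "\<exists>A. finite A \<and> card A = dim \<and> A \<subseteq> carrier V \<and> gen_set A"
      unfolding dim_def .
    then show "carrier V = {\<zero>\<^bsub>V\<^esub>}" using dim span by auto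
  next
    assume V: "carrier V = {\<zero>\<^bsub>V\<^esub>}"
    then have gen: "finite ({} :: 'c set) \<and> card ({} :: 'c set) = 0 \<and> {} \<subseteq> carrier V \<and> gen_set {}" using span by simp
    then have fin: fin_dim unfolding fin_dim_def by blast
    have "dim \<le> 0" unfolding dim_def by (rule Least_le) (use gen in blast)
    then show "vdim K V = 0" using fin by (simp add: vdim_def zero_enat_def)
  qed
qed

section \<open>Betti numbers of torsion modules\<close>

context cring
begin

lemma free_module_minus:
  assumes "f \<in> carrier (free_module R B)" "g \<in> carrier (free_module R B)"
  shows "f \<ominus>\<^bsub>free_module R B\<^esub> g = (\<lambda>b. f b \<ominus> g b)"
proof -
  interpret F: module R "free_module R B" by (rule free_module_is_module) (rule is_cring)
  have gc: "g b \<in> carrier R" for b using assms(2) by (simp add: free_module_carrier)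
  have "(\<lambda>b. \<zero> \<ominus> g b) \<in> carrier (free_module R B)"
    by (rule free_module_minus_closed[OF free_module_closed(1)[OF is_cring] assms(2)])
  then have "(\<lambda>b. \<ominus> g b) \<in> carrier (free_module R B)" using gc by (simp add: a_minus_def)
  then have "\<ominus>\<^bsub>free_module R B\<^esub> g = (\<lambda>b. \<ominus> g b)"
    using gc assms(2) by (intro F.minus_equality) (simp_all add: l_neg)
  then show ?thesis by (simp add: a_minus_def)
qed

end

section \<open>From Betti numbers to the free resolution\<close>

context module
begin

lemma res_free_complex: "free_complex R (res_basis R M) (res_diff R)"
proof (intro free_complex.intro free_complex_axioms.intro R.is_cring)
  show "res_diff R \<in> module_hom R (free_module R (res_basis R M (Suc n))) (free_module R (res_basis R M n))" for n
    using res_diff_hom[of n] by (simp only: res_module_def)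
  note ex = res_exact_Suc[unfolded res_module_def a_kernel_def']
  show "res_diff R (res_diff R f) = (\<lambda>_. \<zero>)"
    if f: "f \<in> carrier (free_module R (res_basis R M (Suc (Suc n))))" for f n
  proof -
    have "res_diff R f \<in> res_diff R ` carrier (free_module R (res_basis R M (Suc (Suc n))))"
      using f by (rule imageI)
    then show ?thesis unfolding ex by simp
  qed
  show "f \<in> res_diff R ` carrier (free_module R (res_basis R M (Suc (Suc n))))"
    if f: "f \<in> carrier (free_module R (res_basis R M (Suc n)))" "res_diff R f = (\<lambda>_. \<zero>)" for f n
    unfolding ex using f by simp
qed

text \<open>The surjections f |-> 1 tensored with f commute with the differentials and have kernel
  \<mm> F, so cycles and boundaries of the tensored complex are exactly the images of
  \<open>cycle\<close> and \<open>boundary\<close>. A vector space of dimension 0 is zero, which for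
  the homology means that every cycle is a boundary.\<close>

lemma betti_eq_0_iff:
  assumes \<mm>: "maximalideal \<mm> R"
  shows "betti R \<mm> d M = 0 \<longleftrightarrow> free_complex.tor_zero R (res_basis R M) (res_diff R) \<mm> d"
proof -
  let ?B = "res_basis R M" and ?D = "res_diff R"
  let ?N = "quot_ring_module R \<mm>"
  interpret m: maximalideal \<mm> R by fact
  have J: "ideal \<mm> R" by (rule m.ideal_axioms)
  interpret X: free_complex R ?B ?D by (rule res_free_complex)
  let ?T = "\<lambda>i. tensor R ?N (free_module R (?B i))"
  let ?r = "\<lambda>i. R.red \<mm> (?B i)"
  have T: "module R (?T i)" for i by (rule R.quot_tensor_is_module[OF J])
  interpret T: module R "?T d" by (rule T)
  have F: "module R (free_module R (?B i))" for i by (rule free_module_is_module) (rule R.is_cring)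
  have tm: "tensor_map R ?N (free_module R (?B i)) ?D (?r (Suc i) f) = ?r i (?D f)" if "f \<in> X.C (Suc i)" for i f
    by (rule R.tensor_map_red[OF J X.D_hom that])
  have tmh: "tensor_map R ?N (free_module R (?B i)) ?D \<in> module_hom R (?T (Suc i)) (?T i)" for i
    by (rule R.tensor_map_hom[OF J X.D_hom])
  have surj: "carrier (?T i) = ?r i ` X.C i" for i by (rule R.red_surj[OF J, symmetric])
  let ?Z = "tor_cycles R d ?N M" and ?Bd = "tor_boundaries R d ?N M"
  have Z_sub: "submodule R ?Z (?T d)"
  proof (cases d)
    case 0
    then have "?Z = carrier (?T d)" by (simp only: tor_cycles_def res_module_def nat.case)
    moreover have "submodule R (carrier (?T d)) (?T d)"
      by (intro submodule.intro T) (auto intro: T.smult_closed)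
    ultimately show ?thesis by simp
  next
    case (Suc j)
    then show ?thesis
      using submodule_a_kernel[OF T T tmh] by (simp add: tor_cycles_def res_module_def)
  qed
  have Z_iff: "?r d f \<in> ?Z \<longleftrightarrow> X.cycle \<mm> d f" if f: "f \<in> X.C d" for f
  proof (cases d)
    case 0
    then show ?thesis using f surj[of 0] by (simp add: tor_cycles_def res_module_def X.cycle_def)
  next
    case (Suc j)
    have "?r d f \<in> carrier (?T d)" using surj[of d] f by blast
    then show ?thesis
      using Suc f tm[of f j] R.red_eq_zero_iff[OF J, of "?D f" "?B j"] X.DD(1)[of f j]
      by (simp add: tor_cycles_def res_module_def X.cycle_def a_kernel_def' del: res_basis.simps)
  qed
  have Bd_eq: "?Bd = (\<lambda>g. ?r d (?D g)) ` X.C (Suc d)"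
  proof -
    have "?Bd = tensor_map R ?N (free_module R (?B d)) ?D ` ?r (Suc d) ` X.C (Suc d)"
      unfolding tor_boundaries_def res_module_def surj by (rule refl)
    also have "\<dots> = (\<lambda>g. ?r d (?D g)) ` X.C (Suc d)"
      unfolding image_image by (rule image_cong[OF refl tm])
    finally show ?thesis .
  qed
  have Bd_sub: "submodule R ?Bd (?T d)"
    unfolding tor_boundaries_def res_module_def by (rule submodule_image[OF T T tmh])
  have Bd_Z: "?Bd \<subseteq> ?Z"
  proof
    fix t assume "t \<in> ?Bd"
    then obtain g where g: "g \<in> X.C (Suc d)" "t = ?r d (?D g)" unfolding Bd_eq by (rule imageE) (rule that)
    have "X.cycle \<mm> d (?D g)"
      unfolding X.cycle_def
    proof (intro conjI allI impI)
      show "?D g \<in> X.C d" using X.DD(1) g(1) .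
      fix j assume "d = Suc j"
      then show "?D (?D g) \<in> X.V \<mm> j"
        using X.D_D[of g j] g(1) R.ideal_valued_closed(1)[OF J] by simp
    qed
    then show "t \<in> ?Z" unfolding g(2) using Z_iff X.DD(1)[OF g(1)] by blast
  qed
  let ?ZM = "(?T d)\<lparr>carrier := ?Z\<rparr>"
  have ZM: "module R ?ZM" by (rule T.submodule_is_module[OF Z_sub])
  interpret ZM: module R ?ZM by fact
  have B_ZM: "submodule R ?Bd ?ZM"
  proof -
    interpret b: submodule R ?Bd "?T d" by (rule Bd_sub)
    show ?thesis using Bd_Z by (intro submodule.intro ZM) auto
  qed
  let ?H = "Tor R d ?N M"
  have H_eq: "?H = quot_module ?ZM ?Bd" by (simp add: Tor_def res_module_def)
  have H: "module R ?H" unfolding H_eq by (rule ZM.quot_module_is_module[OF B_ZM])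
  interpret H: module R ?H by (rule H)
  \<comment> \<open>The ideal \<mm> already kills the tensor product, so the homology is a vector
    space over the residue field.\<close>
  have kill: "a \<odot>\<^bsub>?H\<^esub> h = \<zero>\<^bsub>?H\<^esub>" if a: "a \<in> \<mm>" and h: "h \<in> carrier ?H" for a h
  proof -
    obtain z where z: "z \<in> carrier ?ZM" "h = ?Bd +>\<^bsub>?ZM\<^esub> z"
      using ZM.quot_carrierE[OF h[unfolded H_eq]] by blast
    have ac: "a \<in> carrier R" using a by (rule m.Icarr)
    have zT: "z \<in> carrier (?T d)" using z(1) submodule.subset[OF Z_sub] by auto
    have "a \<odot>\<^bsub>?H\<^esub> h = ?Bd +>\<^bsub>?ZM\<^esub> (a \<odot>\<^bsub>?ZM\<^esub> z)"
      unfolding H_eq z(2) by (rule ZM.quot_smult[OF B_ZM ac z(1)])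
    also have "a \<odot>\<^bsub>?ZM\<^esub> z = \<zero>\<^bsub>?ZM\<^esub>"
      using R.quot_tensor_smult_zero[OF J a zT] by simp
    also have "?Bd +>\<^bsub>?ZM\<^esub> \<zero>\<^bsub>?ZM\<^esub> = \<zero>\<^bsub>?H\<^esub>"
      unfolding H_eq by (rule module_hom_zero[OF ZM ZM.quot_module_is_module[OF B_ZM] ZM.quot_proj_hom[OF B_ZM]])
    finally show ?thesis .
  qed
  have "vectorspace (R Quot \<mm>) (module_over_quot ?H)"
    by (intro vectorspace.intro H.module_over_quot_is_module[OF J kill] m.quotient_is_field R.is_cring)
  then have "betti R \<mm> d M = 0 \<longleftrightarrow> carrier ?H = {\<zero>\<^bsub>?H\<^esub>}"
    unfolding betti_def by (simp add: vdim_eq_0_iff module_over_quot_simps)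
  also have "\<dots> \<longleftrightarrow> ?Z \<subseteq> ?Bd"
  proof
    assume *: "carrier ?H = {\<zero>\<^bsub>?H\<^esub>}"
    show "?Z \<subseteq> ?Bd"
    proof
      fix z assume "z \<in> ?Z"
      then have z: "z \<in> carrier ?ZM" by simp
      then have "?Bd +>\<^bsub>?ZM\<^esub> z \<in> carrier ?H" unfolding H_eq by (rule ZM.quot_carrierI)
      then have "?Bd +>\<^bsub>?ZM\<^esub> z = ?Bd" unfolding * by (simp add: H_eq quot_module_simps)
      then show "z \<in> ?Bd" using ZM.quot_eq_zero_iff[OF B_ZM z] by blast
    qed
  next
    assume *: "?Z \<subseteq> ?Bd"
    have "h = \<zero>\<^bsub>?H\<^esub>" if h: "h \<in> carrier ?H" for h
    proof -
      obtain z where z: "z \<in> carrier ?ZM" "h = ?Bd +>\<^bsub>?ZM\<^esub> z"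
        using ZM.quot_carrierE[OF h[unfolded H_eq]] by blast
      have "z \<in> ?Bd" using z(1) * by auto
      then have "h = ?Bd" using ZM.quot_eq_zero_iff[OF B_ZM z(1)] z(2) by blast
      then show ?thesis by (simp add: H_eq quot_module_simps)
    qed
    then show "carrier ?H = {\<zero>\<^bsub>?H\<^esub>}" using H.zero_closed by blast
  qed
  also have "\<dots> \<longleftrightarrow> X.tor_zero \<mm> d"
  proof -
    have bd: "?r d f \<in> ?Bd \<longleftrightarrow> X.boundary \<mm> d f" if f: "f \<in> X.C d" for f
    proof -
      \<comment> \<open>Equality of the two classes says that f - D g is \<mm>-valued, and this
        difference is the error term in \<open>boundary\<close>.\<close>
      have eq: "?r d f = ?r d (?D g) \<longleftrightarrow> (\<lambda>b. f b \<ominus> ?D g b) \<in> X.V \<mm> d" if g: "g \<in> X.C (Suc d)" for g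
      proof -
        have Dg: "?D g \<in> X.C d" using X.DD(1)[OF g] .
        have rc: "?r d f \<in> carrier (?T d)" "?r d (?D g) \<in> carrier (?T d)" using surj[of d] f Dg by blast+
        have "?r d f = ?r d (?D g) \<longleftrightarrow> ?r d f \<ominus>\<^bsub>?T d\<^esub> ?r d (?D g) = \<zero>\<^bsub>?T d\<^esub>"
          using rc by (metis T.M.minus_eq T.M.r_neg T.M.minus_equality T.M.minus_minus T.M.a_inv_closed)
        also have "?r d f \<ominus>\<^bsub>?T d\<^esub> ?r d (?D g) = ?r d (\<lambda>b. f b \<ominus> ?D g b)"
          using module_hom_minus[OF F T R.red_hom[OF J] f Dg] R.free_module_minus[OF f Dg] by simp
        also have "?r d (\<lambda>b. f b \<ominus> ?D g b) = \<zero>\<^bsub>?T d\<^esub> \<longleftrightarrow> (\<lambda>b. f b \<ominus> ?D g b) \<in> X.V \<mm> d"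
          by (rule R.red_eq_zero_iff[OF J X.C_closed(5)[OF f Dg]])
        finally show ?thesis .
      qed
      have "X.boundary \<mm> d f \<longleftrightarrow> (\<exists>g\<in>X.C (Suc d). (\<lambda>b. f b \<ominus> ?D g b) \<in> X.V \<mm> d)"
      proof
        assume "X.boundary \<mm> d f"
        then obtain g h where g: "g \<in> X.C (Suc d)" "h \<in> X.V \<mm> d" "f = (\<lambda>b. ?D g b \<oplus> h b)"
          unfolding X.boundary_def by blast
        have "(\<lambda>b. f b \<ominus> ?D g b) = h"
        proof
          fix b
          have "?D g b \<in> carrier R" "h b \<in> carrier R" using g X.VD(1)[OF g(2)] by auto
          then show "f b \<ominus> ?D g b = h b" unfolding g(3) by algebra
        qed
        then have "(\<lambda>b. f b \<ominus> ?D g b) \<in> X.V \<mm> d" using g(2) by (simp only:)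
        then show "\<exists>g\<in>X.C (Suc d). (\<lambda>b. f b \<ominus> ?D g b) \<in> X.V \<mm> d" by (rule bexI[OF _ g(1)])
      next
        assume "\<exists>g\<in>X.C (Suc d). (\<lambda>b. f b \<ominus> ?D g b) \<in> X.V \<mm> d"
        then obtain g where g: "g \<in> X.C (Suc d)" "(\<lambda>b. f b \<ominus> ?D g b) \<in> X.V \<mm> d" by blast
        have "f = (\<lambda>b. ?D g b \<oplus> (f b \<ominus> ?D g b))"
        proof
          fix b
          have "?D g b \<in> carrier R" "f b \<in> carrier R" using g f by auto
          then show "f b = ?D g b \<oplus> (f b \<ominus> ?D g b)" by algebra
        qed
        then show "X.boundary \<mm> d f"
          unfolding X.boundary_def by (rule bexI[OF bexI[OF _ g(2)] g(1)])
      qed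
      also have "\<dots> \<longleftrightarrow> (\<exists>g\<in>X.C (Suc d). ?r d f = ?r d (?D g))"
        using eq by (intro bex_cong refl) blast
      finally show ?thesis unfolding Bd_eq by blast
    qed
    have Z_T: "?Z \<subseteq> ?r d ` X.C d" using submodule.subset[OF Z_sub] surj[of d] by blast
    show ?thesis
    proof
      assume *: "?Z \<subseteq> ?Bd"
      show "X.tor_zero \<mm> d"
        unfolding X.tor_zero_def
      proof (intro allI impI)
        fix f assume f: "X.cycle \<mm> d f"
        then have fC: "f \<in> X.C d" by (simp add: X.cycle_def)
        then have "?r d f \<in> ?Bd" using Z_iff f * by blast
        then show "X.boundary \<mm> d f" using bd[OF fC] by blast
      qed
    next
      assume *: "X.tor_zero \<mm> d"
      show "?Z \<subseteq> ?Bd"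
      proof
        fix z assume z: "z \<in> ?Z"
        then obtain f where f: "f \<in> X.C d" "z = ?r d f" using Z_T by blast
        then have "X.boundary \<mm> d f" using z Z_iff[OF f(1)] * unfolding X.tor_zero_def by blast
        then show "z \<in> ?Bd" using bd[OF f(1)] f(2) by blast
      qed
    qed
  qed
  finally show ?thesis .
qed

end

section \<open>Regular sequences, depth and the theorem\<close>

context cring
begin

lemma genideal_empty: "Idl {} = {\<zero>}"
  using genideal_minimal[OF zeroideal, of "{}"] additive_subgroup.zero_closed[OF ideal.axioms(1)[OF genideal_ideal[of "{}"]]]
  by auto

text \<open>Puts the ideals of a regular sequence into the recursive form J + xR on which the
  homological steps operate.\<close>

lemma genideal_insert:
  assumes "x \<in> carrier R" "A \<subseteq> carrier R"
  shows "Idl (insert x A) = Idl A <+>\<^bsub>R\<^esub> PIdl x"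
proof
  note A = genideal_ideal[OF assms(2)] and xA = genideal_ideal[of "insert x A"]
  note add = add_PIdl[OF A assms(1)]
  show "Idl (insert x A) \<subseteq> Idl A <+>\<^bsub>R\<^esub> PIdl x"
    using add genideal_self[OF assms(2)] by (intro genideal_minimal) auto
  interpret xA: ideal "Idl (insert x A)" R using assms by (intro xA) auto
  have gen: "insert x A \<subseteq> Idl (insert x A)" using assms by (intro genideal_self) auto
  then have "Idl A \<subseteq> Idl (insert x A)" by (intro genideal_minimal xA.ideal_axioms) auto
  then show "Idl A <+>\<^bsub>R\<^esub> PIdl x \<subseteq> Idl (insert x A)"
    using gen mem_add_PIdl_iff[OF A assms(1)] by (auto intro!: xA.a_closed xA.I_r_closed)
qed

lemma nonzerodivisor_imp_nzd_mod:
  assumes I: "ideal I R" and x: "x \<in> carrier R" and nzd: "nonzerodivisor (R Quot I) (I +> x)"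
  shows "nzd_mod I x"
  unfolding nzd_mod_def
proof (intro conjI ballI impI x)
  fix y assume y: "y \<in> carrier R" "x \<otimes> y \<in> I"
  have "(I +> x) \<otimes>\<^bsub>R Quot I\<^esub> (I +> y) = \<zero>\<^bsub>R Quot I\<^esub>"
    unfolding quot_ring_coset(3)[OF I x y(1)]
    using quot_ring_coset(5)[OF I m_closed[OF x y(1)] x] y(2) by blast
  then have "I +> y = \<zero>\<^bsub>R Quot I\<^esub>"
    using nzd quot_ring_coset(1)[OF I y(1) x] unfolding nonzerodivisor_def by blast
  then show "y \<in> I" using quot_ring_coset(5)[OF I y(1) x] by blast
qed

text \<open>Turns torsion with respect to powers of an ideal into torsion by powers of its elements,
  as \<open>torsion_cycles\<close> asks.\<close>

lemma pow_mem_ideal_pow: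
  assumes "y \<in> carrier R" "y \<in> I"
  shows "y [^] (n::nat) \<in> I [^]\<^bsub>ideals_set R\<^esub> n"
proof (induction n)
  case 0
  then show ?case by (simp add: nat_pow_def ideals_set_def)
next
  case (Suc n)
  from ideal_prod.prod[OF Suc assms(2), of R] show ?case
    using assms(1) by (simp add: nat_pow_def ideals_set_def)
qed

end

text \<open>A finite nonzero supremum in \<open>enat\<close> is the maximum of a nonempty finite
  set, hence attained. The value 0 is also the supremum of the empty set, so d = 0 is served by the
  empty list.\<close>

lemma depth_regular_sequenceE:
  assumes "depth R \<mm> = enat d"
  obtains xs where "length xs = d" "set xs \<subseteq> \<mm>"
    "\<And>i. i < d \<Longrightarrow> nonzerodivisor (R Quot (genideal R (set (take i xs)))) (genideal R (set (take i xs)) +>\<^bsub>R\<^esub> xs ! i)"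
proof (cases "d = 0")
  case True
  then show thesis using that[of "[]"] by simp
next
  case False
  let ?A = "{enat (length xs) | xs. set xs \<subseteq> \<mm> \<and> regular_sequence R xs}"
  have "Sup ?A = enat d" using assms by (simp add: depth_def)
  then have "?A \<noteq> {}" "finite ?A" "Max ?A = enat d"
    using False unfolding Sup_enat_def by (auto split: if_splits simp: zero_enat_def)
  then have "enat d \<in> ?A" using Max_in[of ?A] by simp
  then obtain xs where "length xs = d" "set xs \<subseteq> \<mm>" "regular_sequence R xs" by auto
  then show thesis using that[of xs] by (simp add: regular_sequence_def Let_def)
qed

lemma krull_dim_chain_le:
  assumes "krull_dim R = enat d" "\<And>i. i \<le> n \<Longrightarrow> primeideal (P i) R" "\<And>i. i < n \<Longrightarrow> P i \<subset> P (Suc i)"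
  shows "n \<le> d"
proof -
  have "enat n \<le> krull_dim R"
    unfolding krull_dim_def using assms(2,3) by (intro Sup_upper) blast
  then show ?thesis using assms(1) by simp
qed

theorem theorem1p3:
  fixes R :: "('a, 'r) ring_scheme" and \<mm> :: "'a set"
    and \<Omega> :: "('a, 'b, 'm) module_scheme" and d :: nat
  assumes "noetherian_ring R"
    and "local_ring R \<mm>"
    and "cohen_macaulay R \<mm>"
    and "krull_dim R = enat d"
    and "module R \<Omega>"
    and "torsion_module R \<mm> \<Omega>"
  shows "carrier \<Omega> = {\<zero>\<^bsub>\<Omega>\<^esub>} \<longleftrightarrow> betti R \<mm> d \<Omega> = 0"
proof -
  interpret R: cring R using assms(2) by (simp add: local_ring_def)
  interpret \<Omega>: module R \<Omega> by fact
  have max: "maximalideal \<mm> R" using assms(2) by (auto simp: local_ring_def)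
  interpret m: maximalideal \<mm> R by (rule max)
  have \<mm>: "ideal \<mm> R" by (rule m.ideal_axioms)
  interpret X: free_complex R "res_basis R \<Omega>" "res_diff R" by (rule \<Omega>.res_free_complex)
  let ?aug = "res_aug R \<Omega>"
  have aug: "?aug \<in> module_hom R (free_module R (res_basis R \<Omega> 0)) \<Omega>"
    using \<Omega>.res_aug_hom by (simp only: res_module_def)
  have exact0: "f \<in> res_diff R ` X.C (Suc 0) \<longleftrightarrow> ?aug f = \<zero>\<^bsub>\<Omega>\<^esub>" if "f \<in> X.C 0" for f
    using \<Omega>.res_exact_0 that unfolding res_module_def a_kernel_def' by blast
  have "X.tor_zero \<mm> d" if "carrier \<Omega> = {\<zero>\<^bsub>\<Omega>\<^esub>}"
  proof (rule X.tor_zero_of_contractible[OF _ \<mm>])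
    show "X.C 0 \<subseteq> res_diff R ` X.C (Suc 0)"
      using exact0 module_hom_closed[OF aug] that by blast
  qed
  moreover have "\<not> X.tor_zero \<mm> d" if nz: "carrier \<Omega> \<noteq> {\<zero>\<^bsub>\<Omega>\<^esub>}"
  proof
    assume V: "X.tor_zero \<mm> d"
    have "depth R \<mm> = enat d" using assms(3,4) by (simp add: cohen_macaulay_def)
    then obtain xs where xs: "length xs = d" "set xs \<subseteq> \<mm>"
      "\<And>i. i < d \<Longrightarrow> nonzerodivisor (R Quot (genideal R (set (take i xs)))) (genideal R (set (take i xs)) +>\<^bsub>R\<^esub> xs ! i)"
      by (rule depth_regular_sequenceE) (rule that)
    define J where "J i = genideal R (set (take i xs))" for i
    have \<mm>c: "\<mm> \<subseteq> carrier R" by (rule m.a_subset)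
    have xc: "set xs \<subseteq> carrier R" using xs(2) \<mm>c by blast
    have xi: "xs ! i \<in> \<mm>" "xs ! i \<in> carrier R" if "i < d" for i
      using that xs(1,2) xc nth_mem[of i xs] by auto
    have tc: "set (take i xs) \<subseteq> carrier R" for i using xc set_take_subset[of i xs] by blast
    have J: "ideal (J i) R" for i unfolding J_def by (rule R.genideal_ideal[OF tc])
    have J0: "J 0 = {\<zero>\<^bsub>R\<^esub>}" by (simp add: J_def R.genideal_empty)
    have JS: "J (Suc i) = J i <+>\<^bsub>R\<^esub> PIdl\<^bsub>R\<^esub> (xs ! i)" if "i < d" for i
    proof -
      have "set (take (Suc i) xs) = insert (xs ! i) (set (take i xs))"
        using that xs(1) by (simp add: take_Suc_conv_app_nth)
      then show ?thesis unfolding J_def using R.genideal_insert[OF xi(2)[OF that] tc] by simp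
    qed
    have nzd: "R.nzd_mod (J i) (xs ! i)" if "i < d" for i
      using R.nonzerodivisor_imp_nzd_mod[OF J xi(2)[OF that]] xs(3)[OF that] unfolding J_def by blast
    have only: "P = \<mm>" if P: "primeideal P R" "J d \<subseteq> P" for P
    proof (rule ccontr)
      assume "P \<noteq> \<mm>"
      have "P \<subseteq> \<mm>"
        using local_ring_prime_le[OF assms(1,2)] primeideal.axioms(1)[OF P(1)] primeideal.I_notcarr[OF P(1)] by blast
      \<comment> \<open>The chain P \<subset> \<mm> has length 1; the d regular elements extend it
        downwards to length d + 1, beyond the Krull dimension.\<close>
      define Q where "Q i = (if i = 0 then P else \<mm>)" for i :: nat
      have "\<exists>P'. (\<forall>i\<le>1 + d. primeideal (P' i) R) \<and> (\<forall>i<1 + d. P' i \<subset> P' (Suc i))"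
      proof (rule R.prime_chain_extend[OF assms(1), of d J "\<lambda>i. xs ! i" Q 1])
        show "J i \<subseteq> J (Suc i)" if "i < d" for i
          unfolding JS[OF that] by (rule R.add_PIdl(2)[OF J xi(2)[OF that]])
        show "xs ! i \<in> J (Suc i) \<and> R.nzd_mod (J i) (xs ! i)" if "i < d" for i
          unfolding JS[OF that] using nzd[OF that] R.add_PIdl(3)[OF J xi(2)[OF that]] by blast
        show "primeideal (Q i) R" for i
          unfolding Q_def using P(1) R.maximalideal_prime[OF max] by simp
        show "Q i \<subset> Q (Suc i)" if "i < 1" for i
          unfolding Q_def using that \<open>P \<subseteq> \<mm>\<close> \<open>P \<noteq> \<mm>\<close> by auto
      qed (use J P(2) in \<open>auto simp: Q_def\<close>)
      then obtain P' where "\<forall>i\<le>1 + d. primeideal (P' i) R" "\<forall>i<1 + d. P' i \<subset> P' (Suc i)" by blast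
      then have "1 + d \<le> d" by (intro krull_dim_chain_le[OF assms(4), of _ P']) blast+
      then show False by simp
    qed
    \<comment> \<open>In degree 0 the boundaries are the kernel of the augmentation, so Tor_0(R,
      \<Omega>) is \<Omega> itself; torsion and nonvanishing enter the induction from here.\<close>
    have z0: "X.boundary {\<zero>\<^bsub>R\<^esub>} 0 f \<longleftrightarrow> ?aug f = \<zero>\<^bsub>\<Omega>\<^esub>" if f: "f \<in> X.C 0" for f
    proof -
      have "(\<lambda>b. res_diff R g b \<oplus>\<^bsub>R\<^esub> \<zero>\<^bsub>R\<^esub>) = res_diff R g" if "g \<in> X.C (Suc 0)" for g
        using X.DC_carrier[OF that] by (simp del: res_basis.simps)
      then have "X.boundary {\<zero>\<^bsub>R\<^esub>} 0 f \<longleftrightarrow> f \<in> res_diff R ` X.C (Suc 0)"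
        unfolding X.boundary_def X.V_zero by auto
      then show ?thesis using exact0[OF f] by blast
    qed
    have tors: "X.torsion_cycles \<mm> {\<zero>\<^bsub>R\<^esub>} 0"
      unfolding X.torsion_cycles_def
    proof (intro allI impI)
      fix f y assume "X.cycle {\<zero>\<^bsub>R\<^esub>} 0 f" and y: "y \<in> \<mm>"
      then have f: "f \<in> X.C 0" by (simp add: X.cycle_def)
      then have "?aug f \<in> carrier \<Omega>" using module_hom_closed[OF aug] by blast
      then obtain n :: nat where n: "\<And>a. a \<in> \<mm> [^]\<^bsub>ideals_set R\<^esub> n \<Longrightarrow> a \<odot>\<^bsub>\<Omega>\<^esub> ?aug f = \<zero>\<^bsub>\<Omega>\<^esub>"
        using assms(6) unfolding torsion_module_def by blast
      have yc: "y \<in> carrier R" using y \<mm>c by blast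
      then have yn: "y [^]\<^bsub>R\<^esub> n \<in> carrier R" by simp
      have "?aug (\<lambda>b. y [^]\<^bsub>R\<^esub> n \<otimes>\<^bsub>R\<^esub> f b) = y [^]\<^bsub>R\<^esub> n \<odot>\<^bsub>\<Omega>\<^esub> ?aug f"
        using module_hom_smult[OF aug yn f] by simp
      also have "\<dots> = \<zero>\<^bsub>\<Omega>\<^esub>" by (rule n[OF R.pow_mem_ideal_pow[OF yc y]])
      finally have "X.boundary {\<zero>\<^bsub>R\<^esub>} 0 (\<lambda>b. y [^]\<^bsub>R\<^esub> n \<otimes>\<^bsub>R\<^esub> f b)"
        using z0[OF X.C_closed(3)[OF yn f]] by blast
      then show "\<exists>n::nat. X.boundary {\<zero>\<^bsub>R\<^esub>} 0 (\<lambda>b. y [^]\<^bsub>R\<^esub> n \<otimes>\<^bsub>R\<^esub> f b)" by blast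
    qed
    \<comment> \<open>In degree 0 every element is a cycle, so vanishing would make the surjective
      augmentation zero.\<close>
    have "\<not> X.tor_zero {\<zero>\<^bsub>R\<^esub>} 0"
    proof
      assume z: "X.tor_zero {\<zero>\<^bsub>R\<^esub>} 0"
      have aug0: "?aug f = \<zero>\<^bsub>\<Omega>\<^esub>" if f: "f \<in> X.C 0" for f
      proof -
        have "X.cycle {\<zero>\<^bsub>R\<^esub>} 0 f" using f by (simp add: X.cycle_def)
        then show ?thesis using z z0[OF f] unfolding X.tor_zero_def by blast
      qed
      have "w = \<zero>\<^bsub>\<Omega>\<^esub>" if "w \<in> carrier \<Omega>" for w
      proof -
        have "w \<in> ?aug ` X.C 0"
          using that unfolding \<Omega>.res_aug_surj[unfolded res_module_def, symmetric] .
        then obtain f where "f \<in> X.C 0" "w = ?aug f" by (rule imageE) (rule that)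
        then show ?thesis using aug0[of f] by simp
      qed
      then have "carrier \<Omega> = {\<zero>\<^bsub>\<Omega>\<^esub>}" using \<Omega>.M.zero_closed by auto
      then show False using nz by contradiction
    qed
    from X.tor_regular_sequence[of J d "\<lambda>i. xs ! i" \<mm>, OF J0 JS _ \<mm>c tors this] nzd xi(1)
    have "\<not> X.tor_zero (J d) d" by blast
    moreover have "X.tor_zero (J d) d"
      by (rule X.tor_zero_of_residue_field[OF assms(1) \<mm> only V J])
    ultimately show False by blast
  qed
  ultimately show ?thesis using \<Omega>.betti_eq_0_iff[OF max] by blast
qed

end
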